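(* Let $(\mathcal{A},H,D)$ be an odd spectral triple for the (not necessarily unital) $C^*$-algebra $\mathcal{A}$, and assume that $D$ has compact resolvent. Let $\alpha$ be an automorphism of $\mathcal{A}$, consider the crossed product $\mathcal{A}\rtimes_\alpha\mathbb{Z}$, and assume that the dense subalgebra $\mathcal{A}_\infty$ of the spectral triple contains a dense $\alpha$-invariant subalgebra $\mathcal{A}_\infty'$ such that, for any fixed $a\in\mathcal{A}_\infty'$, the sequence of bounded operators $\{[D,\alpha^n(a)]\}_{n\in\mathbb{Z}}$ is uniformly bounded in the operator norm. Let $(C(S^1),\ell^2(\mathbb{Z}),\partial)$ be the standard spectral triple on the circle. Let $\mathcal{H}=\ell^2(\mathbb{Z},H)\oplus\ell^2(\mathbb{Z},H)$ be the direct sum of two copies of the Hilbert space of the regular representation of $\mathcal{A}\rtimes_\alpha\mathbb{Z}$ (acting diagonally), and let $$\mathcal{D}=\begin{pmatrix}0 & D_0^*\\ D_0 & 0\end{pmatrix},\qquad D_0=D\otimes 1+i\otimes\partial .$$ Then $(\mathcal{A}\rtimes_\alpha\mathbb{Z},\mathcal{H},\mathcal{D})$ is an even spectral triple with respect to the grading $\gamma=\begin{pmatrix}1&0\\0&-1\end{pmatrix}$ on $\mathcal{H}$. Moreover, if $(\mathcal{A},H,D)$ is $(p,\infty)$-summable, then $(\mathcal{A}\rtimes_\alpha\mathbb{Z},\mathcal{H},\mathcal{D})$ is $(p+1,\infty)$-summable.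
   Context: Spectral triple (possibly non-unital algebra): $(\mathcal{A},\mathcal{H},\mathcal{D})$ consists of a $C^*$-algebra $\mathcal{A}$, a representation $\pi:\mathcal{A}\to\mathcal{B}(\mathcal{H})$ on a separable Hilbert space $\mathcal{H}$, and an unbounded self-adjoint operator $\mathcal{D}$ on $\mathcal{H}$ such that the subalgebra $$\mathcal{A}_\infty:=\{a\in\mathcal{A} \mid a\,\mathrm{Dom}\,\mathcal{D}\subseteq \mathrm{Dom}\,\mathcal{D},\ [\mathcal{D},a] \text{ extends to a bounded operator on } \mathcal{H},\ a(1+\mathcal{D}^2)^{-1}\in\mathcal{K}(\mathcal{H})\}$$ is dense in $\mathcal{A}$, where $\mathcal{K}(\mathcal{H})$ is the ideal of compact operators. "Odd" means no grading is part of the data; "even" with respect to $\gamma$ ($\gamma=\gamma^*$, $\gamma^2=1$) means that $\gamma$ commutes with the represented algebra and anticommutes with $\mathcal{D}$. Regular representation: $\mathcal{A}\rtimes_\alpha\mathbb{Z}$ acts on $\ell^2(\mathbb{Z},H)=H\otimes\ell^2(\mathbb{Z})$ by $((a\otimes V^n)\xi)(k)=\alpha^k(a)(\xi(n+k))$ for $a\in\mathcal{A}$, $n,k\in\mathbb{Z}$, where $a\otimes V^n\in C_c(\mathbb{Z},\mathcal{A})\subset\mathcal{A}\rtimes_\alpha\mathbb{Z}$ and $V$ generates $C^*(\mathbb{Z})=C(S^1)$. The operator $\partial$ is the standard (diagonal) Dirac operator of the circle on $\ell^2(\mathbb{Z})$, with the sign convention that $(D_0\xi)(k)=D(\xi(k))-ik\,\xi(k)$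 for $k\in\mathbb{Z}$. $(p,\infty)$-summable: the singular values of $(1+\mathcal{D}^2)^{-1/2}$, in decreasing order $\mu_1\geq\mu_2\geq\cdots$, satisfy $\mu_n=O(n^{-1/p})$. *)

theory Defs
  imports "HOL-Analysis.Analysis" "HOL-Library.Poly_Mapping" "HOL-Library.Landau_Symbols"
begin

section \<open>Complex Hilbert spaces\<close>

class complex_vector = real_vector +
  fixes scaleC :: "complex \<Rightarrow> 'a \<Rightarrow> 'a" (infixr "*\<^sub>C" 75)
  assumes scaleC_add_right: "c *\<^sub>C (x + y) = c *\<^sub>C x + c *\<^sub>C y"
    and scaleC_add_left: "(c + d) *\<^sub>C x = c *\<^sub>C x + d *\<^sub>C x"
    and scaleC_scaleC: "c *\<^sub>C (d *\<^sub>C x) = (c * d) *\<^sub>C x"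
    and scaleC_of_real: "complex_of_real r *\<^sub>C x = r *\<^sub>R x"

text \<open>The inner product is linear in the second argument. Positive definiteness, the norm and
  completeness come from \<^class>\<open>real_inner\<close> and \<^class>\<open>complete_space\<close>, whose real inner
  product is the real part of the complex one.\<close>

class chilbert_space = complex_vector + real_inner + complete_space +
  fixes cinner :: "'a \<Rightarrow> 'a \<Rightarrow> complex"
  assumes cinner_commute: "cinner x y = cnj (cinner y x)"
    and cinner_add_right: "cinner x (y + z) = cinner x y + cinner x z"
    and cinner_scaleC_right: "cinner x (c *\<^sub>C y) = c * cinner x y"
    and inner_eq_Re_cinner: "inner x y = Re (cinner x y)"

lemma scaleC_one [simp]: "1 *\<^sub>C x = (x :: 'a::complex_vector)"
  using scaleC_of_real[of 1 x] by simp

lemma scaleC_zero_left [simp]: "0 *\<^sub>C x = (0 :: 'a::complex_vector)"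
  using scaleC_of_real[of 0 x] by simp

lemma cinner_scaleC_left: "cinner (c *\<^sub>C x) y = cnj c * cinner x (y :: 'a::chilbert_space)"
  by (metis cinner_commute cinner_scaleC_right complex_cnj_mult)

lemma cinner_self: "cinner x x = complex_of_real ((norm (x :: 'a::chilbert_space))\<^sup>2)"
proof -
  have "Im (cinner x x) = 0"
    using cinner_commute[of x x] by (metis add.inverse_neutral cnj.simps(2) equal_neg_zero)
  then show ?thesis
    by (simp add: complex_eq_iff inner_eq_Re_cinner[symmetric] power2_norm_eq_inner)
qed

lemma norm_scaleC: "norm (c *\<^sub>C x) = cmod c * norm (x :: 'a::chilbert_space)"
proof -
  have "complex_of_real ((norm (c *\<^sub>C x))\<^sup>2) = cnj c * c * complex_of_real ((norm x)\<^sup>2)"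
    by (simp only: cinner_self[symmetric] cinner_scaleC_right cinner_scaleC_left mult_ac)
  also have "cnj c * c = complex_of_real ((cmod c)\<^sup>2)"
    by (metis complex_norm_square mult.commute)
  finally have "(norm (c *\<^sub>C x))\<^sup>2 = (cmod c * norm x)\<^sup>2"
    by (metis of_real_eq_iff of_real_mult power_mult_distrib)
  then show ?thesis
    by (metis mult_nonneg_nonneg norm_ge_zero power2_eq_imp_eq)
qed

lemma cmod_cinner_le: "cmod (cinner x y) \<le> norm x * norm (y :: 'a::chilbert_space)"
proof (cases "cinner x y = 0")
  case False
  define u where "u = cnj (sgn (cinner x y))"
  have u: "cmod u = 1" using False by (simp add: u_def norm_sgn)
  have "cinner x (u *\<^sub>C y) = complex_of_real (cmod (cinner x y))"
  proof -
    have "cnj (cinner x y) * cinner x y = complex_of_real ((cmod (cinner x y))\<^sup>2)"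
      by (metis complex_norm_square mult.commute)
    then show ?thesis
      using False
      by (simp add: u_def cinner_scaleC_right sgn_eq field_simps power2_eq_square)
  qed
  then have "cmod (cinner x y) = inner x (u *\<^sub>C y)" by (simp add: inner_eq_Re_cinner)
  also have "\<dots> \<le> norm x * norm (u *\<^sub>C y)" by (rule norm_cauchy_schwarz)
  finally show ?thesis by (simp add: norm_scaleC u)
qed simp

instantiation prod :: (complex_vector, complex_vector) complex_vector
begin
definition "c *\<^sub>C (x :: 'a \<times> 'b) = (c *\<^sub>C fst x, c *\<^sub>C snd x)"
instance
  by standard (auto simp: scaleC_prod_def scaleC_add_right scaleC_add_left scaleC_scaleC
      scaleC_of_real prod_eq_iff)
end

instantiation prod :: (chilbert_space, chilbert_space) chilbert_space
begin
definition "cinner (x :: 'a \<times> 'b) y = cinner (fst x) (fst y) + cinner (snd x) (snd y)"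
instance
proof
  fix x y z :: "'a \<times> 'b" and c :: complex
  show "cinner x y = cnj (cinner y x)"
    by (simp add: cinner_prod_def cinner_commute[of "fst x"] cinner_commute[of "snd x"])
  show "cinner x (y + z) = cinner x y + cinner x z"
    by (simp add: cinner_prod_def cinner_add_right)
  show "cinner x (c *\<^sub>C y) = c * cinner x y"
    by (simp add: cinner_prod_def scaleC_prod_def cinner_scaleC_right distrib_left)
  show "inner x y = Re (cinner x y)"
    by (simp add: cinner_prod_def inner_prod_def inner_eq_Re_cinner)
qed
end


section \<open>The Hilbert space of square-summable two-sided sequences in a Hilbert space\<close>

typedef (overloaded) 'h l2Z =
  "{f :: int \<Rightarrow> 'h::chilbert_space. (\<lambda>k. (norm (f k))\<^sup>2) summable_on UNIV}"
  morphisms coord Abs_l2Z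
  by (rule exI[of _ "\<lambda>_. 0"]) simp

lemma coord_summable: "(\<lambda>k. (norm (coord x k))\<^sup>2) summable_on UNIV"
  using coord[of x] by simp

lemma coord_Abs: "(\<lambda>k. (norm (f k))\<^sup>2) summable_on UNIV \<Longrightarrow> coord (Abs_l2Z f) = f"
  by (simp add: Abs_l2Z_inverse)

lemma l2Z_eqI: "(\<And>k. coord x k = coord y k) \<Longrightarrow> x = y"
  by (metis coord_inject ext)

lemma l2Z_add_summable:
  fixes f g :: "int \<Rightarrow> 'h::chilbert_space"
  assumes "(\<lambda>k. (norm (f k))\<^sup>2) summable_on UNIV" "(\<lambda>k. (norm (g k))\<^sup>2) summable_on UNIV"
  shows "(\<lambda>k. (norm (f k + g k))\<^sup>2) summable_on UNIV"
proof (rule summable_on_comparison_test)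
  show "(\<lambda>k. 2 * (norm (f k))\<^sup>2 + 2 * (norm (g k))\<^sup>2) summable_on UNIV"
    by (intro summable_on_add summable_on_cmult_right assms)
  show "(norm (f k + g k))\<^sup>2 \<le> 2 * (norm (f k))\<^sup>2 + 2 * (norm (g k))\<^sup>2" for k
  proof -
    have "(norm (f k + g k))\<^sup>2 \<le> (norm (f k) + norm (g k))\<^sup>2"
      by (simp add: norm_triangle_ineq power_mono)
    also have "\<dots> \<le> 2 * (norm (f k))\<^sup>2 + 2 * (norm (g k))\<^sup>2"
      using sum_squares_ge_zero[of "norm (f k) - norm (g k)" 0]
      by (simp add: power2_eq_square algebra_simps)
    finally show ?thesis .
  qed
qed auto

lemma l2Z_scaleC_summable:
  fixes f :: "int \<Rightarrow> 'h::chilbert_space"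
  assumes "(\<lambda>k. (norm (f k))\<^sup>2) summable_on UNIV"
  shows "(\<lambda>k. (norm (c *\<^sub>C f k))\<^sup>2) summable_on UNIV"
  unfolding norm_scaleC power_mult_distrib by (intro summable_on_cmult_right assms)

lemma cinner_coord_summable: "(\<lambda>k. cinner (coord x k) (coord y k)) summable_on UNIV"
proof (rule abs_summable_summable, rule summable_on_comparison_test)
  show "(\<lambda>k. (norm (coord x k))\<^sup>2 + (norm (coord y k))\<^sup>2) summable_on UNIV"
    by (intro summable_on_add coord_summable)
  show "cmod (cinner (coord x k) (coord y k)) \<le> (norm (coord x k))\<^sup>2 + (norm (coord y k))\<^sup>2" for k
  proof -
    have "norm (coord x k) * norm (coord y k) \<le> (norm (coord x k))\<^sup>2 + (norm (coord y k))\<^sup>2"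
      using sum_squares_bound[of "norm (coord x k)" "norm (coord y k)"]
        mult_nonneg_nonneg[OF norm_ge_zero norm_ge_zero, of "coord x k" "coord y k"] by linarith
    then show ?thesis using cmod_cinner_le order_trans by blast
  qed
qed auto

lemma inner_coord_summable: "(\<lambda>k. inner (coord x k) (coord y k)) summable_on UNIV"
  unfolding inner_eq_Re_cinner by (rule summable_on_Re[OF cinner_coord_summable])

instantiation l2Z :: (chilbert_space) complex_vector
begin
definition "0 = Abs_l2Z (\<lambda>_. 0)"
definition "x + y = Abs_l2Z (\<lambda>k. coord x k + coord y k)"
definition "- x = Abs_l2Z (\<lambda>k. - coord x k)"
definition "x - y = Abs_l2Z (\<lambda>k. coord x k - coord y k)"
definition "r *\<^sub>R x = Abs_l2Z (\<lambda>k. r *\<^sub>R coord x k)"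
definition "c *\<^sub>C x = Abs_l2Z (\<lambda>k. c *\<^sub>C coord x k)"

lemma coord_zero [simp]: "coord 0 = (\<lambda>_. 0 :: 'a)"
  unfolding zero_l2Z_def by (rule coord_Abs) simp

lemma coord_plus [simp]: "coord (x + y :: 'a l2Z) = (\<lambda>k. coord x k + coord y k)"
  unfolding plus_l2Z_def by (rule coord_Abs) (intro l2Z_add_summable coord_summable)

lemma coord_uminus [simp]: "coord (- x :: 'a l2Z) = (\<lambda>k. - coord x k)"
  unfolding uminus_l2Z_def by (rule coord_Abs) (simp add: coord_summable)

lemma coord_minus [simp]: "coord (x - y :: 'a l2Z) = (\<lambda>k. coord x k - coord y k)"
  unfolding minus_l2Z_def
  using l2Z_add_summable[OF coord_summable[of x] coord_summable[of "- y"]]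
  by (intro coord_Abs) simp

lemma coord_scaleC [simp]: "coord (c *\<^sub>C x :: 'a l2Z) = (\<lambda>k. c *\<^sub>C coord x k)"
  unfolding scaleC_l2Z_def by (rule coord_Abs) (intro l2Z_scaleC_summable coord_summable)

lemma coord_scaleR [simp]: "coord (r *\<^sub>R x :: 'a l2Z) = (\<lambda>k. r *\<^sub>R coord x k)"
  unfolding scaleR_l2Z_def
  using l2Z_scaleC_summable[OF coord_summable[of x], of "complex_of_real r"]
  by (intro coord_Abs) (simp only: scaleC_of_real)

instance
  by standard (rule l2Z_eqI; simp add: algebra_simps scaleC_add_right scaleC_add_left
      scaleC_scaleC scaleC_of_real)+
end

instantiation l2Z :: (chilbert_space) real_inner
begin
definition "inner x y = (\<Sum>\<^sub>\<infinity>k. inner (coord x k) (coord y k))"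
definition "norm (x :: 'a l2Z) = sqrt (inner x x)"
definition "sgn (x :: 'a l2Z) = x /\<^sub>R norm x"
definition "dist x y = norm (x - y :: 'a l2Z)"
definition "uniformity = (INF e\<in>{0 <..}. principal {(x, y :: 'a l2Z). dist x y < e})"
definition "open (U :: 'a l2Z set) =
  (\<forall>x\<in>U. eventually (\<lambda>(x', y). x' = x \<longrightarrow> y \<in> U) uniformity)"
instance
proof
  fix x y z :: "'a l2Z" and r :: real
  show "inner x y = inner y x"
    by (simp add: inner_l2Z_def inner_commute)
  show "inner (x + y) z = inner x z + inner y z"
    by (simp add: inner_l2Z_def inner_add_left infsum_add inner_coord_summable)
  show "inner (r *\<^sub>R x) y = r * inner x y"
    by (simp add: inner_l2Z_def infsum_cmult_right inner_coord_summable)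
  show nn: "0 \<le> inner x x"
    by (simp add: inner_l2Z_def infsum_nonneg)
  show "inner x x = 0 \<longleftrightarrow> x = 0"
  proof
    assume "inner x x = 0"
    then have s: "(\<Sum>\<^sub>\<infinity>k. inner (coord x k) (coord x k)) = 0" by (simp add: inner_l2Z_def)
    have "inner (coord x k) (coord x k) = 0" for k
      by (rule nonneg_infsum_le_0D[OF eq_refl[OF s] inner_coord_summable]) auto
    then show "x = 0" by (intro l2Z_eqI) simp
  qed (simp add: inner_l2Z_def)
qed (simp_all add: norm_l2Z_def sgn_l2Z_def dist_l2Z_def uniformity_l2Z_def open_l2Z_def)
end

lemma norm_l2Z_sq: "(norm (x :: 'h::chilbert_space l2Z))\<^sup>2 = (\<Sum>\<^sub>\<infinity>k. (norm (coord x k))\<^sup>2)"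
  by (simp add: power2_norm_eq_inner inner_l2Z_def)

lemma sum_coord_le: "finite F \<Longrightarrow> (\<Sum>k\<in>F. (norm (coord x k))\<^sup>2) \<le> (norm x)\<^sup>2"
  unfolding norm_l2Z_sq by (rule finite_sum_le_infsum) (auto simp: coord_summable)

lemma norm_coord_le: "norm (coord x k) \<le> norm x"
  by (rule power2_le_imp_le[OF _ norm_ge_zero]) (use sum_coord_le[of "{k}" x] in simp)

instance l2Z :: (chilbert_space) complete_space
proof
  fix X :: "nat \<Rightarrow> 'a l2Z" assume X: "Cauchy X"
  have "Cauchy (\<lambda>n. coord (X n) k)" for k
  proof (rule CauchyI)
    fix e :: real assume "0 < e"
    then obtain M where M: "\<forall>m\<ge>M. \<forall>n\<ge>M. norm (X m - X n) < e" using CauchyD[OF X] by blast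
    have "norm (coord (X m) k - coord (X n) k) < e" if "m \<ge> M" "n \<ge> M" for m n
      by (rule le_less_trans[OF norm_coord_le[of "X m - X n" k, unfolded coord_minus]])
        (use M that in blast)
    then show "\<exists>M. \<forall>m\<ge>M. \<forall>n\<ge>M. norm (coord (X m) k - coord (X n) k) < e" by blast
  qed
  then have "\<exists>l. (\<lambda>n. coord (X n) k) \<longlonglongrightarrow> l" for k
    using Cauchy_convergent convergent_def by blast
  then obtain L where L: "\<And>k. (\<lambda>n. coord (X n) k) \<longlonglongrightarrow> L k" by metis
  have fin: "(\<Sum>k\<in>F. (norm (coord (X m) k - L k))\<^sup>2) \<le> e\<^sup>2"
    if N: "\<forall>m\<ge>N. \<forall>n\<ge>N. norm (X m - X n) < e" and m: "m \<ge> N" and F: "finite F" for m N e F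
  proof (rule LIMSEQ_le_const2)
    show "(\<lambda>n. \<Sum>k\<in>F. (norm (coord (X m) k - coord (X n) k))\<^sup>2)
        \<longlonglongrightarrow> (\<Sum>k\<in>F. (norm (coord (X m) k - L k))\<^sup>2)"
      by (intro tendsto_intros L)
    have "(\<Sum>k\<in>F. (norm (coord (X m) k - coord (X n) k))\<^sup>2) \<le> e\<^sup>2" if "n \<ge> N" for n
    proof -
      have "(\<Sum>k\<in>F. (norm (coord (X m) k - coord (X n) k))\<^sup>2) \<le> (norm (X m - X n))\<^sup>2"
        using sum_coord_le[OF F, of "X m - X n"] by simp
      also have "\<dots> \<le> e\<^sup>2" using N m that by (intro power_mono) (auto intro: less_imp_le)
      finally show ?thesis .
    qed
    then show "\<exists>N. \<forall>n\<ge>N. (\<Sum>k\<in>F. (norm (coord (X m) k - coord (X n) k))\<^sup>2) \<le> e\<^sup>2" by blast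
  qed
  have diff: "(\<lambda>k. (norm (coord (X m) k - L k))\<^sup>2) summable_on UNIV"
    if "\<forall>m\<ge>N. \<forall>n\<ge>N. norm (X m - X n) < e" "m \<ge> N" for m N e
    by (rule nonneg_bdd_above_summable_on) (use fin[OF that] in \<open>auto simp: bdd_above_def\<close>)
  obtain N1 where N1: "\<forall>m\<ge>N1. \<forall>n\<ge>N1. norm (X m - X n) < 1"
    using CauchyD[OF X, of 1] by auto
  have "(\<lambda>k. (norm (coord (X N1) k + (- (coord (X N1) k - L k)))) \<^sup>2) summable_on UNIV"
    using diff[OF N1 order_refl]
    by (intro l2Z_add_summable coord_summable) (simp only: norm_minus_cancel)
  then have cL: "coord (Abs_l2Z L) = L" by (intro coord_Abs) simp
  have "X \<longlonglongrightarrow> Abs_l2Z L"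
  proof (rule LIMSEQ_I)
    fix e :: real assume e: "0 < e"
    then obtain N where N: "\<forall>m\<ge>N. \<forall>n\<ge>N. norm (X m - X n) < e / 2"
      using CauchyD[OF X, of "e / 2"] by auto
    have "norm (X m - Abs_l2Z L) < e" if m: "m \<ge> N" for m
    proof -
      have "(norm (X m - Abs_l2Z L))\<^sup>2 \<le> (e / 2)\<^sup>2"
        unfolding norm_l2Z_sq coord_minus cL
        by (rule infsum_le_finite_sums[OF diff[OF N m] fin[OF N m]])
      then have "norm (X m - Abs_l2Z L) \<le> e / 2"
        by (rule power2_le_imp_le) (use e in simp)
      with e show ?thesis by linarith
    qed
    then show "\<exists>no. \<forall>n\<ge>no. norm (X n - Abs_l2Z L) < e" by blast
  qed
  then show "convergent X" by (auto simp: convergent_def)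
qed

instantiation l2Z :: (chilbert_space) chilbert_space
begin
definition "cinner x y = (\<Sum>\<^sub>\<infinity>k. cinner (coord x k) (coord y k))"
instance
proof
  fix x y z :: "'a l2Z" and c :: complex
  show "cinner x y = cnj (cinner y x)"
    unfolding cinner_l2Z_def infsum_cnj[symmetric] by (simp add: cinner_commute[symmetric])
  show "cinner x (y + z) = cinner x y + cinner x z"
    by (simp add: cinner_l2Z_def cinner_add_right infsum_add cinner_coord_summable)
  show "cinner x (c *\<^sub>C y) = c * cinner x y"
    by (simp add: cinner_l2Z_def cinner_scaleC_right infsum_cmult_right cinner_coord_summable)
  show "inner x y = Re (cinner x y)"
    unfolding cinner_l2Z_def infsum_Re[OF cinner_coord_summable, symmetric] inner_l2Z_def
    by (simp add: inner_eq_Re_cinner)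
qed
end


section \<open>Bounded and unbounded operators\<close>

definition bounded_clinear ::
    "('h::chilbert_space \<Rightarrow> 'k::chilbert_space) \<Rightarrow> bool" where
  "bounded_clinear T \<longleftrightarrow> bounded_linear T \<and> (\<forall>c x. T (c *\<^sub>C x) = c *\<^sub>C T x)"

definition compact_op :: "('h::chilbert_space \<Rightarrow> 'k::chilbert_space) \<Rightarrow> bool" where
  "compact_op T \<longleftrightarrow> bounded_clinear T \<and> compact (closure (T ` cball 0 1))"

text \<open>An unbounded operator \<open>T\<close> is a partial map with domain \<^term>\<open>dom T\<close>; a bounded operator
  \<open>S\<close> is the everywhere defined partial map \<open>Some \<circ> S\<close>. Composition on the maximal domain is
  \<open>\<circ>\<^sub>m\<close>.\<close>

definition op_linear :: "('h::chilbert_space \<rightharpoonup> 'k::chilbert_space) \<Rightarrow> bool" where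
  "op_linear T \<longleftrightarrow> T 0 = Some 0 \<and>
     (\<forall>x\<in>dom T. \<forall>y\<in>dom T. T (x + y) = Some (the (T x) + the (T y))) \<and>
     (\<forall>x\<in>dom T. \<forall>c. T (c *\<^sub>C x) = Some (c *\<^sub>C the (T x)))"

definition densely_defined :: "('h::chilbert_space \<rightharpoonup> 'k::chilbert_space) \<Rightarrow> bool" where
  "densely_defined T \<longleftrightarrow> op_linear T \<and> closure (dom T) = UNIV"

text \<open>For densely defined \<open>T\<close> the vector \<open>z\<close> is unique.\<close>

definition op_adjoint ::
    "('h::chilbert_space \<rightharpoonup> 'k::chilbert_space) \<Rightarrow> ('k \<rightharpoonup> 'h)" where
  "op_adjoint T y =
     (if \<exists>z. \<forall>x\<in>dom T. cinner (the (T x)) y = cinner x z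
      then Some (THE z. \<forall>x\<in>dom T. cinner (the (T x)) y = cinner x z)
      else None)"

definition self_adjoint :: "('h::chilbert_space \<rightharpoonup> 'h) \<Rightarrow> bool" where
  "self_adjoint T \<longleftrightarrow> densely_defined T \<and> op_adjoint T = T"

definition op_add ::
    "('h \<rightharpoonup> 'k::chilbert_space) \<Rightarrow> ('h \<rightharpoonup> 'k) \<Rightarrow> ('h \<rightharpoonup> 'k)" where
  "op_add S T x = (if x \<in> dom S \<inter> dom T then Some (the (S x) + the (T x)) else None)"

text \<open>\<open>op_bij T\<close>: \<open>T\<close> maps its domain bijectively onto the whole space. Then \<open>op_inv T\<close> is the
  everywhere defined inverse.\<close>

definition op_bij :: "('h \<rightharpoonup> 'k) \<Rightarrow> bool" where
  "op_bij T \<longleftrightarrow> (\<forall>y. \<exists>!x. T x = Some y)"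

definition op_inv :: "('h \<rightharpoonup> 'k) \<Rightarrow> ('k \<Rightarrow> 'h)" where
  "op_inv T y = (THE x. T x = Some y)"

definition compact_resolvent :: "('h::chilbert_space \<rightharpoonup> 'h) \<Rightarrow> bool" where
  "compact_resolvent T \<longleftrightarrow> (\<exists>c. let R = op_add T (\<lambda>x. Some (- (c *\<^sub>C x))) in
     op_bij R \<and> compact_op (op_inv R))"

text \<open>The bounded operator \<open>(1 + D\<^sup>2)\<^sup>-\<^sup>1\<close> for self-adjoint \<open>D\<close>.\<close>

definition inv_one_plus_sq :: "('h::chilbert_space \<rightharpoonup> 'h) \<Rightarrow> ('h \<Rightarrow> 'h)" where
  "inv_one_plus_sq D = op_inv (op_add Some (D \<circ>\<^sub>m D))"


section \<open>Summability\<close>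

definition positive_op :: "('h::chilbert_space \<Rightarrow> 'h) \<Rightarrow> bool" where
  "positive_op S \<longleftrightarrow> bounded_clinear S \<and> (\<forall>x. cinner x (S x) \<in> \<real> \<and> 0 \<le> Re (cinner x (S x)))"

definition op_sqrt :: "('h::chilbert_space \<Rightarrow> 'h) \<Rightarrow> ('h \<Rightarrow> 'h)" where
  "op_sqrt R = (THE S. positive_op S \<and> S \<circ> S = R)"

text \<open>For compact \<open>T\<close> and \<open>n \<ge> 1\<close>, \<open>singular_value T n\<close> is the \<open>n\<close>-th term of the decreasing
  sequence of singular values, i.e. of the square roots of the eigenvalues of \<open>T\<^sup>*T\<close>, counted
  with multiplicity and continued by \<open>0\<close>: it is at least \<open>s > 0\<close> iff there are \<open>n\<close> orthonormal
  eigenvectors of \<open>T\<^sup>*T\<close> whose eigenvalues \<open>t\<^sup>2\<close> satisfy \<open>t \<ge> s\<close>.\<close>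

definition singular_value :: "('h::chilbert_space \<Rightarrow> 'h) \<Rightarrow> nat \<Rightarrow> real" where
  "singular_value T n = Sup ({0} \<union> {s. 0 \<le> s \<and>
     (\<exists>B. finite B \<and> card B = n \<and>
        (\<forall>v\<in>B. \<forall>w\<in>B. cinner v w = (if v = w then 1 else 0)) \<and>
        (\<forall>v\<in>B. \<exists>t\<ge>s. op_adjoint (Some \<circ> T) (T v) = Some (complex_of_real (t\<^sup>2) *\<^sub>C v)))})"

text \<open>\<open>(p,\<infinity>)\<close>-summability. A sequence of singular values is only available for compact operators,
  so compactness of \<open>(1 + D\<^sup>2)\<^sup>-\<^sup>1\<^sup>/\<^sup>2\<close> is part of the definition.\<close>

definition weakly_summable :: "real \<Rightarrow> ('h::chilbert_space \<rightharpoonup> 'h) \<Rightarrow> bool" where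
  "weakly_summable p D \<longleftrightarrow>
     compact_op (op_sqrt (inv_one_plus_sq D)) \<and>
     (\<lambda>n. singular_value (op_sqrt (inv_one_plus_sq D)) n) \<in> O(\<lambda>n. real n powr (- (1 / p)))"


section \<open>C*-algebras and spectral triples\<close>

text \<open>Not necessarily unital: \<^class>\<open>real_normed_algebra\<close> has no unit.\<close>

class cstar_algebra = complex_vector + real_normed_algebra + complete_space +
  fixes star :: "'a \<Rightarrow> 'a"
  assumes scaleC_mult_left: "(c *\<^sub>C x) * y = c *\<^sub>C (x * y)"
    and scaleC_mult_right: "x * (c *\<^sub>C y) = c *\<^sub>C (x * y)"
    and norm_scaleC_cstar: "norm (c *\<^sub>C x) = cmod c * norm x"
    and star_add: "star (x + y) = star x + star y"
    and star_scaleC: "star (c *\<^sub>C x) = cnj c *\<^sub>C star x"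
    and star_mult: "star (x * y) = star y * star x"
    and star_star: "star (star x) = x"
    and cstar_identity: "norm (star x * x) = (norm x)\<^sup>2"

definition representation :: "('a::cstar_algebra \<Rightarrow> 'h::chilbert_space \<Rightarrow> 'h) \<Rightarrow> bool" where
  "representation \<pi> \<longleftrightarrow>
     (\<forall>a. bounded_clinear (\<pi> a)) \<and>
     (\<forall>a b x. \<pi> (a + b) x = \<pi> a x + \<pi> b x) \<and>
     (\<forall>c a x. \<pi> (c *\<^sub>C a) x = c *\<^sub>C \<pi> a x) \<and>
     (\<forall>a b x. \<pi> (a * b) x = \<pi> a (\<pi> b x)) \<and>
     (\<forall>a. op_adjoint (Some \<circ> \<pi> a) = Some \<circ> \<pi> (star a))"

text \<open>\<open>bounded_commutator D S T\<close>: \<open>S\<close> preserves the domain of \<open>D\<close> and the bounded operator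
  \<open>T\<close> extends \<open>[D, S]\<close>.\<close>

definition bounded_commutator ::
    "('h::chilbert_space \<rightharpoonup> 'h) \<Rightarrow> ('h \<Rightarrow> 'h) \<Rightarrow> ('h \<Rightarrow> 'h) \<Rightarrow> bool" where
  "bounded_commutator D S T \<longleftrightarrow> bounded_clinear T \<and> S ` dom D \<subseteq> dom D \<and>
     (\<forall>x\<in>dom D. T x = the (D (S x)) - S (the (D x)))"

definition smooth_algebra ::
    "('a::cstar_algebra \<Rightarrow> 'h::chilbert_space \<Rightarrow> 'h) \<Rightarrow> ('h \<rightharpoonup> 'h) \<Rightarrow> 'a set" where
  "smooth_algebra \<pi> D =
     {a. (\<exists>T. bounded_commutator D (\<pi> a) T) \<and> compact_op (\<pi> a \<circ> inv_one_plus_sq D)}"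

definition spectral_triple ::
    "('a::cstar_algebra \<Rightarrow> 'h::chilbert_space \<Rightarrow> 'h) \<Rightarrow> ('h \<rightharpoonup> 'h) \<Rightarrow> bool" where
  "spectral_triple \<pi> D \<longleftrightarrow>
     (\<exists>S :: 'h set. countable S \<and> closure S = UNIV) \<and>
     representation \<pi> \<and> self_adjoint D \<and> closure (smooth_algebra \<pi> D) = UNIV"

text \<open>An odd spectral triple is one without further data.\<close>

abbreviation odd_spectral_triple ::
    "('a::cstar_algebra \<Rightarrow> 'h::chilbert_space \<Rightarrow> 'h) \<Rightarrow> ('h \<rightharpoonup> 'h) \<Rightarrow> bool" where
  "odd_spectral_triple \<equiv> spectral_triple"

definition even_spectral_triple ::
    "('a::cstar_algebra \<Rightarrow> 'h::chilbert_space \<Rightarrow> 'h) \<Rightarrow> ('h \<rightharpoonup> 'h) \<Rightarrow> ('h \<Rightarrow> 'h) \<Rightarrow> bool" where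
  "even_spectral_triple \<pi> D \<gamma> \<longleftrightarrow> spectral_triple \<pi> D \<and>
     bounded_clinear \<gamma> \<and> self_adjoint (Some \<circ> \<gamma>) \<and> \<gamma> \<circ> \<gamma> = id \<and>
     (\<forall>a. \<gamma> \<circ> \<pi> a = \<pi> a \<circ> \<gamma>) \<and>
     \<gamma> ` dom D \<subseteq> dom D \<and> (\<forall>x\<in>dom D. the (D (\<gamma> x)) = - \<gamma> (the (D x)))"

definition complex_subalgebra :: "'a::cstar_algebra set \<Rightarrow> bool" where
  "complex_subalgebra B \<longleftrightarrow> 0 \<in> B \<and>
     (\<forall>a\<in>B. \<forall>b\<in>B. a + b \<in> B \<and> a * b \<in> B) \<and> (\<forall>c. \<forall>a\<in>B. c *\<^sub>C a \<in> B)"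


section \<open>Crossed products by the integers\<close>

definition cstar_automorphism :: "('a::cstar_algebra \<Rightarrow> 'a) \<Rightarrow> bool" where
  "cstar_automorphism \<alpha> \<longleftrightarrow> bij \<alpha> \<and>
     (\<forall>a b. \<alpha> (a + b) = \<alpha> a + \<alpha> b) \<and> (\<forall>c a. \<alpha> (c *\<^sub>C a) = c *\<^sub>C \<alpha> a) \<and>
     (\<forall>a b. \<alpha> (a * b) = \<alpha> a * \<alpha> b) \<and> (\<forall>a. \<alpha> (star a) = star (\<alpha> a))"

definition zpow :: "('a \<Rightarrow> 'a) \<Rightarrow> int \<Rightarrow> 'a \<Rightarrow> 'a" where
  "zpow \<alpha> n = (if 0 \<le> n then \<alpha> ^^ nat n else inv \<alpha> ^^ nat (- n))"

text \<open>The *-algebra of finitely supported functions from the integers to \<open>A\<close> is carried by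
  \<^typ>\<open>int \<Rightarrow>\<^sub>0 'a\<close>, with \<^term>\<open>Poly_Mapping.single n a\<close> for \<open>a \<otimes> V\<^sup>n\<close>. Product and involution are
  determined by
  \<open>(a \<otimes> V\<^sup>n) (b \<otimes> V\<^sup>m) = a \<alpha>\<^sup>n(b) \<otimes> V\<^sup>n\<^sup>+\<^sup>m\<close> and \<open>(a \<otimes> V\<^sup>n)\<^sup>* = \<alpha>\<^sup>-\<^sup>n(a\<^sup>*) \<otimes> V\<^sup>-\<^sup>n\<close>;
  this is not the (untwisted) product that \<^theory>\<open>HOL-Library.Poly_Mapping\<close> provides.\<close>

definition cc_scaleC :: "complex \<Rightarrow> (int \<Rightarrow>\<^sub>0 'a::cstar_algebra) \<Rightarrow> (int \<Rightarrow>\<^sub>0 'a)" where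
  "cc_scaleC c f = (\<Sum>n\<in>Poly_Mapping.keys f.
     Poly_Mapping.single n (c *\<^sub>C Poly_Mapping.lookup f n))"

definition cc_mult ::
    "('a::cstar_algebra \<Rightarrow> 'a) \<Rightarrow> (int \<Rightarrow>\<^sub>0 'a) \<Rightarrow> (int \<Rightarrow>\<^sub>0 'a) \<Rightarrow> (int \<Rightarrow>\<^sub>0 'a)" where
  "cc_mult \<alpha> f g = (\<Sum>n\<in>Poly_Mapping.keys f. \<Sum>m\<in>Poly_Mapping.keys g.
     Poly_Mapping.single (n + m) (Poly_Mapping.lookup f n * zpow \<alpha> n (Poly_Mapping.lookup g m)))"

definition cc_star :: "('a::cstar_algebra \<Rightarrow> 'a) \<Rightarrow> (int \<Rightarrow>\<^sub>0 'a) \<Rightarrow> (int \<Rightarrow>\<^sub>0 'a)" where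
  "cc_star \<alpha> f = (\<Sum>n\<in>Poly_Mapping.keys f.
     Poly_Mapping.single (- n) (zpow \<alpha> (- n) (star (Poly_Mapping.lookup f n))))"

definition l1_norm :: "(int \<Rightarrow>\<^sub>0 'a::cstar_algebra) \<Rightarrow> real" where
  "l1_norm f = (\<Sum>n\<in>Poly_Mapping.keys f. norm (Poly_Mapping.lookup f n))"

definition cc_seminorm ::
    "('a::cstar_algebra \<Rightarrow> 'a) \<Rightarrow> ((int \<Rightarrow>\<^sub>0 'a) \<Rightarrow> real) \<Rightarrow> bool" where
  "cc_seminorm \<alpha> q \<longleftrightarrow>
     (\<forall>f. 0 \<le> q f \<and> q f \<le> l1_norm f) \<and>
     (\<forall>f g. q (f + g) \<le> q f + q g) \<and> (\<forall>c f. q (cc_scaleC c f) = cmod c * q f) \<and>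
     (\<forall>f g. q (cc_mult \<alpha> f g) \<le> q f * q g) \<and> (\<forall>f. q (cc_mult \<alpha> (cc_star \<alpha> f) f) = (q f)\<^sup>2)"

text \<open>The norm of the enveloping C*-algebra of \<open>\<ell>\<^sup>1(Z, A)\<close>. The seminorms over which the supremum
  is taken are precisely the functions \<open>f \<mapsto> \<parallel>\<rho>(f)\<parallel>\<close> for *-representations \<open>\<rho>\<close> of
  \<open>\<ell>\<^sup>1(Z, A)\<close>, equivalently for covariant representations of \<open>(A, \<alpha>)\<close>.\<close>

definition crossed_product_norm ::
    "('a::cstar_algebra \<Rightarrow> 'a) \<Rightarrow> (int \<Rightarrow>\<^sub>0 'a) \<Rightarrow> real" where
  "crossed_product_norm \<alpha> f = (SUP q\<in>Collect (cc_seminorm \<alpha>). q f)"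

text \<open>\<open>crossed_product \<alpha> \<iota>\<close>: the C*-algebra \<open>'b\<close> is the crossed product of \<open>'a\<close> by \<open>\<alpha>\<close>, that is,
  the completion of the finitely supported functions in the above norm; \<open>\<iota>\<close> is the canonical
  map into this completion. (As the completion depends on \<open>\<alpha>\<close>, it cannot be a type constructor
  applied to \<open>'a\<close>; the pair \<open>('b, \<iota>)\<close> is unique up to isomorphism.)\<close>

definition crossed_product ::
    "('a::cstar_algebra \<Rightarrow> 'a) \<Rightarrow> ((int \<Rightarrow>\<^sub>0 'a) \<Rightarrow> 'b::cstar_algebra) \<Rightarrow> bool" where
  "crossed_product \<alpha> \<iota> \<longleftrightarrow>
     (\<forall>f g. \<iota> (f + g) = \<iota> f + \<iota> g) \<and> (\<forall>c f. \<iota> (cc_scaleC c f) = c *\<^sub>C \<iota> f) \<and>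
     (\<forall>f g. \<iota> (cc_mult \<alpha> f g) = \<iota> f * \<iota> g) \<and> (\<forall>f. \<iota> (cc_star \<alpha> f) = star (\<iota> f)) \<and>
     (\<forall>f. norm (\<iota> f) = crossed_product_norm \<alpha> f) \<and> closure (range \<iota>) = UNIV"

definition regular_representation ::
    "('a::cstar_algebra \<Rightarrow> 'h::chilbert_space \<Rightarrow> 'h) \<Rightarrow> ('a \<Rightarrow> 'a) \<Rightarrow>
     ((int \<Rightarrow>\<^sub>0 'a) \<Rightarrow> 'b::cstar_algebra) \<Rightarrow> 'b \<Rightarrow> 'h l2Z \<Rightarrow> 'h l2Z" where
  "regular_representation \<pi> \<alpha> \<iota> = (THE \<rho>. representation \<rho> \<and>
     (\<forall>a n \<xi> k. coord (\<rho> (\<iota> (Poly_Mapping.single n a)) \<xi>) k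
        = \<pi> (zpow \<alpha> k a) (coord \<xi> (n + k))))"


section \<open>The operator on the crossed product\<close>

text \<open>\<open>tensor_diag S \<lambda>\<close> is \<open>S \<otimes> diag(\<lambda>\<^sub>k)\<close> on \<open>H \<otimes> \<ell>\<^sup>2(Z) = \<ell>\<^sup>2(Z, H)\<close>, on its maximal domain.\<close>

definition tensor_diag ::
    "('h::chilbert_space \<rightharpoonup> 'h) \<Rightarrow> (int \<Rightarrow> complex) \<Rightarrow> ('h l2Z \<rightharpoonup> 'h l2Z)" where
  "tensor_diag S l \<xi> =
     (if (\<forall>k. coord \<xi> k \<in> dom S) \<and>
         (\<lambda>k. (norm (l k *\<^sub>C the (S (coord \<xi> k))))\<^sup>2) summable_on UNIV
      then Some (Abs_l2Z (\<lambda>k. l k *\<^sub>C the (S (coord \<xi> k))))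
      else None)"

text \<open>The eigenvalues of the Dirac operator \<open>\<partial>\<close> of the circle on \<open>\<ell>\<^sup>2(Z)\<close>. The sign is the one for
  which \<open>(D \<otimes> 1 + i \<otimes> \<partial>) \<xi> (k) = D (\<xi> k) - i k \<xi>(k)\<close>.\<close>

definition circle_dirac :: "int \<Rightarrow> complex" where
  "circle_dirac k = - of_int k"

definition D0 :: "('h::chilbert_space \<rightharpoonup> 'h) \<Rightarrow> ('h l2Z \<rightharpoonup> 'h l2Z)" where
  "D0 D = op_add (tensor_diag D (\<lambda>_. 1)) (tensor_diag (\<lambda>x. Some (\<i> *\<^sub>C x)) circle_dirac)"

definition off_diagonal ::
    "('k \<rightharpoonup> 'h) \<Rightarrow> ('h \<rightharpoonup> 'k) \<Rightarrow> ('h \<times> 'k \<rightharpoonup> 'h \<times> 'k)" where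
  "off_diagonal S T z =
     (if fst z \<in> dom T \<and> snd z \<in> dom S then Some (the (S (snd z)), the (T (fst z))) else None)"

definition crossed_dirac ::
    "('h::chilbert_space \<rightharpoonup> 'h) \<Rightarrow> ('h l2Z \<times> 'h l2Z \<rightharpoonup> 'h l2Z \<times> 'h l2Z)" where
  "crossed_dirac D = off_diagonal (op_adjoint (D0 D)) (D0 D)"

definition doubled_representation :: "('b \<Rightarrow> 'k \<Rightarrow> 'k) \<Rightarrow> 'b \<Rightarrow> 'k \<times> 'k \<Rightarrow> 'k \<times> 'k" where
  "doubled_representation \<rho> b = map_prod (\<rho> b) (\<rho> b)"

definition grading :: "'k::chilbert_space \<times> 'k \<Rightarrow> 'k \<times> 'k" where
  "grading = map_prod id uminus"

end

theory Submission
  imports Defs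
begin

text \<open>Since the resolvent of \<open>D\<close> is compact, \<open>(1 + D\<^sup>2)\<^sup>-\<^sup>1\<close> has an orthonormal eigenbasis \<open>e\<^sub>j\<close>
  with eigenvalues \<open>r\<^sub>j\<close>. On \<open>\<ell>\<^sup>2(Z, H)\<close> the operators \<open>D\<^sub>0\<close> and \<open>D\<^sub>0\<^sup>*\<close> act coordinatewise as
  \<open>D - ik\<close> and \<open>D + ik\<close>, so \<open>1 + \<D>\<^sup>2\<close> is \<open>1 + D\<^sup>2 + k\<^sup>2\<close> in the \<open>k\<close>-th coordinate of both summands, and its
  inverse is diagonal with eigenvalues \<open>1 / (1/r\<^sub>j + k\<^sup>2)\<close>. These tend to \<open>0\<close>, which gives compactness, and
  at most \<open>2 (2/s + 1)\<close> times as many of them exceed \<open>s\<^sup>2\<close> as there are \<open>r\<^sub>j \<ge> s\<^sup>2\<close>, which raises the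
  summability exponent by one. The regular representation sends \<open>a \<otimes> V\<^sup>n\<close> to a weighted shift, whose
  commutator with \<open>D \<plusminus> ik\<close> is the weighted shift with weights \<open>[D, \<alpha>\<^sup>k(a)] \<mp> i n \<alpha>\<^sup>k(a)\<close>, bounded
  uniformly in \<open>k\<close>.\<close>

section \<open>Preliminaries\<close>

text \<open>Several objects are given by definite descriptions: adjoints, the inverse of 1 + D^2,
  square roots and the regular representation. Each needs existence and uniqueness. Adjoints and
  inverses are replaced by relations between a vector and its value
  (\<open>op_adjoint_eq_Some\<close>, \<open>self_adjoint_inv_one_plus_sq\<close>,
  \<open>shifted_graph\<close>), so that no domain is computed separately. The regular
  representation exists because its operator norm on finitely supported functions is one of the
  seminorms defining the crossed product norm; it is unique because representations of C*-algebras
  are automatically contractive. Contractivity also bounds \<open>\<pi> (zpow \<alpha> k a)\<close>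
  uniformly in \<open>k\<close>. Spectral statements are reduced to counting: an
  \<open>eigenbasis\<close> has finitely many eigenvalues above each positive level, and weak
  summability becomes a power bound on these counts. Once the resolvent of the new operator is
  compact, the compactness clause of \<open>smooth_algebra\<close> holds for every element, and
  density only concerns commutators.\<close>

instance chilbert_space \<subseteq> banach ..
instance cstar_algebra \<subseteq> banach ..

text \<open>Over the reals a sesquilinear form is bilinear, so one interpretation supplies limits
  and finite sums in both arguments; complex scalars are handled by
  \<open>cinner_simps\<close>.\<close>

interpretation cinner: bounded_bilinear "cinner :: 'h::chilbert_space \<Rightarrow> 'h \<Rightarrow> complex"
proof
  have add: "cinner (x + y) z = cinner x z + cinner y z" for x y z :: 'h
    by (metis cinner_add_right cinner_commute complex_cnj_add)
  show "cinner (x + y) z = cinner x z + cinner y z" for x y z :: 'h by (rule add)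
  show "cinner x (y + z) = cinner x y + cinner x z" for x y z :: 'h by (rule cinner_add_right)
  show "cinner (r *\<^sub>R x) y = r *\<^sub>R cinner x y" for r and x y :: 'h
    by (simp add: cinner_scaleC_left scaleR_conv_of_real flip: scaleC_of_real)
  show "cinner x (r *\<^sub>R y) = r *\<^sub>R cinner x y" for r and x y :: 'h
    by (simp add: cinner_scaleC_right scaleR_conv_of_real flip: scaleC_of_real)
  show "\<exists>K. \<forall>x y. norm (cinner x (y :: 'h)) \<le> norm x * norm y * K"
    by (rule exI[of _ 1]) (simp add: cmod_cinner_le)
qed

interpretation scaleC: bounded_bilinear "scaleC :: complex \<Rightarrow> 'h \<Rightarrow> 'h::chilbert_space"
proof
  show "(a + b) *\<^sub>C x = a *\<^sub>C x + b *\<^sub>C x" for a b and x :: 'h by (rule scaleC_add_left)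
  show "a *\<^sub>C (x + y) = a *\<^sub>C x + a *\<^sub>C y" for a and x y :: 'h by (rule scaleC_add_right)
  show "(r *\<^sub>R a) *\<^sub>C x = r *\<^sub>R (a *\<^sub>C x)" for r a and x :: 'h
    by (simp add: scaleR_conv_of_real scaleC_scaleC flip: scaleC_of_real)
  show "a *\<^sub>C (r *\<^sub>R x) = r *\<^sub>R (a *\<^sub>C x)" for r a and x :: 'h
    by (simp add: scaleC_scaleC mult.commute flip: scaleC_of_real)
  show "\<exists>K. \<forall>a x. norm (a *\<^sub>C (x :: 'h)) \<le> norm a * norm x * K"
    by (rule exI[of _ 1]) (simp add: norm_scaleC)
qed

lemmas cinner_simps = cinner.add_left cinner.add_right cinner.diff_left cinner.diff_right
  cinner.minus_left cinner.minus_right cinner_scaleC_left cinner_scaleC_right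

lemma scaleC_minus1 [simp]: "(- 1) *\<^sub>C x = - (x :: 'h::chilbert_space)"
  by (simp add: scaleC.minus_left)

lemma cinner_self_eq_0 [simp]: "cinner x x = 0 \<longleftrightarrow> x = (0 :: 'h::chilbert_space)"
  by (simp add: cinner_self)

lemma cinner_eqI: "(\<And>x. cinner x y = cinner x z) \<Longrightarrow> y = (z :: 'h::chilbert_space)"
  using cinner_self_eq_0[of "y - z"] by (simp add: cinner.diff_right)

lemma cinner_eq_0_sym: "cinner x y = 0 \<longleftrightarrow> cinner y x = 0"
  by (metis cinner_commute complex_cnj_zero)

lemma norm_sq_cinner: "(norm (x :: 'h::chilbert_space))\<^sup>2 = Re (cinner x x)"
  by (simp add: cinner_self)

lemma norm_eq_sqrt_Re_cinner: "norm (x :: 'h::chilbert_space) = sqrt (Re (cinner x x))"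
  by (simp add: cinner_self)

lemma norm_sq_add:
  "(norm (x + y))\<^sup>2 = (norm x)\<^sup>2 + 2 * Re (cinner x y) + (norm (y :: 'h::chilbert_space))\<^sup>2"
proof -
  have "Re (cinner y x) = Re (cinner x y)" by (subst cinner_commute) simp
  then show ?thesis by (simp add: norm_sq_cinner cinner_simps)
qed

lemma norm_sq_diff:
  "(norm (x - y))\<^sup>2 = (norm x)\<^sup>2 - 2 * Re (cinner x y) + (norm (y :: 'h::chilbert_space))\<^sup>2"
  using norm_sq_add[of x "- y"] by (simp add: cinner.minus_right)

subsection \<open>Bounded complex-linear operators\<close>

lemma bounded_clinearI:
  assumes "\<And>x y. T (x + y) = T x + T y" and "\<And>c x. T (c *\<^sub>C x) = c *\<^sub>C T x"
    and "\<And>x. norm (T x) \<le> K * norm x"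
  shows "bounded_clinear T"
  unfolding bounded_clinear_def
proof
  show "bounded_linear T"
    by (rule bounded_linear_intro[of _ K])
      (simp_all add: assms mult.commute flip: scaleC_of_real)
qed (simp add: assms)

lemma bounded_clinear_linear: "bounded_clinear T \<Longrightarrow> bounded_linear T"
  by (simp add: bounded_clinear_def)

lemma bounded_clinear_scaleC: "bounded_clinear T \<Longrightarrow> T (c *\<^sub>C x) = c *\<^sub>C T x"
  by (simp add: bounded_clinear_def)

lemma bounded_clinear_simps:
  assumes "bounded_clinear T"
  shows "T (x + y) = T x + T y" "T (x - y) = T x - T y" "T (- x) = - T x" "T 0 = 0"
    "T (sum g F) = (\<Sum>i\<in>F. T (g i))" "T (c *\<^sub>C x) = c *\<^sub>C T x"
proof -
  have l: "linear T" using assms by (simp add: bounded_clinear_def bounded_linear.linear)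
  show "T (x + y) = T x + T y" "T (x - y) = T x - T y" "T (- x) = - T x" "T 0 = 0"
    "T (sum g F) = (\<Sum>i\<in>F. T (g i))"
    by (simp_all add: linear_add[OF l] linear_diff[OF l] linear_neg[OF l] linear_0[OF l] linear_sum[OF l])
  show "T (c *\<^sub>C x) = c *\<^sub>C T x" using assms by (simp add: bounded_clinear_def)
qed

lemma bounded_clinear_bound:
  assumes "bounded_clinear T"
  obtains K where "K > 0" "\<And>x. norm (T x) \<le> K * norm x"
  using bounded_linear.pos_bounded[OF bounded_clinear_linear[OF assms]] that
  by (auto simp: mult.commute)

lemma bounded_clinear_onorm: "bounded_clinear T \<Longrightarrow> norm (T x) \<le> onorm T * norm x"
  by (simp add: bounded_clinear_linear onorm)

lemma bounded_clinear_tendsto: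
  "bounded_clinear T \<Longrightarrow> (f \<longlongrightarrow> l) F \<Longrightarrow> ((\<lambda>n. T (f n)) \<longlongrightarrow> T l) F"
  by (simp add: bounded_clinear_linear bounded_linear.tendsto)

lemma bounded_clinear_zero: "bounded_clinear (\<lambda>_. 0)"
  by (rule bounded_clinearI[of _ 0]) (auto simp: scaleC.zero_right)

lemma bounded_clinear_add:
  "bounded_clinear S \<Longrightarrow> bounded_clinear T \<Longrightarrow> bounded_clinear (\<lambda>x. S x + T x)"
  by (simp add: bounded_clinear_def bounded_linear_add scaleC_add_right)

lemma bounded_clinear_sum:
  "(\<And>i. i \<in> F \<Longrightarrow> bounded_clinear (T i)) \<Longrightarrow> bounded_clinear (\<lambda>x. \<Sum>i\<in>F. T i x)"
  by (induction F rule: infinite_finite_induct) (auto simp: bounded_clinear_zero bounded_clinear_add)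

lemma bounded_clinear_comp:
  "bounded_clinear S \<Longrightarrow> bounded_clinear T \<Longrightarrow> bounded_clinear (S \<circ> T)"
  using bounded_linear_compose[of S T] by (simp add: bounded_clinear_def comp_def)

lemma bounded_clinear_mult: "bounded_clinear T \<Longrightarrow> bounded_clinear (\<lambda>x. c *\<^sub>C T x)"
  unfolding bounded_clinear_def
  by (auto simp: scaleC_scaleC mult.commute intro: bounded_linear_compose[OF scaleC.bounded_linear_right])

lemma bounded_clinear_id: "bounded_clinear (\<lambda>x. x)"
  by (simp add: bounded_clinear_def)

section \<open>Adjoints and positive operators\<close>

lemma op_adjoint_unique:
  assumes "closure (dom T) = UNIV"
    and "\<forall>x\<in>dom T. cinner x z = cinner x (z' :: 'h::chilbert_space)"
  shows "z = z'"
proof -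
  have "(z - z') \<in> closure (dom T)" using assms(1) by simp
  then obtain f where f: "\<And>n. f n \<in> dom T" "f \<longlonglongrightarrow> z - z'"
    unfolding closure_sequential by blast
  have "(\<lambda>n. cinner (f n) (z - z')) \<longlonglongrightarrow> cinner (z - z') (z - z')"
    by (intro cinner.tendsto tendsto_const f)
  moreover have "cinner (f n) (z - z') = 0" for n
    using assms(2) f(1) by (simp add: cinner.diff_right)
  ultimately have "cinner (z - z') (z - z') = 0"
    using LIMSEQ_unique[of "\<lambda>n. 0" 0 "cinner (z - z') (z - z')"] by simp
  then show ?thesis by simp
qed

text \<open>Density makes the vector in the definition of \<open>op_adjoint\<close> unique, so the
  definite description can be traded for the defining identity. Every later computation of an
  adjoint rests on this.\<close>

lemma op_adjoint_eq_Some: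
  assumes "closure (dom T) = (UNIV :: 'h::chilbert_space set)"
  shows "op_adjoint T y = Some z \<longleftrightarrow> (\<forall>x\<in>dom T. cinner (the (T x)) y = cinner x z)"
    (is "_ \<longleftrightarrow> ?P z")
proof
  assume z: "op_adjoint T y = Some z"
  have ex: "\<exists>z. ?P z"
  proof (rule ccontr)
    assume "\<nexists>z. ?P z"
    then have "op_adjoint T y = None" unfolding op_adjoint_def by (rule if_not_P)
    with z show False by simp
  qed
  obtain w where w: "?P w" using ex by blast
  have "w' = w" if "?P w'" for w'
    using op_adjoint_unique[OF assms] w that by metis
  with w have "?P (THE z. ?P z)" by (rule theI)
  have "op_adjoint T y = Some (THE z. ?P z)"
    unfolding op_adjoint_def using ex by (rule if_P)
  then have "(THE z. ?P z) = z" using z by (metis option.inject)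
  then show "?P z" using \<open>?P (THE z. ?P z)\<close> by (rule subst)
next
  assume z: "?P z"
  have "w = z" if "?P w" for w
    using op_adjoint_unique[OF assms] z that by metis
  with z have the: "(THE z. ?P z) = z" by (intro the_equality)
  have ex: "\<exists>z. ?P z" using z by (rule exI)
  have "op_adjoint T y = Some (THE z. ?P z)"
    unfolding op_adjoint_def using ex by (rule if_P)
  also have "\<dots> = Some z" by (rule arg_cong[OF the])
  finally show "op_adjoint T y = Some z" .
qed

lemma op_adjoint_total:
  "op_adjoint (Some \<circ> T) y = Some z \<longleftrightarrow> (\<forall>x. cinner (T x) y = cinner x z)"
  by (subst op_adjoint_eq_Some) (auto simp: dom_def)

text \<open>Polarization: the quadratic form is real by positivity, and its values at
  \<open>x + y\<close> and \<open>x + \<i> *\<^sub>C y\<close> compare the imaginary and the real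
  parts of the two mixed terms.\<close>

lemma positive_op_symmetric:
  assumes "positive_op S"
  shows "cinner (S x) y = cinner x (S y)"
proof -
  note l = bounded_clinear_simps[of S]
  have S: "bounded_clinear S" and r: "\<And>x. Im (cinner x (S x)) = 0"
    using assms unfolding positive_op_def by (auto simp: complex_is_Real_iff)
  have "Im (cinner x (S y)) + Im (cinner y (S x)) = 0"
    using r[of "x + y"] r[of x] r[of y] by (simp add: l[OF S] cinner_simps)
  moreover have "Re (cinner x (S y)) - Re (cinner y (S x)) = 0"
    using r[of "x + \<i> *\<^sub>C y"] r[of x] r[of y] by (simp add: l[OF S] cinner_simps)
  ultimately have "cnj (cinner y (S x)) = cinner x (S y)"
    by (simp add: complex_eq_iff)
  then show ?thesis by (simp add: cinner_commute[of "S x"])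
qed

subsection \<open>Representations are contractive\<close>

lemma representation_simps:
  assumes "representation \<pi>"
  shows "bounded_clinear (\<pi> a)" "\<pi> (a + b) x = \<pi> a x + \<pi> b x" "\<pi> (c *\<^sub>C a) x = c *\<^sub>C \<pi> a x"
    "\<pi> (a * b) x = \<pi> a (\<pi> b x)" "cinner (\<pi> a x) y = cinner x (\<pi> (star a) y)"
    "\<pi> 0 x = 0" "\<pi> (- a) x = - \<pi> a x" "\<pi> (a - b) x = \<pi> a x - \<pi> b x"
proof -
  show 0: "bounded_clinear (\<pi> a)" "\<pi> (a + b) x = \<pi> a x + \<pi> b x" "\<pi> (c *\<^sub>C a) x = c *\<^sub>C \<pi> a x"
    "\<pi> (a * b) x = \<pi> a (\<pi> b x)" for a b c x
    using assms unfolding representation_def by blast+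
  have "op_adjoint (Some \<circ> \<pi> a) y = Some (\<pi> (star a) y)"
    using assms unfolding representation_def by (metis comp_apply)
  then show "cinner (\<pi> a x) y = cinner x (\<pi> (star a) y)"
    by (simp add: op_adjoint_total)
  show z: "\<pi> 0 x = 0" for x using 0(2)[of 0 0 x] by simp
  show m: "\<pi> (- a) x = - \<pi> a x" for a using 0(2)[of a "- a" x] z[of x] by (simp add: eq_neg_iff_add_eq_0 add.commute)
  show "\<pi> (a - b) x = \<pi> a x - \<pi> b x" using 0(2)[of a "- b" x] m by simp
qed

text \<open>\<open>1 + b\<close> is the inverse of \<open>1 - k\<close> in the unitization.\<close>

lemma quasi_inverse_exists:
  fixes k :: "'a::cstar_algebra"
  assumes "norm k < 1"
  obtains b where "b = k + b * k"
proof -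
  have "\<exists>!x. k + x * k = x"
  proof (rule banach_fix_type[of "norm k"])
    show "\<forall>x y. dist (k + x * k) (k + y * k) \<le> norm k * dist x y"
    proof (intro allI)
      fix x y :: 'a
      show "dist (k + x * k) (k + y * k) \<le> norm k * dist x y"
        using norm_mult_ineq[of "x - y" k]
        by (simp add: dist_norm left_diff_distrib mult.commute[of "norm k"])
    qed
  qed (use assms in auto)
  then obtain b where "k + b * k = b" by blast
  then show ?thesis by (rule that[OF sym])
qed

text \<open>If the norm \<open>t\<close> of \<open>\<pi>(a)\<close> exceeded that of \<open>a\<close>, then \<open>a\<^sup>*a/t\<^sup>2\<close> would be quasi-invertible,
  but \<open>1\<close> is an approximate eigenvalue of \<open>\<pi>(a\<^sup>*a)/t\<^sup>2\<close>.\<close>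

theorem representation_contractive:
  assumes \<pi>: "representation \<pi>"
  shows "norm (\<pi> a x) \<le> norm a * norm x"
proof -
  note \<pi>s = representation_simps[OF \<pi>]
  define t where "t = onorm (\<pi> a)"
  have t0: "t \<ge> 0" unfolding t_def
    by (intro onorm_pos_le bounded_clinear_linear \<pi>s)
  have bd: "norm (\<pi> a x) \<le> t * norm x" for x
    unfolding t_def by (intro bounded_clinear_onorm \<pi>s)
  have "t \<le> norm a"
  proof (rule ccontr)
    assume "\<not> t \<le> norm a"
    then have ta: "norm a < t" by simp
    then have tp: "t > 0" using norm_ge_zero[of a] by linarith
    define k where "k = complex_of_real (1 / t\<^sup>2) *\<^sub>C (star a * a)"
    have "norm k = (norm a)\<^sup>2 / t\<^sup>2"
      by (simp add: k_def norm_scaleC_cstar cstar_identity norm_power norm_divide)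
    also have "\<dots> < 1" using ta tp by (simp add: power_strict_mono)
    finally obtain b where b: "b = k + b * k" using quasi_inverse_exists by blast
    obtain M where M: "M > 0" "\<And>x. norm (\<pi> b x) \<le> M * norm x"
      using bounded_clinear_bound[OF \<pi>s(1)] by blast
    \<comment> \<open>Since 1 + b is a left inverse of 1 - k, the norm of x is at most 1 + M times
      that of x - \<pi>(k) x; \<open>c\<close> is the resulting lower bound for the squared norm of
      the latter on unit vectors.\<close>
    define c where "c = 1 / (1 + M)\<^sup>2"
    have c: "0 < c" using M(1) by (simp add: c_def)
    have adj: "norm (\<pi> (star a) y) \<le> t * norm y" for y
    proof -
      have "(norm (\<pi> (star a) y))\<^sup>2 = Re (cinner (\<pi> a (\<pi> (star a) y)) y)"
        by (simp add: norm_sq_cinner \<pi>s(5))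
      also have "\<dots> \<le> norm (\<pi> a (\<pi> (star a) y)) * norm y"
        using complex_Re_le_cmod cmod_cinner_le order_trans by blast
      also have "\<dots> \<le> (t * norm (\<pi> (star a) y)) * norm y"
        by (intro mult_right_mono bd) simp
      finally have "norm (\<pi> (star a) y) * norm (\<pi> (star a) y) \<le> (t * norm y) * norm (\<pi> (star a) y)"
        by (simp add: power2_eq_square mult_ac)
      then show ?thesis
        by (cases "norm (\<pi> (star a) y) = 0") (use t0 in \<open>auto simp: mult_le_cancel_right\<close>)
    qed
    \<comment> \<open>The squared norm of x - \<pi>(k) x is at least c |x|^2 and, by the facts
      \<open>2\<close> and \<open>3\<close>, at most |x|^2 - |\<pi>(a) x|^2 / t^2. This improves the
      bound \<open>t\<close> on \<pi>(a) to \<open>t * sqrt (1 - c)\<close>, although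
      \<open>t\<close> is the operator norm.\<close>
    have main: "(norm (\<pi> a x))\<^sup>2 \<le> (t\<^sup>2 * (1 - c)) * (norm x)\<^sup>2" for x
    proof -
      have kx: "\<pi> k x = complex_of_real (1 / t\<^sup>2) *\<^sub>C \<pi> (star a) (\<pi> a x)"
        by (simp add: k_def \<pi>s)
      have "\<pi> b x = \<pi> k x + \<pi> b (\<pi> k x)"
        by (subst b) (simp add: \<pi>s)
      then have "x = (x - \<pi> k x) + \<pi> b (x - \<pi> k x)"
        by (simp add: bounded_clinear_simps[OF \<pi>s(1)])
      then have "norm x \<le> norm (x - \<pi> k x) + norm (\<pi> b (x - \<pi> k x))"
        by (metis norm_triangle_ineq)
      also have "\<dots> \<le> (1 + M) * norm (x - \<pi> k x)" using M(2) by (simp add: distrib_right)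
      finally have "(norm x)\<^sup>2 \<le> ((1 + M) * norm (x - \<pi> k x))\<^sup>2" by (intro power_mono) auto
      then have 1: "c * (norm x)\<^sup>2 \<le> (norm (x - \<pi> k x))\<^sup>2"
        using M(1) by (simp add: c_def power_mult_distrib divide_simps mult.commute)
      have "norm (\<pi> k x) \<le> (1 / t\<^sup>2) * (t * norm (\<pi> a x))"
        using tp mult_left_mono[OF adj[of "\<pi> a x"], of "1 / t\<^sup>2"] by (simp add: kx norm_scaleC norm_divide norm_power)
      then have 2: "norm (\<pi> k x) \<le> norm (\<pi> a x) / t"
        using tp by (simp add: power2_eq_square divide_simps split: if_splits)
      have 3: "Re (cinner x (\<pi> k x)) = (norm (\<pi> a x))\<^sup>2 / t\<^sup>2"
      proof -
        have "cinner x (\<pi> (star a) (\<pi> a x)) = cinner (\<pi> a x) (\<pi> a x)" by (simp add: \<pi>s(5))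
        then show ?thesis by (simp add: kx cinner_scaleC_right cinner_self)
      qed
      have "(norm (x - \<pi> k x))\<^sup>2 \<le> (norm x)\<^sup>2 - 2 * ((norm (\<pi> a x))\<^sup>2 / t\<^sup>2) + (norm (\<pi> a x) / t)\<^sup>2"
        unfolding norm_sq_diff 3 using power_mono[OF 2, of 2] by simp
      also have "\<dots> = (norm x)\<^sup>2 - (norm (\<pi> a x))\<^sup>2 / t\<^sup>2" by (simp add: power_divide)
      finally have "(norm (\<pi> a x))\<^sup>2 / t\<^sup>2 \<le> (1 - c) * (norm x)\<^sup>2" using 1 by (simp add: algebra_simps)
      then have "t\<^sup>2 * ((norm (\<pi> a x))\<^sup>2 / t\<^sup>2) \<le> t\<^sup>2 * ((1 - c) * (norm x)\<^sup>2)"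
        by (rule mult_left_mono) simp
      then show ?thesis using tp by (simp add: mult_ac)
    qed
    have "norm (\<pi> a x) \<le> t * sqrt (1 - c) * norm x" for x
    proof -
      have "norm (\<pi> a x) = sqrt ((norm (\<pi> a x))\<^sup>2)" by simp
      also have "\<dots> \<le> sqrt ((t\<^sup>2 * (1 - c)) * (norm x)\<^sup>2)" by (rule real_sqrt_le_mono[OF main])
      finally show ?thesis using t0 by (simp add: real_sqrt_mult)
    qed
    moreover have "c \<le> 1" unfolding c_def
      using M(1) power_mono[of 1 "1 + M" 2] by (simp add: divide_simps)
    ultimately have "onorm (\<pi> a) \<le> t * sqrt (1 - c)"
      by (intro onorm_bound) (use t0 in auto)
    then have "t \<le> t * sqrt (1 - c)" by (simp add: t_def)
    then have "1 \<le> sqrt (1 - c)" using tp by simp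
    then show False using c by simp
  qed
  then have "t * norm x \<le> norm a * norm x" by (rule mult_right_mono) simp
  with bd[of x] show ?thesis by linarith
qed

section \<open>Compact operators\<close>

lemma compact_op_subset:
  assumes "bounded_clinear T" "T ` cball 0 1 \<subseteq> K" "compact K"
  shows "compact_op T"
proof -
  have "closure (T ` cball 0 1) \<subseteq> K"
    using assms by (intro closure_minimal compact_imp_closed)
  then have "closure (T ` cball 0 1) = K \<inter> closure (T ` cball 0 1)" by blast
  moreover have "compact (K \<inter> closure (T ` cball 0 1))"
    using assms by (intro compact_Int_closed) auto
  ultimately show ?thesis using assms(1) by (simp add: compact_op_def)
qed

lemma compact_op_add:
  assumes "compact_op S" "compact_op T"
  shows "compact_op (\<lambda>x. S x + T x)"
proof (rule compact_op_subset)
  let ?A = "closure (S ` cball 0 1)" and ?B = "closure (T ` cball 0 1)"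
  show "bounded_clinear (\<lambda>x. S x + T x)"
    using assms by (intro bounded_clinear_add) (auto simp: compact_op_def)
  show "compact {x + y |x y. x \<in> ?A \<and> y \<in> ?B}"
    using assms by (intro compact_sums) (auto simp: compact_op_def)
  show "(\<lambda>x. S x + T x) ` cball 0 1 \<subseteq> {x + y |x y. x \<in> ?A \<and> y \<in> ?B}"
    using closure_subset[of "S ` cball 0 1"] closure_subset[of "T ` cball 0 1"] by blast
qed

lemma compact_op_zero: "compact_op (\<lambda>_. 0)"
  by (rule compact_op_subset[of _ "{0}"]) (auto simp: bounded_clinear_zero)

lemma compact_op_sum:
  "finite F \<Longrightarrow> (\<And>i. i \<in> F \<Longrightarrow> compact_op (T i)) \<Longrightarrow> compact_op (\<lambda>x. \<Sum>i\<in>F. T i x)"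
  by (induction F rule: finite_induct) (auto simp: compact_op_zero compact_op_add)

lemma compact_op_rank_one:
  fixes e :: "'h::chilbert_space" and f :: "'k::chilbert_space"
  shows "compact_op (\<lambda>x. (c * cinner e x) *\<^sub>C f)"
proof (rule compact_op_subset)
  have bd: "cmod (c * cinner e x) \<le> cmod c * (norm e * norm x)" for x
    by (simp add: norm_mult cmod_cinner_le mult_left_mono)
  show "bounded_clinear (\<lambda>x. (c * cinner e x) *\<^sub>C f)"
  proof (rule bounded_clinearI)
    show "norm ((c * cinner e x) *\<^sub>C f) \<le> (cmod c * norm e * norm f) * norm x" for x
      using mult_right_mono[OF bd[of x], of "norm f"] by (simp add: norm_scaleC mult_ac)
  qed (simp_all add: cinner_simps distrib_left scaleC_add_left scaleC_scaleC mult_ac)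
  show "compact ((\<lambda>z. z *\<^sub>C f) ` cball 0 (cmod c * norm e))"
    by (intro compact_continuous_image compact_cball linear_continuous_on scaleC.bounded_linear_left)
  show "(\<lambda>x. (c * cinner e x) *\<^sub>C f) ` cball 0 1 \<subseteq> (\<lambda>z. z *\<^sub>C f) ` cball 0 (cmod c * norm e)"
  proof (rule image_subsetI)
    fix x :: 'h assume "x \<in> cball 0 1"
    then have "cmod (c * cinner e x) \<le> cmod c * norm e"
      using bd[of x] mult_left_mono[of "norm x" 1 "cmod c * norm e"] by (simp add: mult_ac)
    then show "(c * cinner e x) *\<^sub>C f \<in> (\<lambda>z. z *\<^sub>C f) ` cball 0 (cmod c * norm e)" by auto
  qed
qed

text \<open>Total boundedness survives uniform approximation: a finite net for \<open>S\<close> at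
  scale e/4 is one for \<open>T\<close> at scale e/2. The intermediate balls are closed, so that
  they still cover the closure.\<close>

lemma compact_op_limit:
  fixes T :: "'h::chilbert_space \<Rightarrow> 'k::chilbert_space"
  assumes T: "bounded_clinear T"
    and lim: "\<And>e. e > 0 \<Longrightarrow> \<exists>S. compact_op S \<and> (\<forall>x. norm (T x - S x) \<le> e * norm x)"
  shows "compact_op T"
proof -
  have "\<exists>k. finite k \<and> closure (T ` cball 0 1) \<subseteq> (\<Union>y\<in>k. ball y e)" if e: "e > 0" for e :: real
  proof -
    obtain S where S: "compact_op S" "\<And>x. norm (T x - S x) \<le> (e / 4) * norm x"
      using lim[of "e / 4"] e by auto
    have tb: "\<forall>e>0. \<exists>k. finite k \<and> closure (S ` cball 0 1) \<subseteq> (\<Union>y\<in>k. ball y e)"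
      using S(1) by (simp add: compact_op_def compact_eq_totally_bounded)
    have "e / 4 > 0" using e by simp
    from mp[OF spec[OF tb] this]
    obtain k where k: "finite k" "closure (S ` cball 0 1) \<subseteq> (\<Union>y\<in>k. ball y (e / 4))"
      by (elim exE conjE)
    have "T ` cball 0 1 \<subseteq> (\<Union>y\<in>k. cball y (e / 2))"
    proof (rule image_subsetI)
      fix x :: 'h assume x: "x \<in> cball 0 1"
      then have "S x \<in> closure (S ` cball 0 1)" using closure_subset[of "S ` cball 0 1"] by auto
      with k(2) have "S x \<in> (\<Union>y\<in>k. ball y (e / 4))" by (rule subsetD)
      then obtain y where y: "y \<in> k" "dist y (S x) < e / 4" by auto
      have "norm (T x - S x) \<le> e / 4"
        using order_trans[OF S(2)[of x] mult_left_mono[of "norm x" 1 "e / 4"]] x e by simp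
      then have "dist (S x) (T x) \<le> e / 4" by (simp add: dist_norm norm_minus_commute)
      with y have "dist y (T x) \<le> e / 2" using dist_triangle[of y "T x" "S x"] by linarith
      with y show "T x \<in> (\<Union>y\<in>k. cball y (e / 2))" by auto
    qed
    then have "closure (T ` cball 0 1) \<subseteq> (\<Union>y\<in>k. cball y (e / 2))"
      using k(1) by (intro closure_minimal closed_UN) auto
    also have "\<dots> \<subseteq> (\<Union>y\<in>k. ball y e)" using e by auto
    finally show ?thesis using k(1) by blast
  qed
  then show ?thesis
    using T by (auto simp: compact_op_def compact_eq_totally_bounded complete_eq_closed)
qed

lemma compact_op_comp_right:
  fixes T :: "'h::chilbert_space \<Rightarrow> 'k::chilbert_space"
  assumes S: "compact_op S" and T: "bounded_clinear T"
  shows "compact_op (S \<circ> T)"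
proof -
  have Sb: "bounded_clinear S" using S by (simp add: compact_op_def)
  obtain K where K: "K > 0" "\<And>x. norm (T x) \<le> K * norm x"
    using bounded_clinear_bound[OF T] by blast
  show ?thesis
  proof (rule compact_op_subset)
    show "compact ((\<lambda>x. K *\<^sub>R x) ` closure (S ` cball 0 1))"
      using S by (intro compact_scaling) (simp add: compact_op_def)
    show "(S \<circ> T) ` cball 0 1 \<subseteq> (\<lambda>x. K *\<^sub>R x) ` closure (S ` cball 0 1)"
    proof (rule image_subsetI)
      fix x :: 'h assume "x \<in> cball 0 1"
      then have "K * norm x \<le> K * 1" using K(1) by (intro mult_left_mono) auto
      with K(2)[of x] have "norm (T x) \<le> K" by simp
      then have "(1 / K) *\<^sub>R T x \<in> cball 0 1" using K(1) by (simp add: divide_simps)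
      then have "S ((1 / K) *\<^sub>R T x) \<in> closure (S ` cball 0 1)"
        using closure_subset[of "S ` cball 0 1"] by auto
      moreover have "S (T x) = K *\<^sub>R S ((1 / K) *\<^sub>R T x)"
        using K(1) linear_cmul[OF bounded_linear.linear[OF bounded_clinear_linear[OF Sb]]] by simp
      ultimately show "(S \<circ> T) x \<in> (\<lambda>x. K *\<^sub>R x) ` closure (S ` cball 0 1)" by auto
    qed
  qed (use Sb T in \<open>simp add: bounded_clinear_comp\<close>)
qed

lemma compact_op_comp_left:
  assumes S: "compact_op S" and T: "bounded_clinear T"
  shows "compact_op (T \<circ> S)"
proof (rule compact_op_subset)
  show "bounded_clinear (T \<circ> S)" using assms by (simp add: bounded_clinear_comp compact_op_def)
  show "compact (T ` closure (S ` cball 0 1))"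
    using S T by (intro compact_continuous_image linear_continuous_on)
      (auto simp: compact_op_def bounded_clinear_def)
  show "(T \<circ> S) ` cball 0 1 \<subseteq> T ` closure (S ` cball 0 1)"
    unfolding image_comp[symmetric] by (intro image_mono closure_subset)
qed

section \<open>Diagonalization of compact positive operators\<close>

definition orthonormal :: "'h::chilbert_space set \<Rightarrow> bool" where
  "orthonormal E \<longleftrightarrow> (\<forall>e\<in>E. \<forall>f\<in>E. cinner e f = (if e = f then 1 else 0))"

text \<open>Indexing by the vectors themselves lets multiplicities be counted as cardinalities.
  Totality replaces series expansions, and the last clause says that the eigenvalues tend to 0.
  Positivity of all \<open>r e\<close> makes \<open>R\<close> injective.\<close>

definition eigenbasis ::
    "('h::chilbert_space \<Rightarrow> 'h) \<Rightarrow> 'h set \<Rightarrow> ('h \<Rightarrow> real) \<Rightarrow> bool" where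
  "eigenbasis R E r \<longleftrightarrow> positive_op R \<and> orthonormal E \<and>
     (\<forall>x. (\<forall>e\<in>E. cinner e x = 0) \<longrightarrow> x = 0) \<and>
     (\<forall>e\<in>E. 0 < r e \<and> R e = complex_of_real (r e) *\<^sub>C e) \<and>
     (\<forall>s>0. finite {e \<in> E. s \<le> r e})"

text \<open>A maximizing sequence for \<open>\<parallel>R x\<parallel>\<close> on the unit sphere of \<open>V\<close> consists of approximate
  eigenvectors of \<open>R\<^sup>2\<close>, and \<open>R\<^sup>2 - \<mu>\<^sup>2 = (R - \<mu>) (R + \<mu>)\<close> with \<open>R + \<mu>\<close> injective.\<close>

lemma compact_positive_eigenvector:
  fixes R :: "'h::chilbert_space \<Rightarrow> 'h"
  assumes R: "compact_op R" and pos: "positive_op R"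
    and inj: "\<And>x. R x = 0 \<Longrightarrow> x = 0"
    and V: "subspace V" "closed V" "R ` V \<subseteq> V" and v: "v \<in> V" "v \<noteq> 0"
  obtains e \<mu> where "e \<in> V" "norm e = 1" "\<mu> > 0" "R e = complex_of_real \<mu> *\<^sub>C e"
proof -
  have Rb: "bounded_clinear R" using R by (simp add: compact_op_def)
  note l = bounded_clinear_simps[OF Rb]
  have lR: "R (a *\<^sub>R x) = a *\<^sub>R R x" for a x by (simp add: l(6) flip: scaleC_of_real)
  have sym: "cinner (R x) y = cinner x (R y)" for x y by (rule positive_op_symmetric[OF pos])
  obtain K where K: "K > 0" "\<And>x. norm (R x) \<le> K * norm x"
    using bounded_clinear_bound[OF Rb] by blast
  define S where "S = {norm (R x) |x. x \<in> V \<and> norm x = 1}"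
  define \<mu> where "\<mu> = Sup S"
  have "s \<le> K" if "s \<in> S" for s
  proof -
    from that obtain x where "s = norm (R x)" "norm x = 1" by (auto simp: S_def)
    with K(2)[of x] show ?thesis by simp
  qed
  then have bdd: "bdd_above S" by (auto simp: bdd_above_def)
  have nrm: "inverse (norm x) *\<^sub>R x \<in> V" "norm (inverse (norm x) *\<^sub>R x) = 1" if "x \<in> V" "x \<noteq> 0" for x
    using that V(1) by (auto simp: subspace_scale)
  have S_in: "norm (R x) / norm x \<in> S" if "x \<in> V" "x \<noteq> 0" for x
    unfolding S_def using nrm[OF that]
    by (intro CollectI exI[of _ "inverse (norm x) *\<^sub>R x"]) (simp add: lR divide_inverse mult.commute)
  have up: "norm (R x) \<le> \<mu> * norm x" if "x \<in> V" for x
  proof (cases "x = 0")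
    case False
    then have "norm (R x) / norm x \<le> \<mu>"
      unfolding \<mu>_def by (intro cSup_upper bdd S_in that)
    with False show ?thesis by (simp add: divide_simps)
  qed (simp add: l)
  have Sne: "S \<noteq> {}" using S_in[OF v] by blast
  have "0 < norm (R v) / norm v" using v inj[of v] by (intro divide_pos_pos) auto
  also have "\<dots> \<le> \<mu>" unfolding \<mu>_def by (intro cSup_upper bdd S_in v)
  finally have \<mu>: "\<mu> > 0" .
  have "\<exists>x. x \<in> V \<and> norm x = 1 \<and> \<mu> - inverse (real (Suc n)) < norm (R x)" for n
  proof -
    have "\<mu> - inverse (real (Suc n)) < Sup S" by (simp add: \<mu>_def)
    then show ?thesis unfolding less_cSup_iff[OF Sne bdd] by (auto simp: S_def)
  qed
  then obtain x where x: "\<And>n. x n \<in> V" "\<And>n. norm (x n) = 1"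
      "\<And>n. \<mu> - inverse (real (Suc n)) < norm (R (x n))" by metis
  have Rx: "(\<lambda>n. norm (R (x n))) \<longlonglongrightarrow> \<mu>"
  proof (rule tendsto_sandwich)
    show "(\<lambda>n. \<mu> - inverse (real (Suc n))) \<longlonglongrightarrow> \<mu>"
      using LIMSEQ_inverse_real_of_nat_add_minus[of \<mu>] by simp
    show "\<forall>\<^sub>F n in sequentially. norm (R (x n)) \<le> \<mu>"
      using up[OF x(1)] x(2) by simp
  qed (use x(3) in \<open>auto intro: always_eventually less_imp_le\<close>)
  have "seq_compact (closure (R ` cball 0 1))"
    using R by (simp add: compact_op_def compact_imp_seq_compact)
  moreover have "\<forall>n. R (x n) \<in> closure (R ` cball 0 1)"
    using x(2) closure_subset[of "R ` cball 0 1"] by auto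
  ultimately obtain y q where q: "strict_mono (q :: nat \<Rightarrow> nat)" "((\<lambda>n. R (x n)) \<circ> q) \<longlonglongrightarrow> y"
    by (rule seq_compactE)
  have q2: "(\<lambda>n. R (x (q n))) \<longlonglongrightarrow> y" using q(2) by (simp add: comp_def)
  have "(\<lambda>n. R (R (x n)) - \<mu>\<^sup>2 *\<^sub>R x n) \<longlonglongrightarrow> 0"
  proof -
    \<comment> \<open>In the expansion of the square, the first term is at most \<mu>^2 |R x|^2 and
      the cross term is -2 \<mu>^2 |R x|^2.\<close>
    have le: "(norm (R (R (x n)) - \<mu>\<^sup>2 *\<^sub>R x n))\<^sup>2 \<le> \<mu>^4 - \<mu>\<^sup>2 * (norm (R (x n)))\<^sup>2" for n
    proof -
      have "norm (R (R (x n))) \<le> \<mu> * norm (R (x n))" using V(3) x(1) by (intro up) auto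
      then have "(norm (R (R (x n))))\<^sup>2 \<le> (\<mu> * norm (R (x n)))\<^sup>2"
        by (intro power_mono) auto
      then have "(norm (R (R (x n))))\<^sup>2 \<le> \<mu>\<^sup>2 * (norm (R (x n)))\<^sup>2"
        by (simp add: power_mult_distrib)
      moreover have "Re (cinner (R (R (x n))) (\<mu>\<^sup>2 *\<^sub>R x n)) = \<mu>\<^sup>2 * (norm (R (x n)))\<^sup>2"
        by (simp add: sym[of "R (x n)"] cinner.scaleR_right cinner_self)
      moreover have "(norm (\<mu>\<^sup>2 *\<^sub>R x n))\<^sup>2 = \<mu>^4" by (simp add: x(2) flip: power_mult)
      ultimately show ?thesis unfolding norm_sq_diff by linarith
    qed
    have "(\<lambda>n. \<mu>^4 - \<mu>\<^sup>2 * (norm (R (x n)))\<^sup>2) \<longlonglongrightarrow> \<mu>^4 - \<mu>\<^sup>2 * \<mu>\<^sup>2"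
      by (intro tendsto_intros Rx)
    moreover have "\<mu>^4 - \<mu>\<^sup>2 * \<mu>\<^sup>2 = 0"
      by (simp add: power2_eq_square power4_eq_xxxx)
    ultimately have lim: "(\<lambda>n. \<mu>^4 - \<mu>\<^sup>2 * (norm (R (x n)))\<^sup>2) \<longlonglongrightarrow> 0"
      by (simp only:)
    have "(\<lambda>n. (norm (R (R (x n)) - \<mu>\<^sup>2 *\<^sub>R x n))\<^sup>2) \<longlonglongrightarrow> 0"
      by (rule tendsto_sandwich[OF _ _ tendsto_const lim])
        (rule always_eventually, simp, rule always_eventually, rule allI, rule le)
    then have "(\<lambda>n. sqrt ((norm (R (R (x n)) - \<mu>\<^sup>2 *\<^sub>R x n))\<^sup>2)) \<longlonglongrightarrow> sqrt 0"
      by (rule tendsto_real_sqrt)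
    then show ?thesis by (simp add: tendsto_norm_zero_iff)
  qed
  then have d0: "(\<lambda>n. R (R (x (q n))) - \<mu>\<^sup>2 *\<^sub>R x (q n)) \<longlonglongrightarrow> 0"
    using LIMSEQ_subseq_LIMSEQ[OF _ q(1), of "\<lambda>n. R (R (x n)) - \<mu>\<^sup>2 *\<^sub>R x n"] by (simp add: comp_def)
  \<comment> \<open>Since R (R x) - \<mu>^2 x tends to 0 and R x tends to y along the subsequence, x
    itself must converge to R y / \<mu>^2.\<close>
  define w where "w = (1 / \<mu>\<^sup>2) *\<^sub>R R y"
  have "(\<lambda>n. (1 / \<mu>\<^sup>2) *\<^sub>R (R (R (x (q n))) - (R (R (x (q n))) - \<mu>\<^sup>2 *\<^sub>R x (q n)))) \<longlonglongrightarrow> (1 / \<mu>\<^sup>2) *\<^sub>R (R y - 0)"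
    by (intro tendsto_intros d0 bounded_clinear_tendsto[OF Rb] q2)
  then have xw: "(\<lambda>n. x (q n)) \<longlonglongrightarrow> w" using \<mu> by (simp add: w_def)
  have w1: "norm w = 1" using tendsto_norm[OF xw] x(2) LIMSEQ_unique[OF _ tendsto_const] by auto
  have wV: "w \<in> V" using closed_sequentially[OF V(2) _ xw] x(1) by blast
  have "(\<lambda>n. R (R (x (q n))) - \<mu>\<^sup>2 *\<^sub>R x (q n)) \<longlonglongrightarrow> R (R w) - \<mu>\<^sup>2 *\<^sub>R w"
    by (intro tendsto_intros bounded_clinear_tendsto[OF Rb] xw)
  from LIMSEQ_unique[OF this d0] have RRw: "R (R w) = \<mu>\<^sup>2 *\<^sub>R w" by simp
  \<comment> \<open>(R - \<mu>) (R + \<mu>) w = 0, so u = (R + \<mu>) w is an eigenvector once it is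
    nonzero; its inner product with w has real part at least \<mu>, which excludes u = 0.\<close>
  define u where "u = R w + \<mu> *\<^sub>R w"
  have Ru: "R u = \<mu> *\<^sub>R u" by (simp add: u_def l lR RRw scaleR_add_right power2_eq_square)
  have uV: "u \<in> V" using wV V unfolding u_def by (intro subspace_add subspace_scale) auto
  have "Re (cinner w u) = Re (cinner w (R w)) + \<mu>"
    using w1 by (simp add: u_def cinner.add_right cinner.scaleR_right cinner_self)
  moreover have "Re (cinner w (R w)) \<ge> 0" using pos by (simp add: positive_op_def)
  ultimately have "u \<noteq> 0" using \<mu> by (auto simp: cinner.zero_right)
  show thesis
  proof (rule that)
    show "inverse (norm u) *\<^sub>R u \<in> V" "norm (inverse (norm u) *\<^sub>R u) = 1" "\<mu> > 0"
      using nrm[OF uV \<open>u \<noteq> 0\<close>] \<mu> by auto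
    show "R (inverse (norm u) *\<^sub>R u) = complex_of_real \<mu> *\<^sub>C inverse (norm u) *\<^sub>R u"
      by (simp add: lR Ru scaleC_of_real)
  qed
qed

text \<open>A maximal orthonormal set of eigenvectors exists by Zorn's lemma. Its orthogonal
  complement is closed and invariant under \<open>R\<close>, so a nonzero vector there would produce
  a further eigenvector and contradict maximality.\<close>

theorem compact_positive_eigenbasis:
  fixes R :: "'h::chilbert_space \<Rightarrow> 'h"
  assumes R: "compact_op R" and pos: "positive_op R" and inj: "\<And>x. R x = 0 \<Longrightarrow> x = 0"
  obtains E r where "eigenbasis R E r"
proof -
  have Rb: "bounded_clinear R" using R by (simp add: compact_op_def)
  note l = bounded_clinear_simps[OF Rb]
  have sym: "cinner (R x) y = cinner x (R y)" for x y by (rule positive_op_symmetric[OF pos])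
  define ev where "ev e \<longleftrightarrow> (\<exists>r>0. R e = complex_of_real r *\<^sub>C e)" for e
  define \<E> where "\<E> = {E. orthonormal E \<and> (\<forall>e\<in>E. ev e)}"
  have "\<exists>M\<in>\<E>. \<forall>X\<in>\<E>. M \<subseteq> X \<longrightarrow> X = M"
  proof (rule subset_Zorn')
    fix C assume C: "subset.chain \<E> C"
    have "cinner e f = (if e = f then 1 else 0)" if ef: "e \<in> \<Union>C" "f \<in> \<Union>C" for e f
    proof -
      obtain A B where AB: "A \<in> C" "B \<in> C" "e \<in> A" "f \<in> B" using ef by blast
      then have "A \<subseteq> B \<or> B \<subseteq> A" using C by (auto simp: subset.chain_def)
      then obtain M where "M \<in> C" "e \<in> M" "f \<in> M" using AB by blast
      then show ?thesis using C by (auto simp: subset.chain_def \<E>_def orthonormal_def)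
    qed
    moreover have "\<forall>e\<in>\<Union>C. ev e" using C by (auto simp: subset.chain_def \<E>_def)
    ultimately show "\<Union>C \<in> \<E>" by (simp add: \<E>_def orthonormal_def)
  qed
  then obtain E where E\<E>: "E \<in> \<E>" and max: "\<And>X. X \<in> \<E> \<Longrightarrow> E \<subseteq> X \<Longrightarrow> X = E"
    by blast
  from E\<E> have E: "orthonormal E" "\<And>e. e \<in> E \<Longrightarrow> ev e" by (auto simp: \<E>_def)
  have total: "x = 0" if x: "\<forall>e\<in>E. cinner e x = 0" for x
  proof (rule ccontr)
    assume x0: "x \<noteq> 0"
    define V where "V = {x. \<forall>e\<in>E. cinner e x = 0}"
    have subV: "subspace V"
      by (auto simp: V_def subspace_def cinner.zero_right cinner.add_right cinner.scaleR_right)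
    have "V = (\<Inter>e\<in>E. {x. cinner e x = 0})" by (auto simp: V_def)
    moreover have "closed {x. cinner e x = 0}" for e :: 'h
      by (intro closed_Collect_eq linear_continuous_on cinner.bounded_linear_right continuous_on_const)
    ultimately have clV: "closed V" by (simp add: closed_INT)
    have "R ` V \<subseteq> V"
    proof (rule image_subsetI)
      fix x assume "x \<in> V"
      then have "cinner e (R x) = 0" if "e \<in> E" for e
        using E(2)[OF that] that
        by (auto simp: V_def ev_def sym[symmetric] cinner_scaleC_left)
      then show "R x \<in> V" by (simp add: V_def)
    qed
    moreover have "x \<in> V" using x by (simp add: V_def)
    ultimately obtain e \<mu> where e: "e \<in> V" "norm e = 1" "\<mu> > 0" "R e = complex_of_real \<mu> *\<^sub>C e"
      using compact_positive_eigenvector[OF R pos inj subV clV _ _ x0] by metis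
    have e0: "cinner f e = 0" "cinner e f = 0" if "f \<in> E" for f
      using e(1) that cinner_eq_0_sym[of f e] by (auto simp: V_def)
    have "cinner e e = 1" using e(2) by (simp add: cinner_self)
    then have "insert e E \<in> \<E>"
      using e e0 E by (auto simp: \<E>_def orthonormal_def ev_def)
    from max[OF this] have "e \<in> E" by auto
    with e0 \<open>cinner e e = 1\<close> show False by auto
  qed
  define r where "r e = Re (cinner e (R e))" for e
  have r: "0 < r e \<and> R e = complex_of_real (r e) *\<^sub>C e" if "e \<in> E" for e
  proof -
    obtain t where "t > 0" "R e = complex_of_real t *\<^sub>C e" using E(2)[OF \<open>e \<in> E\<close>] by (auto simp: ev_def)
    moreover have "cinner e e = 1" using E(1) that by (auto simp: orthonormal_def)
    ultimately show ?thesis by (simp add: r_def cinner_scaleC_right)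
  qed
  have "finite {e \<in> E. s \<le> r e}" if s: "s > 0" for s
  proof -
    let ?F = "{e \<in> E. s \<le> r e}"
    have "\<forall>e>0. \<exists>k. finite k \<and> closure (R ` cball 0 1) \<subseteq> (\<Union>y\<in>k. ball y e)"
      using R by (simp add: compact_op_def compact_eq_totally_bounded)
    from spec[OF this, of "s / 2"] s
    obtain k where k: "finite k" "closure (R ` cball 0 1) \<subseteq> (\<Union>y\<in>k. ball y (s / 2))"
      by (meson half_gt_zero)
    \<comment> \<open>Orthogonal eigenvectors with eigenvalues at least \<open>s\<close> have images
      at distance at least \<open>s\<close>, so a ball of radius s/2 contains at most one of
      them.\<close>
    have one: "e = f" if e: "e \<in> ?F" "R e \<in> ball y (s / 2)" and f: "f \<in> ?F" "R f \<in> ball y (s / 2)" for e f y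
    proof (rule ccontr)
      assume "e \<noteq> f"
      then have o: "cinner e f = 0" "norm e = 1" "norm f = 1"
        using e f E(1) by (auto simp: orthonormal_def norm_eq_sqrt_Re_cinner)
      then have "(norm (R e - R f))\<^sup>2 = (r e)\<^sup>2 + (r f)\<^sup>2"
        using r e f by (simp add: norm_sq_diff cinner_simps norm_scaleC)
      moreover have "s\<^sup>2 \<le> (r e)\<^sup>2" using e s by (intro power_mono) auto
      ultimately have "s\<^sup>2 \<le> (norm (R e - R f))\<^sup>2" using zero_le_power2[of "r f"] by linarith
      then have "s \<le> norm (R e - R f)" by (rule power2_le_imp_le) simp
      also have "\<dots> < s"
        using e f dist_triangle_half_r[of y "R e" s "R f"] by (simp add: dist_norm)
      finally show False by simp
    qed
    have "?F \<subseteq> (\<Union>y\<in>k. {e \<in> ?F. R e \<in> ball y (s / 2)})"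
    proof
      fix e assume e: "e \<in> ?F"
      then have "norm e = 1" using E(1) by (simp add: orthonormal_def norm_eq_sqrt_Re_cinner)
      then have "R e \<in> closure (R ` cball 0 1)" using closure_subset[of "R ` cball 0 1"] by auto
      with k(2) have "R e \<in> (\<Union>y\<in>k. ball y (s / 2))" by (rule subsetD)
      with e show "e \<in> (\<Union>y\<in>k. {e \<in> ?F. R e \<in> ball y (s / 2)})" by auto
    qed
    moreover have "finite {e \<in> ?F. R e \<in> ball y (s / 2)}" for y
    proof (cases "\<exists>e. e \<in> {e \<in> ?F. R e \<in> ball y (s / 2)}")
      case True
      then obtain e where "e \<in> ?F" "R e \<in> ball y (s / 2)" by blast
      then have "{e \<in> ?F. R e \<in> ball y (s / 2)} \<subseteq> {e}" using one by blast
      then show ?thesis by (rule finite_subset) simp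
    next
      case False
      then have "{e \<in> ?F. R e \<in> ball y (s / 2)} = {}" by blast
      then show ?thesis by (simp only: finite.emptyI)
    qed
    then have "finite (\<Union>y\<in>k. {e \<in> ?F. R e \<in> ball y (s / 2)})"
      using k(1) by (rule finite_UN_I[rotated])
    ultimately show ?thesis by (rule finite_subset)
  qed
  then have "eigenbasis R E r"
    unfolding eigenbasis_def
    by (intro conjI allI impI ballI pos E(1) total) (auto dest: r)
  then show thesis by (rule that)
qed

section \<open>Diagonal operators, square roots and singular values\<close>

lemma cmod_cinner_commute: "cmod (cinner x y) = cmod (cinner y x)"
  by (subst cinner_commute) (rule complex_mod_cnj)

lemma orthonormalD:
  "orthonormal E \<Longrightarrow> e \<in> E \<Longrightarrow> f \<in> E \<Longrightarrow> cinner e f = (if e = f then 1 else 0)"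
  by (simp add: orthonormal_def)

lemma orthonormal_subset: "orthonormal E \<Longrightarrow> F \<subseteq> E \<Longrightarrow> orthonormal F"
  unfolding orthonormal_def by blast

lemma orthonormal_coeff:
  assumes "orthonormal E" "finite F" "F \<subseteq> E" "e \<in> E"
  shows "cinner e (\<Sum>f\<in>F. c f *\<^sub>C f) = (if e \<in> F then c e else 0)"
proof -
  have "cinner e (\<Sum>f\<in>F. c f *\<^sub>C f) = (\<Sum>f\<in>F. if e = f then c f else 0)"
    unfolding cinner.sum_right
    by (intro sum.cong refl) (use assms in \<open>auto simp: cinner_scaleC_right orthonormal_def\<close>)
  then show ?thesis using assms(2) by simp
qed

lemma orthonormal_norm_sum:
  assumes "orthonormal F" "finite F"
  shows "(norm (\<Sum>f\<in>F. c f *\<^sub>C f))\<^sup>2 = (\<Sum>f\<in>F. (cmod (c f))\<^sup>2)"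
proof -
  have "cinner (\<Sum>e\<in>F. c e *\<^sub>C e) (\<Sum>f\<in>F. c f *\<^sub>C f) = (\<Sum>e\<in>F. cnj (c e) * c e)"
    unfolding cinner.sum_left
    by (intro sum.cong refl) (use orthonormal_coeff[OF assms(1,2) order_refl] in \<open>simp add: cinner_scaleC_left\<close>)
  also have "\<dots> = complex_of_real (\<Sum>e\<in>F. (cmod (c e))\<^sup>2)"
    by (simp add: complex_norm_square mult.commute del: of_real_power)
  finally show ?thesis by (simp only: norm_sq_cinner Re_complex_of_real)
qed

lemma bessel:
  assumes "orthonormal F" "finite F"
  shows "(\<Sum>f\<in>F. (cmod (cinner f x))\<^sup>2) \<le> (norm x)\<^sup>2"
proof -
  let ?P = "\<Sum>f\<in>F. cinner f x *\<^sub>C f"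
  have "cinner x ?P = (\<Sum>f\<in>F. complex_of_real ((cmod (cinner f x))\<^sup>2))"
    unfolding cinner.sum_right cinner_scaleC_right
    by (intro sum.cong refl) (simp add: complex_norm_square cinner_commute[of x] del: of_real_power)
  then have "Re (cinner x ?P) = (\<Sum>f\<in>F. (cmod (cinner f x))\<^sup>2)"
    by (simp del: of_real_power)
  moreover have "0 \<le> (norm (x - ?P))\<^sup>2" by simp
  ultimately show ?thesis unfolding norm_sq_diff orthonormal_norm_sum[OF assms] by simp
qed

text \<open>By symmetry \<open>cinner e (S x)\<close> is determined by \<open>S e\<close>, so
  agreement on a total set suffices and no expansion of \<open>x\<close> is involved.\<close>

lemma positive_op_eqI:
  assumes "positive_op S" "positive_op T"
    and total: "\<And>x. (\<And>e. e \<in> E \<Longrightarrow> cinner e x = 0) \<Longrightarrow> x = 0"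
    and eq: "\<And>e. e \<in> E \<Longrightarrow> S e = T e"
  shows "S = T"
proof
  fix x
  have "cinner e (S x - T x) = 0" if "e \<in> E" for e
    using eq[OF that]
    by (simp add: cinner.diff_right positive_op_symmetric[OF assms(1), symmetric]
        positive_op_symmetric[OF assms(2), symmetric])
  from total[OF this] show "S x = T x" by simp
qed

lemma eigenbasisD:
  assumes "eigenbasis R E r"
  shows "positive_op R" "orthonormal E" "(\<And>e. e \<in> E \<Longrightarrow> cinner e x = 0) \<Longrightarrow> x = 0"
    "e \<in> E \<Longrightarrow> 0 < r e" "e \<in> E \<Longrightarrow> R e = complex_of_real (r e) *\<^sub>C e"
    "s > 0 \<Longrightarrow> finite {e \<in> E. s \<le> r e}"
  using assms unfolding eigenbasis_def by simp_all

text \<open>The truncation \<open>t n\<close> keeps the finitely many values of at least 1/(n+1). By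
  Pythagoras and Bessel the truncations are Cauchy in operator norm, which avoids sums over a
  possibly uncountable \<open>E\<close> and makes the limit compact.\<close>

lemma diagonal_op_exists:
  fixes E :: "'h::chilbert_space set"
  assumes E: "orthonormal E" and g: "\<And>e. e \<in> E \<Longrightarrow> 0 < g e"
    and fin: "\<And>s. s > 0 \<Longrightarrow> finite {e \<in> E. s \<le> g e}"
  obtains T where "compact_op T" "positive_op T" "\<And>e. e \<in> E \<Longrightarrow> T e = complex_of_real (g e) *\<^sub>C e"
proof -
  define F where "F n = {e \<in> E. inverse (real (Suc n)) \<le> g e}" for n
  have finF: "finite (F n)" for n unfolding F_def by (rule fin) simp
  have FE: "F n \<subseteq> E" for n by (auto simp: F_def)
  have mono: "F n \<subseteq> F m" if "n \<le> m" for n m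
  proof -
    have "inverse (real (Suc m)) \<le> inverse (real (Suc n))" using that by (simp add: field_simps)
    then show ?thesis unfolding F_def by (blast intro: order_trans)
  qed
  define t where "t n x = (\<Sum>e\<in>F n. (complex_of_real (g e) * cinner e x) *\<^sub>C e)" for n x
  have tc: "compact_op (t n)" for n
    unfolding t_def by (intro compact_op_sum finF compact_op_rank_one)
  then have tb: "bounded_clinear (t n)" for n by (simp add: compact_op_def)
  note tl = bounded_clinear_simps[OF tb]
  have close: "norm (t m x - t n x) \<le> inverse (real (Suc n)) * norm x" if "n \<le> m" for n m x
  proof -
    let ?G = "F m - F n"
    have G: "orthonormal ?G" "finite ?G"
      using orthonormal_subset[OF E, of ?G] finF FE[of m] by auto
    have "t m x - t n x = (\<Sum>e\<in>?G. (complex_of_real (g e) * cinner e x) *\<^sub>C e)"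
      unfolding t_def by (rule sum_diff[symmetric]) (use finF mono[OF that] in auto)
    then have "(norm (t m x - t n x))\<^sup>2 = (\<Sum>e\<in>?G. (g e)\<^sup>2 * (cmod (cinner e x))\<^sup>2)"
      by (simp add: orthonormal_norm_sum[OF G] norm_mult power_mult_distrib)
    also have "\<dots> \<le> (\<Sum>e\<in>?G. (inverse (real (Suc n)))\<^sup>2 * (cmod (cinner e x))\<^sup>2)"
    proof (intro sum_mono mult_right_mono power_mono)
      fix e assume e: "e \<in> ?G"
      then have "e \<in> E" using FE by auto
      then show "0 \<le> g e" using g by (simp add: less_imp_le)
      show "g e \<le> inverse (real (Suc n))" using e \<open>e \<in> E\<close> by (auto simp: F_def)
    qed auto
    also have "\<dots> \<le> (inverse (real (Suc n)))\<^sup>2 * (norm x)\<^sup>2"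
      unfolding sum_distrib_left[symmetric] by (intro mult_left_mono bessel G) simp
    finally have "(norm (t m x - t n x))\<^sup>2 \<le> (inverse (real (Suc n)) * norm x)\<^sup>2"
      by (simp only: power_mult_distrib)
    then show ?thesis by (rule power2_le_imp_le) simp
  qed
  have "\<exists>y. (\<lambda>n. t n x) \<longlonglongrightarrow> y" for x
  proof -
    have "Cauchy (\<lambda>n. t n x)"
    proof (rule metric_CauchyI)
      fix e :: real assume e: "e > 0"
      have lim: "(\<lambda>n. inverse (real (Suc n)) * norm x) \<longlonglongrightarrow> 0"
        using tendsto_mult_right[OF LIMSEQ_inverse_real_of_nat, of "norm x"] by simp
      obtain N where N: "inverse (real (Suc N)) * norm x < e / 2"
        using order_tendstoD(2)[OF lim, of "e / 2"] e by (auto simp: eventually_sequentially)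
      have "dist (t m x) (t n x) < e" if "m \<ge> N" "n \<ge> N" for m n
        using close[OF that(1), of x] close[OF that(2), of x] N
          dist_triangle_half_l[of "t m x" "t N x" e "t n x"] by (simp add: dist_norm)
      then show "\<exists>N. \<forall>m\<ge>N. \<forall>n\<ge>N. dist (t m x) (t n x) < e" by blast
    qed
    then show ?thesis using Cauchy_convergent convergent_def by blast
  qed
  then obtain T where T: "\<And>x. (\<lambda>n. t n x) \<longlonglongrightarrow> T x" by metis
  have Tc: "norm (T x - t n x) \<le> inverse (real (Suc n)) * norm x" for n x
  proof (rule LIMSEQ_le_const2)
    show "(\<lambda>m. norm (t m x - t n x)) \<longlonglongrightarrow> norm (T x - t n x)" by (intro tendsto_intros T)
    show "\<exists>N. \<forall>m\<ge>N. norm (t m x - t n x) \<le> inverse (real (Suc n)) * norm x"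
      using close by blast
  qed
  obtain K where K: "K > 0" "\<And>x. norm (t 0 x) \<le> K * norm x"
    using bounded_clinear_bound[OF tb] by blast
  have Tb: "bounded_clinear T"
  proof (rule bounded_clinearI)
    show "T (x + y) = T x + T y" for x y
      by (rule LIMSEQ_unique[OF T]) (unfold tl, intro tendsto_intros T)
    show "T (c *\<^sub>C x) = c *\<^sub>C T x" for c x
      by (rule LIMSEQ_unique[OF T]) (unfold tl, intro scaleC.tendsto tendsto_const T)
    show "norm (T x) \<le> (1 + K) * norm x" for x
      using Tc[of x 0] K(2)[of x] norm_triangle_ineq[of "T x - t 0 x" "t 0 x"]
      by (simp add: distrib_right)
  qed
  show thesis
  proof (rule that)
    show "compact_op T"
    proof (rule compact_op_limit[OF Tb])
      fix e :: real assume "e > 0"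
      then obtain n where n: "inverse (real (Suc n)) < e" using reals_Archimedean by blast
      have "norm (T x - t n x) \<le> e * norm x" for x
        by (rule order_trans[OF Tc]) (use n in \<open>simp add: mult_right_mono\<close>)
      then show "\<exists>S. compact_op S \<and> (\<forall>x. norm (T x - S x) \<le> e * norm x)" using tc by blast
    qed
    have "cinner x (t n x) = complex_of_real (\<Sum>e\<in>F n. g e * (cmod (cinner e x))\<^sup>2)" for n x
      unfolding t_def cinner.sum_right of_real_sum
      by (intro sum.cong refl)
        (simp add: cinner_scaleC_right complex_norm_square cinner_commute[of x] mult_ac del: of_real_power)
    moreover have "(\<Sum>e\<in>F n. g e * (cmod (cinner e x))\<^sup>2) \<ge> 0" for n x
      by (intro sum_nonneg mult_nonneg_nonneg) (use g FE in \<open>auto intro: less_imp_le\<close>)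
    ultimately have tp: "Im (cinner x (t n x)) = 0" "Re (cinner x (t n x)) \<ge> 0" for n x by simp_all
    have lim: "(\<lambda>n. cinner x (t n x)) \<longlonglongrightarrow> cinner x (T x)" for x
      by (intro cinner.tendsto tendsto_const T)
    have "Im (cinner x (T x)) = 0" for x
      using tendsto_Im[OF lim[of x]] LIMSEQ_unique[OF tendsto_const, of 0] by (simp add: tp(1))
    moreover have "Re (cinner x (T x)) \<ge> 0" for x
      by (rule LIMSEQ_le_const[OF tendsto_Re[OF lim]]) (simp add: tp(2))
    ultimately show "positive_op T" using Tb by (simp add: positive_op_def complex_is_Real_iff)
    fix e assume e: "e \<in> E"
    then obtain n where n: "inverse (real (Suc n)) < g e" using reals_Archimedean g by blast
    have "t m e = complex_of_real (g e) *\<^sub>C e" if "m \<ge> n" for m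
    proof -
      have "e \<in> F m" using mono[OF that] e n by (auto simp: F_def)
      moreover have "t m e = (\<Sum>f\<in>F m. if e = f then complex_of_real (g e) *\<^sub>C e else 0)"
        unfolding t_def
      proof (intro sum.cong refl)
        fix f assume "f \<in> F m"
        then have "f \<in> E" using FE by auto
        then show "(complex_of_real (g f) * cinner f e) *\<^sub>C f = (if e = f then complex_of_real (g e) *\<^sub>C e else 0)"
          using orthonormalD[OF E _ e] by auto
      qed
      ultimately show ?thesis using finF by simp
    qed
    then have "(\<lambda>m. t m e) \<longlonglongrightarrow> complex_of_real (g e) *\<^sub>C e"
      by (intro tendsto_eventually) (auto simp: eventually_sequentially)
    with T show "T e = complex_of_real (g e) *\<^sub>C e" by (rule LIMSEQ_unique)
  qed
qed

text \<open>By \<open>positive_op_eqI\<close> the operator is the compact one built in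
  \<open>diagonal_op_exists\<close>. This is how the inverse of 1 + \<D>^2 will be seen to be
  compact.\<close>

lemma eigenbasis_compact:
  assumes R: "eigenbasis R E r"
  shows "compact_op R"
proof -
  obtain T where T: "compact_op T" "positive_op T" "\<And>e. e \<in> E \<Longrightarrow> T e = complex_of_real (r e) *\<^sub>C e"
    using diagonal_op_exists[OF eigenbasisD(2)[OF R] eigenbasisD(4)[OF R] eigenbasisD(6)[OF R]] by blast
  have "R = T"
    by (rule positive_op_eqI[OF eigenbasisD(1)[OF R] T(2) eigenbasisD(3)[OF R]])
      (auto simp: T(3) eigenbasisD(5)[OF R])
  with T show ?thesis by simp
qed

text \<open>If \<open>S \<ge> 0\<close> and \<open>S\<^sup>2 e = r e\<close>, then \<open>S + \<surd>r\<close> is injective and kills \<open>(S - \<surd>r) e\<close>.\<close>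

lemma positive_sqrt_eigenvector:
  assumes S: "positive_op S" and r: "r > 0" and e: "S (S e) = complex_of_real r *\<^sub>C e"
  shows "S e = complex_of_real (sqrt r) *\<^sub>C e"
proof -
  have Sb: "bounded_clinear S" using S by (simp add: positive_op_def)
  note l = bounded_clinear_simps[OF Sb]
  define w where "w = S e - complex_of_real (sqrt r) *\<^sub>C e"
  have "complex_of_real (sqrt r) * complex_of_real (sqrt r) = complex_of_real r"
    using r by (simp flip: of_real_mult)
  then have "S w = - (complex_of_real (sqrt r) *\<^sub>C w)"
    by (simp add: w_def l e scaleC.diff_right scaleC_scaleC)
  then have "cinner w (S w) = - complex_of_real (sqrt r * (norm w)\<^sup>2)"
    by (simp add: cinner.minus_right cinner_scaleC_right cinner_self)
  moreover have "Re (cinner w (S w)) \<ge> 0" using S by (simp add: positive_op_def)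
  ultimately have "sqrt r * (norm w)\<^sup>2 \<le> 0" by simp
  then have "w = 0" using r by (simp add: mult_le_0_iff)
  then show ?thesis by (simp add: w_def)
qed

text \<open>Existence comes from the diagonal operator with eigenvalues \<open>sqrt (r e)\<close>.
  The definite description in \<open>op_sqrt\<close> also asks for uniqueness: by
  \<open>positive_sqrt_eigenvector\<close> any positive root takes the same values on
  \<open>E\<close>.\<close>

lemma op_sqrt_eigenbasis:
  assumes R: "eigenbasis R E r"
  shows "compact_op (op_sqrt R)" "positive_op (op_sqrt R)" "op_sqrt R (op_sqrt R x) = R x"
proof -
  note Rd = eigenbasisD[OF R]
  have fin: "finite {e \<in> E. s \<le> sqrt (r e)}" if "s > 0" for s
  proof (rule finite_subset[OF _ Rd(6)])
    show "{e \<in> E. s \<le> sqrt (r e)} \<subseteq> {e \<in> E. s\<^sup>2 \<le> r e}"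
    proof safe
      fix e assume "e \<in> E" "s \<le> sqrt (r e)"
      then have "s\<^sup>2 \<le> (sqrt (r e))\<^sup>2" using that by (intro power_mono) auto
      then show "s\<^sup>2 \<le> r e" using Rd(4)[OF \<open>e \<in> E\<close>] by simp
    qed
    show "s\<^sup>2 > 0" using that by simp
  qed
  have "\<And>e. e \<in> E \<Longrightarrow> 0 < sqrt (r e)" using Rd(4) by simp
  then obtain T where T: "compact_op T" "positive_op T"
      "\<And>e. e \<in> E \<Longrightarrow> T e = complex_of_real (sqrt (r e)) *\<^sub>C e"
    using diagonal_op_exists[OF Rd(2) _ fin] by metis
  have Tb: "bounded_clinear T" using T(2) by (simp add: positive_op_def)
  have TT: "T \<circ> T = R"
  proof (rule positive_op_eqI[OF _ Rd(1) Rd(3)])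
    have sym: "cinner x (T (T x)) = cinner (T x) (T x)" for x
      by (simp add: positive_op_symmetric[OF T(2)])
    show "positive_op (T \<circ> T)" unfolding positive_op_def
      using bounded_clinear_comp[OF Tb Tb] by (simp add: sym cinner_self)
    show "(T \<circ> T) e = R e" if "e \<in> E" for e
      using Rd(4)[OF that] by (simp add: T(3)[OF that] bounded_clinear_simps[OF Tb] scaleC_scaleC
          Rd(5)[OF that] flip: of_real_mult)
  qed auto
  have uniq: "S = T" if S: "positive_op S \<and> S \<circ> S = R" for S
  proof (rule positive_op_eqI[OF _ T(2) Rd(3)])
    fix e assume e: "e \<in> E"
    have "S (S e) = complex_of_real (r e) *\<^sub>C e" using S Rd(5)[OF e] by (metis comp_apply)
    then show "S e = T e" using S Rd(4)[OF e] T(3)[OF e] positive_sqrt_eigenvector by metis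
  qed (use S in auto)
  have eqT: "op_sqrt R = T"
    unfolding op_sqrt_def by (rule the_equality, rule conjI[OF T(2) TT], rule uniq)
  show "compact_op (op_sqrt R)" "positive_op (op_sqrt R)"
    using T(1,2) by (simp_all only: eqT)
  show "op_sqrt R (op_sqrt R x) = R x"
    using fun_cong[OF TT, of x] by (simp add: eqT)
qed

text \<open>Eigenvectors for eigenvalues at least \<open>s\<close> are orthogonal to the basis
  vectors with smaller eigenvalue, so \<open>B\<close> lies in the span of the finite set on the
  right. Summing |<e, v>|^2 over both families in two orders, with Bessel's inequality for
  \<open>B\<close>, compares the cardinalities.\<close>

lemma orthonormal_eigenvectors_card:
  assumes R: "eigenbasis R E r" and s: "s > 0" and B: "finite B" "orthonormal B"
    and ev: "\<And>v. v \<in> B \<Longrightarrow> \<exists>t\<ge>s. R v = complex_of_real t *\<^sub>C v"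
  shows "card B \<le> card {e \<in> E. s \<le> r e}"
proof -
  note Rd = eigenbasisD[OF R]
  let ?F = "{e \<in> E. s \<le> r e}"
  have F: "finite ?F" "orthonormal ?F" using Rd(6)[OF s] Rd(2) by (auto simp: orthonormal_def)
  have zero: "cinner e v = 0" if v: "v \<in> B" and e: "e \<in> E - ?F" for v e
  proof -
    obtain t where t: "t \<ge> s" "R v = complex_of_real t *\<^sub>C v" using ev[OF v] by blast
    have "complex_of_real (r e) * cinner e v = cinner (R e) v"
      using e by (simp add: Rd(5) cinner_scaleC_left)
    also have "\<dots> = complex_of_real t * cinner e v"
      by (simp add: positive_op_symmetric[OF Rd(1)] t(2) cinner_scaleC_right)
    finally have "r e = t \<or> cinner e v = 0" by auto
    with e t show ?thesis by auto
  qed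
  have expand: "v = (\<Sum>e\<in>?F. cinner e v *\<^sub>C e)" if v: "v \<in> B" for v
  proof -
    have "cinner e (v - (\<Sum>e\<in>?F. cinner e v *\<^sub>C e)) = 0" if e: "e \<in> E" for e
      using zero[OF v] e orthonormal_coeff[OF Rd(2) F(1) _ e, of "\<lambda>e. cinner e v"]
      by (auto simp: cinner.diff_right)
    from Rd(3)[OF this] show ?thesis by simp
  qed
  have n1: "norm v = 1" if "v \<in> B" for v
    using B(2) that by (simp add: orthonormal_def norm_eq_sqrt_Re_cinner)
  have "real (card B) = (\<Sum>v\<in>B. (norm v)\<^sup>2)" using n1 by simp
  also have "\<dots> = (\<Sum>v\<in>B. \<Sum>e\<in>?F. (cmod (cinner e v))\<^sup>2)"
  proof (rule sum.cong[OF refl])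
    fix v assume "v \<in> B"
    from expand[OF this] have "(norm v)\<^sup>2 = (norm (\<Sum>e\<in>?F. cinner e v *\<^sub>C e))\<^sup>2"
      by (rule arg_cong)
    then show "(norm v)\<^sup>2 = (\<Sum>e\<in>?F. (cmod (cinner e v))\<^sup>2)"
      by (simp only: orthonormal_norm_sum[OF F(2,1)])
  qed
  also have "\<dots> = (\<Sum>e\<in>?F. \<Sum>v\<in>B. (cmod (cinner v e))\<^sup>2)"
    unfolding sum.swap[of _ _ B] by (intro sum.cong refl) (simp add: cmod_cinner_commute)
  also have "\<dots> \<le> (\<Sum>e\<in>?F. (norm e)\<^sup>2)" by (intro sum_mono bessel B)
  also have "\<dots> = real (card ?F)"
    using F(2) by (simp add: orthonormal_def norm_eq_sqrt_Re_cinner)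
  finally show ?thesis by simp
qed

section \<open>Singular values by counting eigenvalues\<close>

context
  fixes R :: "'h::chilbert_space \<Rightarrow> 'h" and E r
  assumes R: "eigenbasis R E r"
begin

lemma sv_adjoint_iff:
  "op_adjoint (Some \<circ> op_sqrt R) (op_sqrt R v) = Some w \<longleftrightarrow> R v = w"
proof -
  have "op_adjoint (Some \<circ> op_sqrt R) (op_sqrt R v) = Some w \<longleftrightarrow> (\<forall>x. cinner x (R v) = cinner x w)"
    by (simp add: op_adjoint_total positive_op_symmetric[OF op_sqrt_eigenbasis(2)[OF R]]
        op_sqrt_eigenbasis(3)[OF R])
  then show ?thesis using cinner_eqI by metis
qed

text \<open>For \<open>T = op_sqrt R\<close> the adjoint of \<open>T\<close> composed with
  \<open>T\<close> is \<open>R\<close>; this is the set from \<open>singular_value\<close> after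
  that replacement.\<close>

definition sv_set :: "nat \<Rightarrow> real set" where
  "sv_set n = {s. 0 \<le> s \<and> (\<exists>B. finite B \<and> card B = n \<and> orthonormal B \<and>
     (\<forall>v\<in>B. \<exists>t\<ge>s. R v = complex_of_real (t\<^sup>2) *\<^sub>C v))}"

lemma singular_value_op_sqrt: "singular_value (op_sqrt R) n = Sup ({0} \<union> sv_set n)"
  unfolding singular_value_def sv_set_def orthonormal_def sv_adjoint_iff ..

text \<open>Together with \<open>singular_value_ge\<close> this translates between bounds on
  singular values and bounds on the number of eigenvalues of \<open>R\<close> above s^2.\<close>

lemma singular_value_le:
  assumes "c \<ge> 0" and "\<And>s. s > c \<Longrightarrow> card {e \<in> E. s\<^sup>2 \<le> r e} < n"
  shows "singular_value (op_sqrt R) n \<le> c"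
  unfolding singular_value_op_sqrt
proof (rule cSup_least)
  fix s assume s: "s \<in> {0} \<union> sv_set n"
  show "s \<le> c"
  proof (rule ccontr)
    assume c: "\<not> s \<le> c"
    then have s0: "s > 0" using assms(1) by simp
    then obtain B where B: "finite B" "card B = n" "orthonormal B"
        "\<forall>v\<in>B. \<exists>t\<ge>s. R v = complex_of_real (t\<^sup>2) *\<^sub>C v"
      using s by (auto simp: sv_set_def)
    have "card B \<le> card {e \<in> E. s\<^sup>2 \<le> r e}"
    proof (rule orthonormal_eigenvectors_card[OF R _ B(1,3)])
      fix v assume "v \<in> B"
      then obtain t where "t \<ge> s" "R v = complex_of_real (t\<^sup>2) *\<^sub>C v" using B(4) by blast
      moreover have "s\<^sup>2 \<le> t\<^sup>2" using \<open>t \<ge> s\<close> s0 by (intro power_mono) auto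
      ultimately show "\<exists>t\<ge>s\<^sup>2. R v = complex_of_real t *\<^sub>C v" by blast
    qed (use s0 in simp)
    with assms(2)[of s] c B(2) show False by simp
  qed
qed simp

text \<open>For \<open>n = 0\<close> the empty family qualifies for every \<open>s\<close>, so the
  set is unbounded and its supremum meaningless. For \<open>n \<ge> 1\<close> a unit eigenvector
  gives t^2 \<le> K; the bound \<open>max 1 K\<close> spares a square root.\<close>

lemma sv_set_bdd:
  assumes n: "n \<ge> 1"
  shows "bdd_above ({0} \<union> sv_set n)"
proof -
  have "bounded_clinear R" using eigenbasisD(1)[OF R] by (simp add: positive_op_def)
  then obtain K where K: "K > 0" "\<And>x. norm (R x) \<le> K * norm x"
    using bounded_clinear_bound by blast
  have "s' \<le> max 1 K" if s'n: "s' \<in> {0} \<union> sv_set n" for s'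
  proof (cases "s' = 0")
    case False
    then obtain B where B: "card B = n" "orthonormal B"
        "\<forall>v\<in>B. \<exists>t\<ge>s'. R v = complex_of_real (t\<^sup>2) *\<^sub>C v" and s': "s' \<ge> 0"
      using s'n by (auto simp: sv_set_def)
    have "B \<noteq> {}" using B(1) n by auto
    then obtain v where v: "v \<in> B" by blast
    with B(3) obtain t where t: "t \<ge> s'" "R v = complex_of_real (t\<^sup>2) *\<^sub>C v" by blast
    have "norm v = 1" using B(2) v by (simp add: orthonormal_def norm_eq_sqrt_Re_cinner)
    with K(2)[of v] t(2) have "t * t \<le> K" by (simp add: norm_scaleC norm_mult power2_eq_square)
    show ?thesis
    proof (cases "t \<le> 1")
      case False
      then have "t * 1 \<le> t * t" by (intro mult_left_mono) auto
      with \<open>t * t \<le> K\<close> t(1) show ?thesis by simp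
    qed (use t(1) in simp)
  qed simp
  then show "bdd_above ({0} \<union> sv_set n)" by (rule bdd_aboveI)
qed

lemma singular_value_nonneg: "n \<ge> 1 \<Longrightarrow> 0 \<le> singular_value (op_sqrt R) n"
  unfolding singular_value_op_sqrt by (rule cSup_upper[OF _ sv_set_bdd]) auto

lemma singular_value_ge:
  assumes s: "s > 0" and n: "n \<ge> 1" "n \<le> card {e \<in> E. s\<^sup>2 \<le> r e}"
  shows "s \<le> singular_value (op_sqrt R) n"
  unfolding singular_value_op_sqrt
proof (rule cSup_upper[OF _ sv_set_bdd[OF n(1)]])
  note Rd = eigenbasisD[OF R]
  obtain B where B: "B \<subseteq> {e \<in> E. s\<^sup>2 \<le> r e}" "card B = n" "finite B"
    by (rule obtain_subset_with_card_n[OF n(2)])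
  have "orthonormal B" by (rule orthonormal_subset[OF Rd(2)]) (use B(1) in auto)
  moreover have "\<exists>t\<ge>s. R v = complex_of_real (t\<^sup>2) *\<^sub>C v" if "v \<in> B" for v
  proof -
    have v: "v \<in> E" "s\<^sup>2 \<le> r v" using that B(1) by auto
    then have "s \<le> sqrt (r v)" using s by (simp add: real_le_rsqrt)
    moreover have "R v = complex_of_real ((sqrt (r v))\<^sup>2) *\<^sub>C v"
      using Rd(4,5)[OF v(1)] by simp
    ultimately show ?thesis by blast
  qed
  ultimately show "s \<in> {0} \<union> sv_set n" using B s by (auto simp: sv_set_def)
qed

end

section \<open>Self-adjoint operators\<close>

text \<open>Minimizing sequences for the distance to \<open>M\<close> are Cauchy by the parallelogram law.\<close>

lemma exists_orthogonal:
  fixes M :: "'h::chilbert_space set"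
  assumes M: "subspace M" "closed M" and x: "x \<notin> M"
  obtains z where "z \<noteq> 0" "\<And>m. m \<in> M \<Longrightarrow> inner z m = 0"
proof -
  define d where "d = infdist x M"
  have ne: "M \<noteq> {}" using subspace_0[OF M(1)] by blast
  have le: "d \<le> norm (x - m)" if "m \<in> M" for m
    using infdist_le[OF that, of x] by (simp add: d_def dist_norm)
  have d0: "d \<ge> 0" by (simp add: d_def infdist_nonneg)
  have "\<exists>m\<in>M. norm (x - m) < d + inverse (real (Suc n))" for n
  proof -
    have "(INF a\<in>M. dist x a) < d + inverse (real (Suc n))"
      using ne by (simp add: d_def infdist_def)
    moreover have "bdd_below (dist x ` M)" by (rule bdd_belowI[of _ 0]) auto
    ultimately have "\<exists>m\<in>M. dist x m < d + inverse (real (Suc n))"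
      by (simp only: cINF_less_iff[OF ne])
    then show ?thesis by (simp only: dist_norm)
  qed
  then obtain m where m: "\<And>n. m n \<in> M" "\<And>n. norm (x - m n) < d + inverse (real (Suc n))"
    by metis
  have cl: "(norm (m k - m l))\<^sup>2 \<le> 4 * (d + inverse (real (Suc N)))\<^sup>2 - 4 * d\<^sup>2"
    if kl: "k \<ge> N" "l \<ge> N" for k l N
  proof -
    let ?e = "inverse (real (Suc N))"
    have e: "norm (x - m j) \<le> d + ?e" if "j \<ge> N" for j
    proof -
      have "inverse (real (Suc j)) \<le> ?e" using that by simp
      with m(2)[of j] show ?thesis by linarith
    qed
    have sq: "(norm (x - m j))\<^sup>2 \<le> (d + ?e)\<^sup>2" if "j \<ge> N" for j
      using e[OF that] by (intro power_mono) auto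
    have "(1 / 2) *\<^sub>R (m k + m l) \<in> M" using m(1) M(1) by (intro subspace_scale subspace_add)
    from le[OF this] have "d\<^sup>2 \<le> (norm (x - (1 / 2) *\<^sub>R (m k + m l)))\<^sup>2" using d0 by (intro power_mono)
    moreover have "(x - m k) + (x - m l) = 2 *\<^sub>R (x - (1 / 2) *\<^sub>R (m k + m l))"
      by (simp add: algebra_simps scaleR_2)
    then have "(norm ((x - m k) + (x - m l)))\<^sup>2 = 4 * (norm (x - (1 / 2) *\<^sub>R (m k + m l)))\<^sup>2"
      by (simp add: power_mult_distrib)
    moreover have "(norm ((x - m k) + (x - m l)))\<^sup>2 + (norm ((x - m k) - (x - m l)))\<^sup>2
        = 2 * (norm (x - m k))\<^sup>2 + 2 * (norm (x - m l))\<^sup>2"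
      unfolding norm_sq_add norm_sq_diff by simp
    moreover have "norm ((x - m k) - (x - m l)) = norm (m k - m l)"
      by (simp add: norm_minus_commute)
    ultimately show ?thesis using sq[OF kl(1)] sq[OF kl(2)] by simp
  qed
  have "Cauchy m"
  proof (rule metric_CauchyI)
    fix e :: real assume e: "e > 0"
    have "(\<lambda>N. 4 * (d + inverse (real (Suc N)))\<^sup>2 - 4 * d\<^sup>2) \<longlonglongrightarrow> 4 * (d + 0)\<^sup>2 - 4 * d\<^sup>2"
      by (intro tendsto_intros LIMSEQ_inverse_real_of_nat)
    then have "(\<lambda>N. 4 * (d + inverse (real (Suc N)))\<^sup>2 - 4 * d\<^sup>2) \<longlonglongrightarrow> 0" by simp
    from order_tendstoD(2)[OF this, of "e\<^sup>2"] e
    obtain N where N: "4 * (d + inverse (real (Suc N)))\<^sup>2 - 4 * d\<^sup>2 < e\<^sup>2"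
      by (auto simp: eventually_sequentially)
    have "dist (m k) (m l) < e" if "k \<ge> N" "l \<ge> N" for k l
    proof -
      have "(dist (m k) (m l))\<^sup>2 < e\<^sup>2" using cl[OF that] N by (simp add: dist_norm)
      then show ?thesis by (rule power2_less_imp_less) (use e in simp)
    qed
    then show "\<exists>N. \<forall>k\<ge>N. \<forall>l\<ge>N. dist (m k) (m l) < e" by blast
  qed
  then obtain p where p: "m \<longlonglongrightarrow> p" using Cauchy_convergent convergent_def by blast
  have pM: "p \<in> M" using closed_sequentially[OF M(2) _ p] m(1) by blast
  have dp: "norm (x - p) \<le> d"
  proof (rule LIMSEQ_le)
    show "(\<lambda>n. norm (x - m n)) \<longlonglongrightarrow> norm (x - p)" by (intro tendsto_intros p)
    show "(\<lambda>n. d + inverse (real (Suc n))) \<longlonglongrightarrow> d"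
      using tendsto_add[OF tendsto_const LIMSEQ_inverse_real_of_nat, of d] by simp
    show "\<exists>N. \<forall>n\<ge>N. norm (x - m n) \<le> d + inverse (real (Suc n))"
      using m(2) less_imp_le by blast
  qed
  show thesis
  proof (rule that)
    show "x - p \<noteq> 0" using pM x by auto
    fix y assume y: "y \<in> M"
    show "inner (x - p) y = 0"
    proof (cases "y = 0")
      case False
      \<comment> \<open>\<open>a *\<^sub>R y\<close> is the projection of x - p onto y; moving p by
        it cannot decrease the distance to x, which forces the inner product to vanish.\<close>
      define a where "a = inner (x - p) y / (norm y)\<^sup>2"
      have "p + a *\<^sub>R y \<in> M" using pM y M(1) by (intro subspace_add subspace_scale)
      from le[OF this] have "norm (x - p) \<le> norm ((x - p) - a *\<^sub>R y)"
        using dp by (simp add: algebra_simps)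
      then have "(norm (x - p))\<^sup>2 \<le> (norm ((x - p) - a *\<^sub>R y))\<^sup>2" by (intro power_mono) auto
      also have "\<dots> = (norm (x - p))\<^sup>2 - 2 * a * inner (x - p) y + a\<^sup>2 * (norm y)\<^sup>2"
        unfolding norm_sq_diff by (simp add: power_mult_distrib cinner.scaleR_right inner_eq_Re_cinner)
      finally have "2 * a * inner (x - p) y \<le> a\<^sup>2 * (norm y)\<^sup>2" by simp
      then have "(inner (x - p) y)\<^sup>2 / (norm y)\<^sup>2 \<le> 0"
        using False by (simp add: a_def power2_eq_square field_simps)
      then have "(inner (x - p) y)\<^sup>2 \<le> 0" using False by (simp add: divide_le_0_iff)
      then show ?thesis by simp
    qed simp
  qed
qed

lemma self_adjoint_iff:
  assumes "self_adjoint T"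
  shows "T y = Some z \<longleftrightarrow> (\<forall>x\<in>dom T. cinner (the (T x)) y = cinner x z)"
  using assms op_adjoint_eq_Some[of T y z] by (simp add: self_adjoint_def densely_defined_def)

lemma self_adjoint_linear:
  assumes "self_adjoint T"
  shows "T 0 = Some 0" "T x = Some u \<Longrightarrow> T y = Some v \<Longrightarrow> T (x + y) = Some (u + v)"
    "T x = Some u \<Longrightarrow> T (c *\<^sub>C x) = Some (c *\<^sub>C u)"
    "T x = Some u \<Longrightarrow> T y = Some v \<Longrightarrow> T (x - y) = Some (u - v)"
proof -
  have l: "op_linear T" using assms by (simp add: self_adjoint_def densely_defined_def)
  show "T 0 = Some 0" using l by (simp add: op_linear_def)
  show add: "T x = Some u \<Longrightarrow> T y = Some v \<Longrightarrow> T (x + y) = Some (u + v)" for y v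
    using l unfolding op_linear_def by (metis domI option.sel)
  show sc: "T x = Some u \<Longrightarrow> T (c *\<^sub>C x) = Some (c *\<^sub>C u)" for c x u
    using l unfolding op_linear_def by (metis domI option.sel)
  show "T x = Some u \<Longrightarrow> T y = Some v \<Longrightarrow> T (x - y) = Some (u - v)"
    using add[of "- y" "- v"] sc[of y v "- 1"] by simp
qed

lemma self_adjoint_symmetric:
  assumes "self_adjoint T" "T x = Some u" "T y = Some v"
  shows "cinner u y = cinner x v"
  using self_adjoint_iff[OF assms(1), of y v] assms by (metis domI option.sel)

lemma self_adjoint_real:
  assumes "self_adjoint T" "T x = Some u"
  shows "Im (cinner x u) = 0"
  using self_adjoint_symmetric[OF assms(1,2,2)] cinner_commute[of x u]
  by (metis add.inverse_neutral cnj.simps(2) equal_neg_zero)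

text \<open>Since <u, x> is real, the cross term is purely imaginary. The identity gives the closed
  range of T + \<i> and T - \<i>, and it separates D \<xi>_k from k \<xi>_k in
  \<open>D0_iff\<close>.\<close>

lemma self_adjoint_norm_shift:
  assumes "self_adjoint T" "T x = Some u"
  shows "(norm (u + (\<i> * complex_of_real t) *\<^sub>C x))\<^sup>2 = (norm u)\<^sup>2 + t\<^sup>2 * (norm x)\<^sup>2"
proof -
  have "Re (cinner u ((\<i> * complex_of_real t) *\<^sub>C x)) = 0"
    using self_adjoint_real[OF assms] self_adjoint_symmetric[OF assms(1,2,2)]
    by (simp add: cinner_scaleC_right)
  then show ?thesis
    unfolding norm_sq_add by (simp add: norm_scaleC norm_mult power_mult_distrib)
qed

lemma self_adjoint_closed:
  assumes T: "self_adjoint T" and f: "\<And>n. T (f n) = Some (g n)" "f \<longlonglongrightarrow> x" "g \<longlonglongrightarrow> y"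
  shows "T x = Some y"
  unfolding self_adjoint_iff[OF T]
proof
  fix w assume "w \<in> dom T"
  then obtain v where v: "T w = Some v" by blast
  have "(\<lambda>n. cinner v (f n)) \<longlonglongrightarrow> cinner v x" by (intro cinner.tendsto tendsto_const f)
  moreover have "(\<lambda>n. cinner v (f n)) \<longlonglongrightarrow> cinner w y"
    unfolding self_adjoint_symmetric[OF T v f(1)] by (intro cinner.tendsto tendsto_const f)
  ultimately show "cinner (the (T w)) x = cinner w y" using v LIMSEQ_unique by simp blast
qed

text \<open>The range of T + \<i>s is closed because T is closed and |(T + \<i>s) x| \<ge> |x|. A
  vector z orthogonal to the range satisfies T z = \<i>s z, and self-adjointness excludes nonreal
  eigenvalues.\<close>

lemma self_adjoint_shift_surj:
  fixes T :: "'h::chilbert_space \<rightharpoonup> 'h"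
  assumes T: "self_adjoint T" and s: "s = 1 \<or> s = - (1 :: real)"
  obtains x u where "T x = Some u" "u + (\<i> * complex_of_real s) *\<^sub>C x = y"
proof -
  let ?c = "\<i> * complex_of_real s"
  note lin = self_adjoint_linear[OF T]
  define M where "M = {u + ?c *\<^sub>C x |x u. T x = Some u}"
  have s2: "s\<^sup>2 = 1" using s by auto
  have "closed M"
    unfolding closed_sequential_limits
  proof safe
    fix f l assume f: "\<forall>n. f n \<in> M" "f \<longlonglongrightarrow> l"
    then have "\<exists>x u. T x = Some u \<and> f n = u + ?c *\<^sub>C x" for n unfolding M_def by blast
    then obtain x u where xu: "\<And>n. T (x n) = Some (u n)" "\<And>n. f n = u n + ?c *\<^sub>C x n" by metis
    have "norm (x m - x n) \<le> norm (f m - f n)" for m n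
    proof (rule power2_le_imp_le)
      have "f m - f n = (u m - u n) + ?c *\<^sub>C (x m - x n)"
        by (simp add: xu(2) scaleC.diff_right)
      then have "(norm (f m - f n))\<^sup>2 = (norm (u m - u n))\<^sup>2 + (norm (x m - x n))\<^sup>2"
        using self_adjoint_norm_shift[OF T lin(4)[OF xu(1) xu(1)], of m n s] s2 by simp
      then show "(norm (x m - x n))\<^sup>2 \<le> (norm (f m - f n))\<^sup>2" by simp
    qed simp
    moreover have "Cauchy f" using f(2) by (rule LIMSEQ_imp_Cauchy)
    ultimately have "Cauchy x" unfolding Cauchy_def dist_norm by (meson le_less_trans)
    then obtain x0 where x0: "x \<longlonglongrightarrow> x0" using Cauchy_convergent convergent_def by blast
    have "(\<lambda>n. f n - ?c *\<^sub>C x n) \<longlonglongrightarrow> l - ?c *\<^sub>C x0"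
      by (intro tendsto_diff f(2) scaleC.tendsto tendsto_const x0)
    then have "u \<longlonglongrightarrow> l - ?c *\<^sub>C x0" by (simp add: xu(2))
    from self_adjoint_closed[OF T xu(1) x0 this] show "l \<in> M" unfolding M_def by force
  qed
  moreover have "subspace M"
  proof (rule subspaceI)
    show "0 \<in> M" using lin(1) unfolding M_def by (force simp: scaleC.zero_right)
    show "a + b \<in> M" if "a \<in> M" "b \<in> M" for a b
    proof -
      from that obtain x u y v where "T x = Some u" "a = u + ?c *\<^sub>C x" "T y = Some v" "b = v + ?c *\<^sub>C y"
        by (auto simp: M_def)
      then show ?thesis unfolding M_def
        using lin(2)[of x u y v] by (intro CollectI exI[of _ "x + y"] exI[of _ "u + v"])
          (simp add: scaleC_add_right)
    qed
    show "r *\<^sub>R a \<in> M" if "a \<in> M" for r a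
    proof -
      from that obtain x u where "T x = Some u" "a = u + ?c *\<^sub>C x" by (auto simp: M_def)
      then show ?thesis unfolding M_def
        using lin(3)[of x u "complex_of_real r"]
        by (intro CollectI exI[of _ "r *\<^sub>R x"] exI[of _ "r *\<^sub>R u"])
          (simp add: scaleC_of_real scaleR_add_right scaleC.scaleR_right)
    qed
  qed
  moreover have "z = 0" if z: "\<And>m. m \<in> M \<Longrightarrow> inner z m = 0" for z
  proof -
    \<comment> \<open>\<open>exists_orthogonal\<close> speaks of the real inner product; since
      \<open>M\<close> is invariant under \<i>, testing with \<i> times a vector recovers the
      imaginary part.\<close>
    have orth: "cinner z (u + ?c *\<^sub>C x) = 0" if xu: "T x = Some u" for x u
    proof -
      have "u + ?c *\<^sub>C x \<in> M" using xu by (auto simp: M_def)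
      moreover have "\<i> *\<^sub>C (u + ?c *\<^sub>C x) = (\<i> *\<^sub>C u) + ?c *\<^sub>C (\<i> *\<^sub>C x)"
        by (simp add: scaleC_add_right scaleC_scaleC mult_ac)
      then have "\<i> *\<^sub>C (u + ?c *\<^sub>C x) \<in> M" using lin(3)[OF xu, of \<i>] unfolding M_def by blast
      ultimately show ?thesis
        using z[of "u + ?c *\<^sub>C x"] z[of "\<i> *\<^sub>C (u + ?c *\<^sub>C x)"]
        by (simp add: inner_eq_Re_cinner cinner_scaleC_right complex_eq_iff)
    qed
    have Tz: "T z = Some (?c *\<^sub>C z)"
      unfolding self_adjoint_iff[OF T]
    proof
      fix x assume "x \<in> dom T"
      then obtain u where u: "T x = Some u" by blast
      have "cinner (u + ?c *\<^sub>C x) z = 0" using orth[OF u] cinner_eq_0_sym by blast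
      then show "cinner (the (T x)) z = cinner x (?c *\<^sub>C z)"
        using u by (simp add: cinner_simps)
    qed
    from self_adjoint_real[OF T this] have "s * (norm z)\<^sup>2 = 0"
      by (simp add: cinner_scaleC_right cinner_self)
    with s show ?thesis by auto
  qed
  ultimately have "y \<in> M" using exists_orthogonal[of M y] by metis
  then show thesis using that unfolding M_def by blast
qed

section \<open>The inverse of 1 + T^2\<close>

lemma one_plus_sq_eq:
  "op_add Some (T \<circ>\<^sub>m T) x = Some y \<longleftrightarrow> (\<exists>u w. T x = Some u \<and> T u = Some w \<and> y = x + w)"
  by (auto simp: op_add_def dom_def map_comp_def split: option.splits)

lemma self_adjoint_one_plus_sq_bound:
  assumes T: "self_adjoint T" "T x = Some u" "T u = Some w"
  shows "cinner x (x + w) = complex_of_real ((norm x)\<^sup>2 + (norm u)\<^sup>2)"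
  using self_adjoint_symmetric[OF T] by (simp add: cinner.add_right cinner_self)

text \<open>Surjectivity follows from 1 + T^2 = (T + \<i>) (T - \<i>) by solving two first-order
  equations, injectivity from <x, (1 + T^2) x> = |x|^2 + |T x|^2.\<close>

lemma self_adjoint_inv_one_plus_sq:
  assumes T: "self_adjoint T"
  shows "inv_one_plus_sq T y = x \<longleftrightarrow> (\<exists>u w. T x = Some u \<and> T u = Some w \<and> y = x + w)"
proof -
  note lin = self_adjoint_linear[OF T]
  let ?P = "\<lambda>x. \<exists>u w. T x = Some u \<and> T u = Some w \<and> y = x + w"
  have uniq: "x' = x''" if P: "?P x'" "?P x''" for x' x''
  proof -
    obtain u w u' w' where h: "T x' = Some u" "T u = Some w" "y = x' + w"
        "T x'' = Some u'" "T u' = Some w'" "y = x'' + w'" using P by blast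
    from self_adjoint_one_plus_sq_bound[OF T lin(4)[OF h(1,4)] lin(4)[OF h(2,5)]]
    have "complex_of_real ((norm (x' - x''))\<^sup>2 + (norm (u - u'))\<^sup>2) = cinner (x' - x'') ((x' + w) - (x'' + w'))"
      by (simp add: algebra_simps)
    also have "(x' + w) - (x'' + w') = 0" using h(3,6) by simp
    finally have "(norm (x' - x''))\<^sup>2 + (norm (u - u'))\<^sup>2 = 0"
      by (simp only: cinner.zero_right of_real_eq_0_iff)
    then show ?thesis by (simp add: add_nonneg_eq_0_iff)
  qed
  obtain x1 u1 where 1: "T x1 = Some u1" "u1 + (\<i> * complex_of_real 1) *\<^sub>C x1 = y"
    using self_adjoint_shift_surj[OF T] by metis
  obtain x2 u2 where 2: "T x2 = Some u2" "u2 + (\<i> * complex_of_real (- 1)) *\<^sub>C x2 = x1"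
    using self_adjoint_shift_surj[OF T] by metis
  have u2: "u2 = x1 + \<i> *\<^sub>C x2" using 2(2) by (simp add: scaleC.minus_left algebra_simps)
  have "T u2 = Some (u1 + \<i> *\<^sub>C u2)" unfolding u2 using lin(2)[OF 1(1) lin(3)[OF 2(1)]] u2 by simp
  moreover have "y = x2 + (u1 + \<i> *\<^sub>C u2)"
    unfolding 1(2)[symmetric] u2 by (simp add: scaleC_add_right scaleC_scaleC)
  ultimately have P2: "?P x2" using 2(1) by blast
  have "inv_one_plus_sq T y = (THE x. ?P x)"
    by (simp add: inv_one_plus_sq_def op_inv_def one_plus_sq_eq)
  also have "\<dots> = x2" by (rule the_equality) (use P2 uniq in blast)+
  finally show ?thesis using P2 uniq by blast
qed

text \<open>For \<open>x = inv_one_plus_sq T y\<close> the Cauchy-Schwarz inequality gives |x|^2 +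
  |T x|^2 \<le> |x| |y|, which bounds both the inverse and \<open>U\<close>, that is T (1 +
  T^2)^(-1).\<close>

lemma inv_one_plus_sq_positive:
  assumes T: "self_adjoint T"
  shows "positive_op (inv_one_plus_sq T)" "inv_one_plus_sq T y = 0 \<Longrightarrow> y = 0"
    "\<And>y. norm (inv_one_plus_sq T y) \<le> norm y"
    "\<exists>U. bounded_clinear U \<and> (\<forall>y. T (inv_one_plus_sq T y) = Some (U y))"
proof -
  note lin = self_adjoint_linear[OF T] and iff = self_adjoint_inv_one_plus_sq[OF T]
  let ?R = "inv_one_plus_sq T"
  have ex: "\<exists>u w. T (?R y) = Some u \<and> T u = Some w \<and> y = ?R y + w" for y
    using iff[of y "?R y"] by simp
  then obtain U W where UW: "\<And>y. T (?R y) = Some (U y)" "\<And>y. T (U y) = Some (W y)" "\<And>y. y = ?R y + W y"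
    by metis
  show "y = 0" if "?R y = 0" for y
    using UW[of y] that lin(1) by auto
  have add: "?R (x + y) = ?R x + ?R y" for x y
    unfolding iff using lin(2)[OF UW(1)[of x] UW(1)[of y]] lin(2)[OF UW(2)[of x] UW(2)[of y]] UW(3)[of x] UW(3)[of y]
    by (intro exI[of _ "U x + U y"] exI[of _ "W x + W y"]) (auto simp: algebra_simps)
  have sc: "?R (c *\<^sub>C x) = c *\<^sub>C ?R x" for c x
    unfolding iff using lin(3)[OF UW(1)[of x], of c] lin(3)[OF UW(2)[of x], of c]
      arg_cong[OF UW(3)[of x], of "scaleC c"]
    by (intro exI[of _ "c *\<^sub>C U x"] exI[of _ "c *\<^sub>C W x"]) (simp add: scaleC_add_right)
  have pos: "cinner (?R y) y = complex_of_real ((norm (?R y))\<^sup>2 + (norm (U y))\<^sup>2)" for y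
    using self_adjoint_one_plus_sq_bound[OF T UW(1,2)[of y]] UW(3)[of y] by metis
  have est: "(norm (?R y))\<^sup>2 + (norm (U y))\<^sup>2 \<le> norm (?R y) * norm y" for y
    using cmod_cinner_le[of "?R y" y] unfolding pos by (simp add: norm_of_real del: of_real_add of_real_power)
  show bd: "norm (?R y) \<le> norm y" for y
  proof (cases "norm (?R y) = 0")
    case False
    have "norm (?R y) * norm (?R y) \<le> norm (?R y) * norm y"
      unfolding power2_eq_square[symmetric]
      using est[of y] zero_le_power2[of "norm (U y)"] by linarith
    with False show ?thesis by (simp add: mult_le_cancel_left)
  qed simp
  have Rb: "bounded_clinear ?R" by (rule bounded_clinearI[of _ 1]) (use add sc bd in auto)
  have "cinner y (?R y) = complex_of_real ((norm (?R y))\<^sup>2 + (norm (U y))\<^sup>2)" for y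
    using pos[of y] cinner_commute[of y "?R y"] by (simp del: of_real_add of_real_power)
  then show "positive_op ?R" using Rb by (simp add: positive_op_def del: of_real_add of_real_power)
  have "bounded_clinear U"
  proof (rule bounded_clinearI[of _ 1])
    show "U (x + y) = U x + U y" for x y
      using lin(2)[OF UW(1)[of x] UW(1)[of y]] UW(1)[of "x + y"] by (simp add: add)
    show "U (c *\<^sub>C x) = c *\<^sub>C U x" for c x
      using lin(3)[OF UW(1)[of x], of c] UW(1)[of "c *\<^sub>C x"] by (simp add: sc)
    show "norm (U y) \<le> 1 * norm y" for y
    proof -
      have "(norm (U y))\<^sup>2 \<le> norm (?R y) * norm y"
        using est[of y] zero_le_power2[of "norm (?R y)"] by linarith
      also have "\<dots> \<le> norm y * norm y" by (intro mult_right_mono bd) simp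
      finally have "(norm (U y))\<^sup>2 \<le> (norm y)\<^sup>2" by (simp add: power2_eq_square)
      from power2_le_imp_le[OF this norm_ge_zero] show ?thesis by simp
    qed
  qed
  then show "\<exists>U. bounded_clinear U \<and> (\<forall>y. T (?R y) = Some (U y))" using UW(1) by blast
qed

text \<open>The inverse factors as (T - c)^(-1) composed with the bounded operator \<open>Z\<close>,
  which is (T - c) (1 + T^2)^(-1), for whichever \<open>c\<close> the hypothesis provides.\<close>

lemma compact_resolvent_inv_one_plus_sq:
  assumes T: "self_adjoint T" and c: "compact_resolvent T"
  shows "compact_op (inv_one_plus_sq T)"
proof -
  let ?R = "inv_one_plus_sq T"
  obtain c where K: "op_bij (op_add T (\<lambda>x. Some (- (c *\<^sub>C x))))"
      "compact_op (op_inv (op_add T (\<lambda>x. Some (- (c *\<^sub>C x)))))"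
    using c unfolding compact_resolvent_def Let_def by blast
  let ?S = "op_add T (\<lambda>x. Some (- (c *\<^sub>C x)))"
  obtain U where U: "bounded_clinear U" "\<And>y. T (?R y) = Some (U y)"
    using inv_one_plus_sq_positive(4)[OF T] by blast
  define Z where "Z y = U y + (- c) *\<^sub>C ?R y" for y
  have Rb: "bounded_clinear ?R" using inv_one_plus_sq_positive(1)[OF T] by (simp add: positive_op_def)
  have Zb: "bounded_clinear Z" unfolding Z_def
    by (intro bounded_clinear_add bounded_clinear_mult U Rb)
  have "op_inv ?S (Z y) = ?R y" for y
  proof -
    have "?S (?R y) = Some (Z y)"
      using U(2)[of y] by (auto simp: op_add_def dom_def Z_def scaleC.minus_left)
    moreover from K(1) have "\<exists>!x. ?S x = Some (Z y)" by (simp only: op_bij_def)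
    ultimately show ?thesis unfolding op_inv_def by (metis (mono_tags, lifting) the1_equality)
  qed
  then have "?R = op_inv ?S \<circ> Z" by (simp add: fun_eq_iff)
  with compact_op_comp_right[OF K(2) Zb] show ?thesis by simp
qed

section \<open>Two-sided sequences and the operator on the crossed product\<close>

text \<open>The elementary tensor of \<open>x\<close> with the basis vector at position
  \<open>k\<close>.\<close>

definition delta :: "int \<Rightarrow> 'h::chilbert_space \<Rightarrow> 'h l2Z" where
  "delta k x = Abs_l2Z (\<lambda>j. if j = k then x else 0)"

lemma coord_delta [simp]: "coord (delta k x) j = (if j = k then x else 0)"
proof -
  have "(\<lambda>j. (norm (if j = k then x else 0))\<^sup>2) summable_on UNIV \<longleftrightarrow>
      (\<lambda>j. (norm (if j = k then x else 0))\<^sup>2) summable_on {k}"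
    by (rule summable_on_cong_neutral) auto
  then have "coord (delta k x) = (\<lambda>j. if j = k then x else 0)"
    unfolding delta_def by (intro coord_Abs) simp
  then show ?thesis by simp
qed

lemma cinner_delta_left: "cinner (delta k x) \<xi> = cinner x (coord \<xi> k)"
proof -
  have "cinner (delta k x) \<xi> = (\<Sum>\<^sub>\<infinity>j\<in>{k}. cinner (coord (delta k x) j) (coord \<xi> j))"
    unfolding cinner_l2Z_def by (rule infsum_cong_neutral) (auto simp: cinner.zero_left)
  then show ?thesis by simp
qed

lemma cinner_delta_right: "cinner \<xi> (delta k x) = cinner (coord \<xi> k) x"
  by (metis cinner_commute cinner_delta_left)

lemma norm_delta [simp]: "norm (delta k x) = norm x"
  by (simp add: norm_eq_sqrt_Re_cinner cinner_delta_left)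

lemma delta_simps:
  "delta k (x + y) = delta k x + delta k y" "delta k (x - y) = delta k x - delta k y"
  "delta k (c *\<^sub>C x) = c *\<^sub>C delta k x" "delta k 0 = 0"
  by (rule l2Z_eqI; simp add: scaleC.zero_right)+

lemma delta_bounded_clinear: "bounded_clinear (delta k)"
  by (rule bounded_clinearI[of _ 1]) (auto simp: delta_simps)

lemma coord_sum: "coord (sum f F) j = (\<Sum>i\<in>F. coord (f i) j)"
  by (induction F rule: infinite_finite_induct) auto

text \<open>Finite truncations of a sequence come arbitrarily close to it and are sums of vectors
  \<open>delta k x\<close>. Stated for additive sets rather than subspaces, so that it also applies
  to the closure of a countable set in \<open>l2Z_separable\<close>.\<close>

lemma l2Z_additive_UNIV:
  fixes C :: "'h::chilbert_space l2Z set"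
  assumes C: "closed C" "0 \<in> C" "\<And>x y. x \<in> C \<Longrightarrow> y \<in> C \<Longrightarrow> x + y \<in> C" "\<And>k x. delta k x \<in> C"
  shows "C = UNIV"
proof -
  have "\<xi> \<in> C" for \<xi>
  proof -
    have "\<xi> \<in> closure C"
      unfolding closure_approachable
    proof (intro allI impI)
      fix e :: real assume e: "e > 0"
      have "\<exists>F. finite F \<and> (norm \<xi>)\<^sup>2 - e\<^sup>2 < (\<Sum>k\<in>F. (norm (coord \<xi> k))\<^sup>2)"
      proof (rule ccontr)
        assume "\<not> ?thesis"
        then have "(\<Sum>\<^sub>\<infinity>k. (norm (coord \<xi> k))\<^sup>2) \<le> (norm \<xi>)\<^sup>2 - e\<^sup>2"
          by (intro infsum_le_finite_sums coord_summable) (auto simp: not_less)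
        then show False using e by (simp flip: norm_l2Z_sq)
      qed
      then obtain F where F: "finite F" "(norm \<xi>)\<^sup>2 - e\<^sup>2 < (\<Sum>k\<in>F. (norm (coord \<xi> k))\<^sup>2)" by blast
      define P where "P = (\<Sum>k\<in>F. delta k (coord \<xi> k))"
      have cP: "coord P j = (if j \<in> F then coord \<xi> j else 0)" for j
        using F(1) by (simp add: P_def coord_sum)
      have "cinner \<xi> P = (\<Sum>k\<in>F. complex_of_real ((norm (coord \<xi> k))\<^sup>2))"
        unfolding P_def cinner.sum_right cinner_delta_right by (simp add: cinner_self)
      then have 1: "Re (cinner \<xi> P) = (\<Sum>k\<in>F. (norm (coord \<xi> k))\<^sup>2)" by (simp del: of_real_power)
      have "cinner P P = (\<Sum>k\<in>F. cinner (coord P k) (coord \<xi> k))"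
        by (subst (2) P_def) (simp add: cinner.sum_right cinner_delta_right)
      also have "\<dots> = (\<Sum>k\<in>F. complex_of_real ((norm (coord \<xi> k))\<^sup>2))"
        by (intro sum.cong refl) (simp add: cP cinner_self)
      finally have 2: "(norm P)\<^sup>2 = (\<Sum>k\<in>F. (norm (coord \<xi> k))\<^sup>2)"
        by (simp add: norm_sq_cinner del: of_real_power)
      have "(norm (\<xi> - P))\<^sup>2 < e\<^sup>2" unfolding norm_sq_diff 1 2 using F(2) by simp
      then have "norm (\<xi> - P) < e" by (rule power2_less_imp_less) (use e in simp)
      moreover have "P \<in> C" unfolding P_def
        using F(1) by (induction F rule: finite_induct) (auto simp: C)
      ultimately show "\<exists>y\<in>C. dist y \<xi> < e" by (auto simp: dist_norm norm_minus_commute)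
    qed
    with C(1) show ?thesis by simp
  qed
  then show ?thesis by blast
qed

lemma closure_add_closed:
  fixes S :: "'a::real_normed_vector set"
  assumes "\<And>x y. x \<in> S \<Longrightarrow> y \<in> S \<Longrightarrow> x + y \<in> S" and xy: "x \<in> closure S" "y \<in> closure S"
  shows "x + y \<in> closure S"
proof -
  from xy obtain f g where "\<And>n. f n \<in> S" "f \<longlonglongrightarrow> x" "\<And>n. g n \<in> S" "g \<longlonglongrightarrow> y"
    unfolding closure_sequential by metis
  then show ?thesis unfolding closure_sequential
    using assms(1) by (intro exI[of _ "\<lambda>n. f n + g n"]) (auto intro: tendsto_add)
qed

lemma closure_image_mem:
  assumes "continuous_on UNIV f" "x \<in> closure S" "f ` S \<subseteq> T"
  shows "f x \<in> closure T"
proof -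
  have "f ` closure S \<subseteq> closure T"
    using assms closure_subset[of T]
    by (intro image_closure_subset) (auto intro: continuous_on_subset)
  with assms(2) show ?thesis by blast
qed

text \<open>The graph of \<open>(\<xi>\<^sub>k) \<mapsto> (D \<xi>\<^sub>k + s i k \<xi>\<^sub>k)\<close>: that of \<open>D\<^sub>0\<close> for \<open>s = -1\<close>, that of its adjoint
  for \<open>s = 1\<close>.\<close>

definition shifted_graph ::
    "('h::chilbert_space \<rightharpoonup> 'h) \<Rightarrow> real \<Rightarrow> 'h l2Z \<Rightarrow> 'h l2Z \<Rightarrow> bool" where
  "shifted_graph D s \<xi> \<eta> \<longleftrightarrow> (\<forall>k. \<exists>u. D (coord \<xi> k) = Some u \<and>
     coord \<eta> k = u + (\<i> * complex_of_real (s * of_int k)) *\<^sub>C coord \<xi> k)"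

section \<open>Domains, adjoint and self-adjointness of the off-diagonal operator\<close>

text \<open>The summability clause of the domain is absorbed, because \<eta> is already an element
  of the sequence space.\<close>

lemma tensor_diag_eq:
  "tensor_diag S l \<xi> = Some \<eta> \<longleftrightarrow> (\<forall>k. \<exists>u. S (coord \<xi> k) = Some u \<and> coord \<eta> k = l k *\<^sub>C u)"
proof
  assume h: "tensor_diag S l \<xi> = Some \<eta>"
  then have d: "\<And>k. coord \<xi> k \<in> dom S"
      "(\<lambda>k. (norm (l k *\<^sub>C the (S (coord \<xi> k))))\<^sup>2) summable_on UNIV"
      "\<eta> = Abs_l2Z (\<lambda>k. l k *\<^sub>C the (S (coord \<xi> k)))"
    by (auto simp: tensor_diag_def split: if_splits)
  have "coord \<eta> k = l k *\<^sub>C the (S (coord \<xi> k))" for k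
    unfolding d(3) coord_Abs[OF d(2)] ..
  then show "\<forall>k. \<exists>u. S (coord \<xi> k) = Some u \<and> coord \<eta> k = l k *\<^sub>C u"
    using d(1) by force
next
  assume "\<forall>k. \<exists>u. S (coord \<xi> k) = Some u \<and> coord \<eta> k = l k *\<^sub>C u"
  then obtain u where u: "\<And>k. S (coord \<xi> k) = Some (u k)" "\<And>k. l k *\<^sub>C u k = coord \<eta> k"
    by metis
  have "(\<lambda>k. l k *\<^sub>C u k) = coord \<eta>" using u(2) by blast
  then show "tensor_diag S l \<xi> = Some \<eta>"
    using coord_summable[of \<eta>] by (simp add: tensor_diag_def u coord_inverse dom_def)
qed

lemma op_add_eq:
  "op_add S T x = Some y \<longleftrightarrow> (\<exists>u v. S x = Some u \<and> T x = Some v \<and> y = u + v)"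
  by (auto simp: op_add_def)

text \<open>A priori the domain of the sum is the intersection of two domains. By
  \<open>self_adjoint_norm_shift\<close> the squared norms of D \<xi>_k and k \<xi>_k add up to that
  of \<eta>_k, so both sequences are square-summable as soon as \<eta> is.\<close>

lemma D0_iff:
  assumes D: "self_adjoint D"
  shows "D0 D \<xi> = Some \<eta> \<longleftrightarrow> shifted_graph D (-1) \<xi> \<eta>"
proof
  assume "D0 D \<xi> = Some \<eta>"
  then obtain a b where "\<forall>k. \<exists>u. D (coord \<xi> k) = Some u \<and> coord a k = 1 *\<^sub>C u"
      "\<forall>k. coord b k = circle_dirac k *\<^sub>C \<i> *\<^sub>C coord \<xi> k" "\<eta> = a + b"
    unfolding D0_def op_add_eq tensor_diag_eq by auto
  then show "shifted_graph D (-1) \<xi> \<eta>"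
    unfolding shifted_graph_def
    by (auto simp: scaleC_scaleC circle_dirac_def mult.commute)
next
  assume "shifted_graph D (-1) \<xi> \<eta>"
  then obtain u where u: "\<And>k. D (coord \<xi> k) = Some (u k)"
      "\<And>k. coord \<eta> k = u k + (\<i> * complex_of_real (- real_of_int k)) *\<^sub>C coord \<xi> k"
    unfolding shifted_graph_def by (simp only: mult_minus1) metis
  have sq: "(norm (coord \<eta> k))\<^sup>2 = (norm (u k))\<^sup>2 + (- real_of_int k)\<^sup>2 * (norm (coord \<xi> k))\<^sup>2" for k
    unfolding u(2) by (rule self_adjoint_norm_shift[OF D u(1)])
  have s1: "(\<lambda>k. (norm (u k))\<^sup>2) summable_on UNIV"
    by (rule summable_on_comparison_test[OF coord_summable[of \<eta>]]) (simp_all add: sq)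
  have s2: "(\<lambda>k. (norm (circle_dirac k *\<^sub>C \<i> *\<^sub>C coord \<xi> k))\<^sup>2) summable_on UNIV"
    by (rule summable_on_comparison_test[OF coord_summable[of \<eta>]])
      (simp_all add: sq norm_scaleC circle_dirac_def power_mult_distrib)
  have "\<eta> = Abs_l2Z u + Abs_l2Z (\<lambda>k. circle_dirac k *\<^sub>C \<i> *\<^sub>C coord \<xi> k)"
    by (rule l2Z_eqI, simp only: coord_plus coord_Abs[OF s1] coord_Abs[OF s2] u(2))
      (simp add: scaleC_scaleC circle_dirac_def mult.commute)
  then show "D0 D \<xi> = Some \<eta>"
    unfolding D0_def op_add_eq tensor_diag_eq using u(1)
    by (intro exI[of _ "Abs_l2Z u"] exI[of _ "Abs_l2Z (\<lambda>k. circle_dirac k *\<^sub>C \<i> *\<^sub>C coord \<xi> k)"])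
      (simp add: coord_Abs s1 s2)
qed

lemma shifted_graph_linear:
  assumes D: "self_adjoint D"
  shows "shifted_graph D s 0 0"
    "shifted_graph D s \<xi> \<eta> \<Longrightarrow> shifted_graph D s \<xi>' \<eta>' \<Longrightarrow> shifted_graph D s (\<xi> + \<xi>') (\<eta> + \<eta>')"
    "shifted_graph D s \<xi> \<eta> \<Longrightarrow> shifted_graph D s (c *\<^sub>C \<xi>) (c *\<^sub>C \<eta>)"
proof -
  note lin = self_adjoint_linear[OF D]
  show "shifted_graph D s 0 0" using lin(1) by (simp add: shifted_graph_def scaleC.zero_right)
  show "shifted_graph D s (\<xi> + \<xi>') (\<eta> + \<eta>')" if h: "shifted_graph D s \<xi> \<eta>" "shifted_graph D s \<xi>' \<eta>'"
    unfolding shifted_graph_def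
  proof
    fix k
    obtain u u' where "D (coord \<xi> k) = Some u" "D (coord \<xi>' k) = Some u'"
        "coord \<eta> k = u + (\<i> * complex_of_real (s * of_int k)) *\<^sub>C coord \<xi> k"
        "coord \<eta>' k = u' + (\<i> * complex_of_real (s * of_int k)) *\<^sub>C coord \<xi>' k"
      using h unfolding shifted_graph_def by blast
    then show "\<exists>u. D (coord (\<xi> + \<xi>') k) = Some u \<and>
        coord (\<eta> + \<eta>') k = u + (\<i> * complex_of_real (s * of_int k)) *\<^sub>C coord (\<xi> + \<xi>') k"
      using lin(2)[of "coord \<xi> k" u "coord \<xi>' k" u'] by (simp add: scaleC_add_right)
  qed
  show "shifted_graph D s (c *\<^sub>C \<xi>) (c *\<^sub>C \<eta>)" if h: "shifted_graph D s \<xi> \<eta>"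
    unfolding shifted_graph_def
  proof
    fix k
    obtain u where "D (coord \<xi> k) = Some u"
        "coord \<eta> k = u + (\<i> * complex_of_real (s * of_int k)) *\<^sub>C coord \<xi> k"
      using h unfolding shifted_graph_def by blast
    then show "\<exists>u. D (coord (c *\<^sub>C \<xi>) k) = Some u \<and>
        coord (c *\<^sub>C \<eta>) k = u + (\<i> * complex_of_real (s * of_int k)) *\<^sub>C coord (c *\<^sub>C \<xi>) k"
      using lin(3)[of "coord \<xi> k" u c] by (simp add: scaleC_add_right scaleC_scaleC mult_ac)
  qed
qed

lemma shifted_graph_delta:
  assumes D: "self_adjoint D" and u: "D x = Some u"
  shows "shifted_graph D s (delta k x) (delta k (u + (\<i> * complex_of_real (s * of_int k)) *\<^sub>C x))"
  unfolding shifted_graph_def using u self_adjoint_linear(1)[OF D] by (auto simp: scaleC.zero_right)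

lemma shifted_graph_dense:
  fixes D :: "'h::chilbert_space \<rightharpoonup> 'h"
  assumes D: "self_adjoint D"
  shows "closure {\<xi>. \<exists>\<eta>. shifted_graph D s \<xi> \<eta>} = UNIV"
proof (rule l2Z_additive_UNIV)
  let ?S = "{\<xi>. \<exists>\<eta>. shifted_graph D s \<xi> \<eta>}"
  note lin = shifted_graph_linear[OF D, of s]
  show "closed (closure ?S)" by simp
  show "0 \<in> closure ?S" using lin(1) closure_subset[of ?S] by blast
  show "x + y \<in> closure ?S" if "x \<in> closure ?S" "y \<in> closure ?S" for x y
  proof (rule closure_add_closed[OF _ that])
    show "x + y \<in> ?S" if "x \<in> ?S" "y \<in> ?S" for x y
      using lin(2) that by blast
  qed
  show "delta k x \<in> closure ?S" for k x
  proof (rule closure_image_mem[of "delta k" x "dom D"])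
    show "continuous_on UNIV (delta k :: 'h \<Rightarrow> 'h l2Z)"
      by (intro linear_continuous_on bounded_clinear_linear delta_bounded_clinear)
    show "x \<in> closure (dom D)" using D by (simp add: self_adjoint_def densely_defined_def)
    show "delta k ` dom D \<subseteq> ?S" using shifted_graph_delta[OF D] by blast
  qed
qed

text \<open>Testing against \<open>delta k x\<close> isolates the k-th coordinate, where
  self-adjointness of \<open>D\<close> yields both the domain condition and the value. Conjugating
  \<i> reverses the sign of \<open>s\<close>.\<close>

lemma shifted_graph_adjoint:
  assumes D: "self_adjoint D"
  shows "(\<forall>\<xi> \<eta>. shifted_graph D s \<xi> \<eta> \<longrightarrow> cinner \<eta> y = cinner \<xi> z) \<longleftrightarrow> shifted_graph D (- s) y z"
proof
  assume h: "\<forall>\<xi> \<eta>. shifted_graph D s \<xi> \<eta> \<longrightarrow> cinner \<eta> y = cinner \<xi> z"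
  show "shifted_graph D (- s) y z"
    unfolding shifted_graph_def
  proof
    fix k
    let ?c = "\<i> * complex_of_real (s * of_int k)"
    have "D (coord y k) = Some (coord z k + ?c *\<^sub>C coord y k)"
      unfolding self_adjoint_iff[OF D]
    proof
      fix x assume "x \<in> dom D"
      then obtain u where u: "D x = Some u" by blast
      from h shifted_graph_delta[OF D u, of s k]
      have "cinner (u + ?c *\<^sub>C x) (coord y k) = cinner x (coord z k)"
        by (metis cinner_delta_left)
      then have "cinner u (coord y k) = cinner x (coord z k) + ?c * cinner x (coord y k)"
        by (simp add: cinner_simps algebra_simps)
      then show "cinner (the (D x)) (coord y k) = cinner x (coord z k + ?c *\<^sub>C coord y k)"
        using u by (simp add: cinner_simps)
    qed
    moreover have "\<i> * complex_of_real (- s * of_int k) = - ?c" by simp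
    ultimately show "\<exists>u. D (coord y k) = Some u \<and>
        coord z k = u + (\<i> * complex_of_real (- s * of_int k)) *\<^sub>C coord y k"
      by (auto simp: scaleC.minus_left)
  qed
next
  assume yz: "shifted_graph D (- s) y z"
  show "\<forall>\<xi> \<eta>. shifted_graph D s \<xi> \<eta> \<longrightarrow> cinner \<eta> y = cinner \<xi> z"
  proof (intro allI impI)
    fix \<xi> \<eta> assume x: "shifted_graph D s \<xi> \<eta>"
    have "cinner (coord \<eta> k) (coord y k) = cinner (coord \<xi> k) (coord z k)" for k
    proof -
      let ?c = "\<i> * complex_of_real (s * of_int k)"
      have "\<i> * complex_of_real (- s * of_int k) = - ?c" by simp
      with x yz obtain u v where uv: "D (coord \<xi> k) = Some u" "coord \<eta> k = u + ?c *\<^sub>C coord \<xi> k"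
          "D (coord y k) = Some v" "coord z k = v + (- ?c) *\<^sub>C coord y k"
        unfolding shifted_graph_def by metis
      show ?thesis unfolding uv(2,4)
        using self_adjoint_symmetric[OF D uv(1,3)] by (simp add: cinner_simps)
    qed
    then show "cinner \<eta> y = cinner \<xi> z" by (simp add: cinner_l2Z_def)
  qed
qed

lemma D0_adjoint_iff:
  assumes D: "self_adjoint D"
  shows "op_adjoint (D0 D) y = Some z \<longleftrightarrow> shifted_graph D 1 y z"
proof -
  have dom: "dom (D0 D) = {\<xi>. \<exists>\<eta>. shifted_graph D (-1) \<xi> \<eta>}"
    by (auto simp: dom_def D0_iff[OF D])
  have "op_adjoint (D0 D) y = Some z \<longleftrightarrow> (\<forall>x\<in>dom (D0 D). cinner (the (D0 D x)) y = cinner x z)"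
    by (rule op_adjoint_eq_Some) (simp only: dom shifted_graph_dense[OF D])
  also have "\<dots> \<longleftrightarrow> (\<forall>\<xi> \<eta>. D0 D \<xi> = Some \<eta> \<longrightarrow> cinner \<eta> y = cinner \<xi> z)"
    by (metis domD domI option.sel)
  also have "\<dots> \<longleftrightarrow> shifted_graph D (- (- 1)) y z"
    unfolding D0_iff[OF D] by (rule shifted_graph_adjoint[OF D])
  finally show ?thesis by simp
qed

lemma crossed_dirac_iff:
  assumes D: "self_adjoint D"
  shows "crossed_dirac D p = Some q \<longleftrightarrow>
    shifted_graph D 1 (snd p) (fst q) \<and> shifted_graph D (-1) (fst p) (snd q)"
proof -
  have "crossed_dirac D p = Some q \<longleftrightarrow>
      op_adjoint (D0 D) (snd p) = Some (fst q) \<and> D0 D (fst p) = Some (snd q)"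
    by (cases q) (auto simp: crossed_dirac_def off_diagonal_def)
  then show ?thesis by (simp only: D0_adjoint_iff[OF D] D0_iff[OF D])
qed

text \<open>The adjoint of the off-diagonal matrix involves the adjoint of
  \<open>op_adjoint (D0 D)\<close>; reversing the sign of \<open>s\<close> twice shows that it is
  \<open>D0 D\<close> again.\<close>

theorem crossed_dirac_self_adjoint:
  assumes D: "self_adjoint D"
  shows "self_adjoint (crossed_dirac D)"
proof -
  note iff = crossed_dirac_iff[OF D] and lin = shifted_graph_linear[OF D]
  let ?T = "crossed_dirac D"
  have lin': "op_linear ?T"
    unfolding op_linear_def
  proof (intro conjI ballI allI)
    show "?T 0 = Some 0" unfolding iff by (simp add: lin)
    fix x assume "x \<in> dom ?T"
    then obtain u where u: "?T x = Some u" by blast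
    show "?T (c *\<^sub>C x) = Some (c *\<^sub>C the (?T x))" for c
      using u lin(3) by (simp only: iff option.sel) (simp add: scaleC_prod_def u)
    fix y assume "y \<in> dom ?T"
    then obtain v where v: "?T y = Some v" by blast
    show "?T (x + y) = Some (the (?T x) + the (?T y))"
      using u[unfolded iff] v[unfolded iff] unfolding u v iff option.sel by (simp add: lin(2))
  qed
  have "dom ?T = {\<xi>. \<exists>\<eta>. shifted_graph D (-1) \<xi> \<eta>} \<times> {\<xi>. \<exists>\<eta>. shifted_graph D 1 \<xi> \<eta>}"
    by (auto simp: dom_def iff)
  then have dense: "closure (dom ?T) = UNIV"
    by (simp only: closure_Times shifted_graph_dense[OF D] UNIV_Times_UNIV)
  have "op_adjoint ?T y = Some z \<longleftrightarrow> ?T y = Some z" for y z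
  proof -
    have "op_adjoint ?T y = Some z \<longleftrightarrow> (\<forall>p q. ?T p = Some q \<longrightarrow> cinner q y = cinner p z)"
      unfolding op_adjoint_eq_Some[OF dense] by (metis domD domI option.sel)
    also have "\<dots> \<longleftrightarrow> (\<forall>\<xi> \<eta>. shifted_graph D 1 \<xi> \<eta> \<longrightarrow> cinner \<eta> (fst y) = cinner \<xi> (snd z)) \<and>
        (\<forall>\<xi> \<eta>. shifted_graph D (-1) \<xi> \<eta> \<longrightarrow> cinner \<eta> (snd y) = cinner \<xi> (fst z))" (is "?L \<longleftrightarrow> ?R")
    proof
      assume L: ?L
      have h: "cinner b (fst y) + cinner d (snd y) = cinner c (fst z) + cinner a (snd z)"
        if "shifted_graph D 1 a b" "shifted_graph D (-1) c d" for a b c d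
        using L[rule_format, of "(c, a)" "(b, d)"] that by (simp add: iff cinner_prod_def)
      \<comment> \<open>Pairs with one zero entry separate the two conditions.\<close>
      show ?R
        using h[OF _ lin(1)] h[OF lin(1)] by (simp add: cinner.zero_left)
    next
      assume R: ?R
      then show ?L by (auto simp: iff cinner_prod_def)
    qed
    also have "\<dots> \<longleftrightarrow> shifted_graph D (- 1) (fst y) (snd z) \<and> shifted_graph D (- (- 1)) (snd y) (fst z)"
      by (simp only: shifted_graph_adjoint[OF D])
    also have "\<dots> \<longleftrightarrow> ?T y = Some z" by (auto simp: iff)
    finally show ?thesis .
  qed
  then have "op_adjoint ?T = ?T" by (intro ext) (metis not_None_eq)
  with lin' dense show ?thesis by (simp add: self_adjoint_def densely_defined_def)
qed

section \<open>Eigenvalues and summability of the crossed product operator\<close>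

lemma crossed_dirac_eigenvector:
  fixes k :: int
  assumes D: "self_adjoint D" and r: "r > 0"
    and e: "inv_one_plus_sq D e = complex_of_real r *\<^sub>C e"
  defines "R \<equiv> inv_one_plus_sq (crossed_dirac D)" and "t \<equiv> complex_of_real (1 / (1 / r + (of_int k)\<^sup>2))"
  shows "R (delta k e, 0) = t *\<^sub>C (delta k e, 0)" "R (0, delta k e) = t *\<^sub>C (0, delta k e)"
proof -
  define b where "b = 1 / r + (real_of_int k)\<^sup>2"
  have b: "b > 0" using r by (simp add: b_def add_pos_nonneg)
  note lin = self_adjoint_linear[OF D] and T = crossed_dirac_iff[OF D]
    and inv = self_adjoint_inv_one_plus_sq[OF crossed_dirac_self_adjoint[OF D]]
  have "bounded_clinear (inv_one_plus_sq D)"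
    using inv_one_plus_sq_positive(1)[OF D] by (simp add: positive_op_def)
  then have "inv_one_plus_sq D (complex_of_real (1 / r) *\<^sub>C e) = e"
    using r by (simp add: bounded_clinear_scaleC e scaleC_scaleC flip: of_real_mult)
  then obtain u w where uw: "D e = Some u" "D u = Some w" "complex_of_real (1 / r) *\<^sub>C e = e + w"
    unfolding self_adjoint_inv_one_plus_sq[OF D] by blast
  \<comment> \<open>Here w = D^2 e. Applying D + \<i>sk and then D - \<i>sk to e gives D^2 e + k^2
    e, as the mixed terms cancel; s = 1 and s = -1 are the two orders in which \<open>D0 D\<close>
    and its adjoint are composed.\<close>
  have "\<exists>v. shifted_graph D s (delta k e) (delta k v) \<and>
      shifted_graph D (- s) (delta k v) (delta k (w + complex_of_real ((of_int k)\<^sup>2) *\<^sub>C e))"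
    if s: "s\<^sup>2 = 1" for s :: real
  proof (intro exI conjI)
    let ?c = "\<i> * complex_of_real (s * of_int k)"
    let ?v = "u + ?c *\<^sub>C e"
    show "shifted_graph D s (delta k e) (delta k ?v)" by (rule shifted_graph_delta[OF D uw(1)])
    have Dv: "D ?v = Some (w + ?c *\<^sub>C u)" by (intro lin uw)
    have m: "\<i> * complex_of_real (- s * of_int k) = - ?c" by simp
    have "?c * ?c = - complex_of_real (s\<^sup>2 * (of_int k)\<^sup>2)"
      by (simp add: power2_eq_square mult_ac)
    then have eq: "(w + ?c *\<^sub>C u) + (- ?c) *\<^sub>C ?v = w + complex_of_real ((of_int k)\<^sup>2) *\<^sub>C e"
      using s by (simp add: scaleC_add_right scaleC_scaleC scaleC.minus_left del: of_real_mult)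
    show "shifted_graph D (- s) (delta k ?v) (delta k (w + complex_of_real ((of_int k)\<^sup>2) *\<^sub>C e))"
      using shifted_graph_delta[OF D Dv, of "- s" k] unfolding m eq .
  qed
  from this[of 1] this[of "-1"] obtain v v' where v:
      "shifted_graph D 1 (delta k e) (delta k v)"
      "shifted_graph D (-1) (delta k v) (delta k (w + complex_of_real ((of_int k)\<^sup>2) *\<^sub>C e))"
      "shifted_graph D (-1) (delta k e) (delta k v')"
      "shifted_graph D 1 (delta k v') (delta k (w + complex_of_real ((of_int k)\<^sup>2) *\<^sub>C e))"
    by auto
  have "complex_of_real b *\<^sub>C e = e + (w + complex_of_real ((of_int k)\<^sup>2) *\<^sub>C e)"
    using uw(3) by (simp add: b_def scaleC_add_left add.assoc[symmetric])
  from arg_cong[OF this, of "delta k"]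
  have sum: "complex_of_real b *\<^sub>C delta k e = delta k e + delta k (w + complex_of_real ((of_int k)\<^sup>2) *\<^sub>C e)"
    by (simp only: delta_simps)
  note z = shifted_graph_linear(1)[OF D]
  have "R (complex_of_real b *\<^sub>C (delta k e, 0)) = (delta k e, 0)"
    unfolding R_def inv T
    by (rule exI[of _ "(0, delta k v')"], rule exI[of _ "(delta k (w + complex_of_real ((of_int k)\<^sup>2) *\<^sub>C e), 0)"])
      (simp only: fst_conv snd_conv v z sum scaleC_prod_def scaleC.zero_right add_Pair add_0 simp_thms)
  moreover have "R (complex_of_real b *\<^sub>C (0, delta k e)) = (0, delta k e)"
    unfolding R_def inv T
    by (rule exI[of _ "(delta k v, 0)"], rule exI[of _ "(0, delta k (w + complex_of_real ((of_int k)\<^sup>2) *\<^sub>C e))"])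
      (simp only: fst_conv snd_conv v z sum scaleC_prod_def scaleC.zero_right add_Pair add_0 simp_thms)
  moreover have "R x = complex_of_real (1 / b) *\<^sub>C R (complex_of_real b *\<^sub>C x)" for x
  proof -
    have "bounded_clinear R" unfolding R_def
      using inv_one_plus_sq_positive(1)[OF crossed_dirac_self_adjoint[OF D]] by (simp add: positive_op_def)
    then show ?thesis using b by (simp add: bounded_clinear_scaleC scaleC_scaleC flip: of_real_mult)
  qed
  ultimately show "R (delta k e, 0) = t *\<^sub>C (delta k e, 0)" "R (0, delta k e) = t *\<^sub>C (0, delta k e)"
    unfolding t_def b_def[symmetric] by metis+
qed

lemma card_int_abs_le:
  assumes "x \<ge> 0"
  shows "finite {k::int. \<bar>real_of_int k\<bar> \<le> x}" "real (card {k::int. \<bar>real_of_int k\<bar> \<le> x}) \<le> 2 * x + 1"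
proof -
  have eq: "{k::int. \<bar>real_of_int k\<bar> \<le> x} = {- \<lfloor>x\<rfloor>..\<lfloor>x\<rfloor>}"
    by (auto simp: abs_le_iff le_floor_iff minus_le_iff) 
  show "finite {k::int. \<bar>real_of_int k\<bar> \<le> x}" unfolding eq by simp
  have "real (card {- \<lfloor>x\<rfloor>..\<lfloor>x\<rfloor>}) = 2 * real_of_int \<lfloor>x\<rfloor> + 1"
    using assms by (simp add: of_nat_nat)
  then show "real (card {k::int. \<bar>real_of_int k\<bar> \<le> x}) \<le> 2 * x + 1"
    unfolding eq using of_int_floor_le[of x] by linarith
qed

text \<open>The condition s^2 \<le> 1 / (1/r + k^2) forces both s^2 \<le> r and |k| \<le> 1/s. The
  factor 2 counts the two summands, and 2/s + 1 bounds the number of admissible integers.\<close>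

lemma crossed_dirac_eigenbasis:
  fixes D :: "'h::chilbert_space \<rightharpoonup> 'h"
  assumes D: "self_adjoint D" and E: "eigenbasis (inv_one_plus_sq D) E r"
  obtains E' r' where "eigenbasis (inv_one_plus_sq (crossed_dirac D)) E' r'"
    "\<And>s. s > 0 \<Longrightarrow> real (card {v \<in> E'. s\<^sup>2 \<le> r' v}) \<le>
       2 * real (card {e \<in> E. s\<^sup>2 \<le> r e}) * (2 / s + 1)"
proof -
  let ?R = "inv_one_plus_sq (crossed_dirac D)"
  define f where "f = (\<lambda>(e, k, b). if b then (delta k e, 0) else (0, delta k (e :: 'h)))"
  define E' where "E' = f ` (E \<times> UNIV \<times> UNIV)"
  define r' where "r' v = Re (cinner v (?R v))" for v
  note Ed = eigenbasisD[OF E]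
  have on: "cinner (f (e, k, b)) (f (e', k', b')) = (if e = e' \<and> k = k' \<and> b = b' then 1 else 0)"
    if "e \<in> E" "e' \<in> E" for e k b e' k' b'
    using orthonormalD[OF Ed(2) that]
    by (auto simp: f_def cinner_prod_def cinner_delta_left cinner.zero_left cinner.zero_right)
  have Rf: "?R (f (e, k, b)) = complex_of_real (1 / (1 / r e + (of_int k)\<^sup>2)) *\<^sub>C f (e, k, b)"
    if "e \<in> E" for e k b
    using crossed_dirac_eigenvector[OF D Ed(4)[OF that] Ed(5)[OF that], of k]
    by (cases b) (simp_all only: f_def prod.case if_True if_False)
  have r'f: "r' (f (e, k, b)) = 1 / (1 / r e + (of_int k)\<^sup>2)" if "e \<in> E" for e k b
    unfolding r'_def Rf[OF that] cinner_scaleC_right on[OF that that] by simp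
  have sub: "{v \<in> E'. s\<^sup>2 \<le> r' v} \<subseteq> f ` ({e \<in> E. s\<^sup>2 \<le> r e} \<times> {k. \<bar>real_of_int k\<bar> \<le> 1 / s} \<times> UNIV)"
    if s: "s > 0" for s
  proof safe
    fix v assume "v \<in> E'" and v: "s\<^sup>2 \<le> r' v"
    then obtain e k b where e: "e \<in> E" and vf: "v = f (e, k, b)" by (auto simp: E'_def)
    have re: "r e > 0" by (rule Ed(4)[OF e])
    have pos: "1 / r e + (real_of_int k)\<^sup>2 > 0" using re by (simp add: add_pos_nonneg)
    have "s\<^sup>2 * (1 / r e + (real_of_int k)\<^sup>2) \<le> 1"
      using v pos unfolding vf r'f[OF e] by (simp add: pos_le_divide_eq)
    then have h: "s\<^sup>2 / r e + (s * real_of_int k)\<^sup>2 \<le> 1"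
      by (simp add: algebra_simps power_mult_distrib)
    have "s\<^sup>2 / r e \<ge> 0" using re by simp
    with h have "(s * real_of_int k)\<^sup>2 \<le> 1" by linarith
    then have "\<bar>s * real_of_int k\<bar> \<le> 1" by (simp add: abs_square_le_1)
    then have k: "\<bar>real_of_int k\<bar> \<le> 1 / s" using s by (simp add: abs_mult field_simps)
    have "s\<^sup>2 / r e \<le> 1" using h zero_le_power2[of "s * real_of_int k"] by linarith
    then have "s\<^sup>2 \<le> r e" using re by simp
    with e k show "v \<in> f ` ({e \<in> E. s\<^sup>2 \<le> r e} \<times> {k. \<bar>real_of_int k\<bar> \<le> 1 / s} \<times> UNIV)"
      unfolding vf by blast
  qed
  have finp: "finite ({e \<in> E. s\<^sup>2 \<le> r e} \<times> {k. \<bar>real_of_int k\<bar> \<le> 1 / s} \<times> (UNIV :: bool set))"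
    if "s > 0" for s
    using that by (intro finite_cartesian_product Ed(6) card_int_abs_le) auto
  show thesis
  proof (rule that)
    show "eigenbasis ?R E' r'"
      unfolding eigenbasis_def
    proof (intro conjI allI impI ballI)
      show "positive_op ?R" by (rule inv_one_plus_sq_positive[OF crossed_dirac_self_adjoint[OF D]])
      show "orthonormal E'"
        unfolding orthonormal_def
      proof (intro ballI)
        fix v w assume "v \<in> E'" "w \<in> E'"
        then obtain e k b e' k' b' where vw: "e \<in> E" "e' \<in> E" "v = f (e, k, b)" "w = f (e', k', b')"
          by (auto simp: E'_def)
        show "cinner v w = (if v = w then 1 else 0)"
        proof (cases "e = e' \<and> k = k' \<and> b = b'")
          case True
          then show ?thesis using on[OF vw(1,1), of k b k b] vw by simp
        next
          case False
          then have 0: "cinner v w = 0" using on[OF vw(1,2), of k b k' b'] vw by simp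
          moreover have "cinner v v = 1" using on[OF vw(1,1), of k b k b] vw by simp
          ultimately have "v \<noteq> w" by auto
          with 0 show ?thesis by simp
        qed
      qed
      show "x = 0" if x: "\<forall>v\<in>E'. cinner v x = 0" for x
      proof -
        have "cinner e (coord (fst x) k) = 0" "cinner e (coord (snd x) k) = 0" if "e \<in> E" for e k
        proof -
          have "f (e, k, b) \<in> E'" for b unfolding E'_def using that by (intro imageI) simp
          then have "cinner (f (e, k, b)) x = 0" for b using x by blast
          from this[of True] this[of False]
          show "cinner e (coord (fst x) k) = 0" "cinner e (coord (snd x) k) = 0"
            by (simp_all add: f_def cinner_prod_def cinner_delta_left cinner.zero_left)
        qed
        then have "coord (fst x) k = 0" "coord (snd x) k = 0" for k using Ed(3) by blast+
        then show "x = 0" by (intro prod_eqI l2Z_eqI) auto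
      qed
      fix v assume "v \<in> E'"
      then obtain e k b where e: "e \<in> E" "v = f (e, k, b)" by (auto simp: E'_def)
      show "0 < r' v" unfolding e(2) r'f[OF e(1)] using Ed(4)[OF e(1)] by (simp add: add_pos_nonneg)
      show "?R v = complex_of_real (r' v) *\<^sub>C v" unfolding e(2) r'f[OF e(1)] by (rule Rf[OF e(1)])
    next
      fix t :: real assume t: "t > 0"
      from t sub[of "sqrt t"] finp[of "sqrt t"] show "finite {v \<in> E'. t \<le> r' v}"
        by (auto intro: finite_subset)
    qed
    fix s :: real assume s: "s > 0"
    have "card {v \<in> E'. s\<^sup>2 \<le> r' v} \<le> card (f ` ({e \<in> E. s\<^sup>2 \<le> r e} \<times> {k. \<bar>real_of_int k\<bar> \<le> 1 / s} \<times> UNIV))"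
      by (intro card_mono sub s finite_imageI finp)
    also have "\<dots> \<le> card ({e \<in> E. s\<^sup>2 \<le> r e} \<times> {k. \<bar>real_of_int k\<bar> \<le> 1 / s} \<times> (UNIV :: bool set))"
      by (intro card_image_le finp s)
    also have "\<dots> = 2 * card {e \<in> E. s\<^sup>2 \<le> r e} * card {k. \<bar>real_of_int k\<bar> \<le> 1 / s}"
      by (simp add: card_cartesian_product)
    finally have "real (card {v \<in> E'. s\<^sup>2 \<le> r' v}) \<le>
        real (2 * card {e \<in> E. s\<^sup>2 \<le> r e} * card {k. \<bar>real_of_int k\<bar> \<le> 1 / s})"
      by (rule of_nat_mono)
    also have "\<dots> = 2 * real (card {e \<in> E. s\<^sup>2 \<le> r e}) * real (card {k. \<bar>real_of_int k\<bar> \<le> 1 / s})"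
      by (simp only: of_nat_mult of_nat_numeral)
    also have "\<dots> \<le> 2 * real (card {e \<in> E. s\<^sup>2 \<le> r e}) * (2 / s + 1)"
      using card_int_abs_le(2)[of "1 / s"] s by (intro mult_left_mono) auto
    finally show "real (card {v \<in> E'. s\<^sup>2 \<le> r' v}) \<le> 2 * real (card {e \<in> E. s\<^sup>2 \<le> r e}) * (2 / s + 1)" .
  qed
qed

text \<open>The eigenvalue count N(s), of order s^(-p), is multiplied by a factor of order 1/s, and
  the resulting count is translated back into singular values.\<close>

theorem crossed_dirac_weakly_summable:
  fixes D :: "'h::chilbert_space \<rightharpoonup> 'h"
  assumes D: "self_adjoint D" and E: "eigenbasis (inv_one_plus_sq D) E r"
    and p: "p > 0" and ws: "weakly_summable p D"
  shows "weakly_summable (p + 1) (crossed_dirac D)"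
proof -
  note Ed = eigenbasisD[OF E]
  obtain E' r' where E': "eigenbasis (inv_one_plus_sq (crossed_dirac D)) E' r'"
    and card': "\<And>s. s > 0 \<Longrightarrow> real (card {v \<in> E'. s\<^sup>2 \<le> r' v}) \<le>
       2 * real (card {e \<in> E. s\<^sup>2 \<le> r e}) * (2 / s + 1)"
    using crossed_dirac_eigenbasis[OF D E] by blast
  let ?S = "op_sqrt (inv_one_plus_sq D)" and ?S' = "op_sqrt (inv_one_plus_sq (crossed_dirac D))"
  define N where "N s = card {e \<in> E. s\<^sup>2 \<le> r e}" for s
  from ws obtain c where c: "c > 0" "eventually (\<lambda>n. norm (singular_value ?S n) \<le> c * norm (real n powr (- (1 / p)))) at_top"
    unfolding weakly_summable_def by (auto elim: landau_o.bigE)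
  then obtain n0 where n0: "\<And>n. n \<ge> n0 \<Longrightarrow> singular_value ?S n \<le> c * real n powr (- (1 / p))"
    unfolding eventually_sequentially by (metis abs_le_D1 abs_of_nonneg powr_ge_zero real_norm_def)
  \<comment> \<open>The summand n0 + 1 covers counts N(s) \<le> n0, where the asymptotic bound says
    nothing; it is absorbed because s^(-p) \<ge> 1. The summand \<open>c powr p\<close> comes from
    solving s \<le> c N^(-1/p) for N.\<close>
  define A where "A = real n0 + 1 + c powr p"
  have A: "A > 0" by (simp add: A_def add_pos_nonneg)
  have N_le: "real (N s) \<le> A * s powr (- p)" if s: "0 < s" "s \<le> 1" for s
  proof -
    have sp: "1 \<le> s powr (- p)" using s p powr_mono2'[of "- p" s 1] by simp
    have "real (N s) \<le> real n0 + 1 + c powr p * s powr (- p)"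
    proof (cases "N s < n0 + 1")
      case True
      moreover have "0 \<le> c powr p * s powr (- p)" by simp
      ultimately show ?thesis by linarith
    next
      case False
      then have Np: "real (N s) > 0" by simp
      have "s \<le> singular_value ?S (N s)"
        using False s by (intro singular_value_ge[OF E]) (auto simp: N_def)
      also have "\<dots> \<le> c * real (N s) powr (- (1 / p))" using False by (intro n0) simp
      finally have "s powr p \<le> (c * real (N s) powr (- (1 / p))) powr p"
        using s p by (intro powr_mono2) auto
      also have "\<dots> = c powr p * real (N s) powr (- 1)"
        using c(1) p by (simp add: powr_mult powr_powr)
      also have "\<dots> = c powr p / real (N s)" using Np by (simp add: powr_minus divide_inverse)
      finally have "real (N s) * s powr p \<le> c powr p" using Np by (simp add: field_simps)
      then have "real (N s) \<le> c powr p * s powr (- p)"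
        using s by (simp add: powr_minus field_simps)
      then show ?thesis by simp
    qed
    also have "\<dots> \<le> (real n0 + 1) * s powr (- p) + c powr p * s powr (- p)"
      using mult_left_mono[OF sp, of "real n0 + 1"] by simp
    finally show ?thesis by (simp add: A_def algebra_simps)
  qed
  \<comment> \<open>Levels s > 1 are outside the reach of \<open>N_le\<close>, but the inverse of 1
    + D^2 is a contraction and has no eigenvalue above 1.\<close>
  have N_zero: "N s = 0" if s: "s > 1" for s
  proof -
    have "r e \<le> 1" if "e \<in> E" for e
    proof -
      have "norm e = 1" using orthonormalD[OF Ed(2) that that] by (simp add: norm_eq_sqrt_Re_cinner)
      then show ?thesis
        using inv_one_plus_sq_positive(3)[OF D, of e] Ed(4)[OF that]
        unfolding Ed(5)[OF that] by (simp add: norm_scaleC)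
    qed
    moreover have "1 < s\<^sup>2" using s by (simp add: one_less_power)
    ultimately have "{e \<in> E. s\<^sup>2 \<le> r e} = {}" by force
    then show ?thesis by (simp only: N_def card.empty)
  qed
  \<comment> \<open>For s \<le> 1 one has 2/s + 1 \<le> 3/s, so the new count is at most 2 A s^(-p)
    3/s = 6 A s^(-(p+1)).\<close>
  define B where "B = 6 * A"
  have B: "B > 0" using A by (simp add: B_def)
  have sv: "singular_value ?S' n \<le> B powr (1 / (p + 1)) * real n powr (- (1 / (p + 1)))" if n: "n \<ge> 1" for n
  proof -
    define q where "q = p + 1"
    have q: "q > 0" using p by (simp add: q_def)
    \<comment> \<open>The right-hand side is the level s at which B s^(-q) equals n.\<close>
    have "singular_value ?S' n \<le> (B / real n) powr (1 / q)"
    proof (rule singular_value_le[OF E'])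
      fix s assume s: "s > (B / real n) powr (1 / q)"
      have "(B / real n) powr (1 / q) > 0" using B n by simp
      with s have s0: "s > 0" by linarith
      show "card {v \<in> E'. s\<^sup>2 \<le> r' v} < n"
      proof (cases "s \<le> 1")
        case False
        with card'[OF s0] N_zero[of s] have "card {v \<in> E'. s\<^sup>2 \<le> r' v} = 0" by (simp add: N_def)
        with n show ?thesis by linarith
      next
        case True
        have "real (card {v \<in> E'. s\<^sup>2 \<le> r' v}) \<le> 2 * real (N s) * (2 / s + 1)"
          using card'[OF s0] by (simp add: N_def)
        also have "\<dots> \<le> 2 * (A * s powr (- p)) * (3 / s)"
        proof (intro mult_mono mult_left_mono N_le s0 True)
          show "2 / s + 1 \<le> 3 / s" using s0 True by (simp add: field_simps)
        qed (use A s0 in auto)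
        also have "\<dots> = B * s powr (- q)"
          using s0 by (simp add: B_def q_def powr_diff minus_add_distrib powr_minus field_simps powr_add)
        also have "\<dots> < real n"
        proof -
          have "((B / real n) powr (1 / q)) powr q < s powr q"
            using s q by (intro powr_less_mono2) auto
          then have "B / real n < s powr q" using q B n by (simp add: powr_powr)
          then have "B < real n * s powr q" using n by (simp add: field_simps)
          then show ?thesis using s0 by (simp add: powr_minus field_simps)
        qed
        finally show ?thesis by simp
      qed
    qed simp
    also have "\<dots> = B powr (1 / q) * real n powr (- (1 / q))"
    proof -
      have "(B / real n) powr (1 / q) = B powr (1 / q) / real n powr (1 / q)"
        by (rule powr_divide)
      then show ?thesis by (simp add: powr_minus_divide)
    qed
    finally show ?thesis by (simp only: q_def)
  qed
  have "(\<lambda>n. singular_value ?S' n) \<in> O(\<lambda>n. real n powr (- (1 / (p + 1))))"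
  proof (rule bigoI)
    show "eventually (\<lambda>n. norm (singular_value ?S' n) \<le>
        B powr (1 / (p + 1)) * norm (real n powr (- (1 / (p + 1))))) sequentially"
      using eventually_ge_at_top[of 1]
    proof eventually_elim
      case (elim n)
      then show ?case using sv[of n] singular_value_nonneg[OF E', of n] by simp
    qed
  qed
  then show ?thesis
    unfolding weakly_summable_def using op_sqrt_eigenbasis(1)[OF E'] by blast
qed

section \<open>The regular representation\<close>

text \<open>Weighted shift with operator weights, the common form of a \<otimes> V^n in the regular
  representation and of its commutators. For uniformly bounded weights the sequence is
  square-summable, so that \<open>Abs_l2Z\<close> has the intended value.\<close>

definition shift_op ::
    "int \<Rightarrow> (int \<Rightarrow> 'h::chilbert_space \<Rightarrow> 'h) \<Rightarrow> 'h l2Z \<Rightarrow> 'h l2Z" where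
  "shift_op n S \<xi> = Abs_l2Z (\<lambda>k. S k (coord \<xi> (n + k)))"

lemma bij_int_shift: "bij_betw (\<lambda>k. n + k) (UNIV :: int set) UNIV"
  by (rule bij_betwI[of _ _ _ "\<lambda>k. k - n"]) auto

lemma shift_op:
  assumes S: "\<And>k x. norm (S k x) \<le> C * norm x" and C: "C \<ge> 0"
  shows "coord (shift_op n S \<xi>) k = S k (coord \<xi> (n + k))" "norm (shift_op n S \<xi>) \<le> C * norm \<xi>"
proof -
  have sq: "(norm (S k x))\<^sup>2 \<le> C\<^sup>2 * (norm x)\<^sup>2" for k x
    using power_mono[OF S norm_ge_zero, of k x 2] by (simp add: power_mult_distrib)
  have s0: "(\<lambda>k. (norm (coord \<xi> (n + k)))\<^sup>2) summable_on UNIV"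
    using coord_summable[of \<xi>] summable_on_reindex_bij_betw[OF bij_int_shift, of "\<lambda>k. (norm (coord \<xi> k))\<^sup>2" n]
    by simp
  then have s1: "(\<lambda>k. C\<^sup>2 * (norm (coord \<xi> (n + k)))\<^sup>2) summable_on UNIV"
    by (rule summable_on_cmult_right)
  have s2: "(\<lambda>k. (norm (S k (coord \<xi> (n + k))))\<^sup>2) summable_on UNIV"
    by (rule summable_on_comparison_test[OF s1]) (simp_all add: sq)
  have co: "coord (shift_op n S \<xi>) = (\<lambda>k. S k (coord \<xi> (n + k)))"
    unfolding shift_op_def by (rule coord_Abs[OF s2])
  then show "coord (shift_op n S \<xi>) k = S k (coord \<xi> (n + k))" by simp
  have "(norm (shift_op n S \<xi>))\<^sup>2 = (\<Sum>\<^sub>\<infinity>k. (norm (S k (coord \<xi> (n + k))))\<^sup>2)"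
    unfolding norm_l2Z_sq co ..
  also have "\<dots> \<le> (\<Sum>\<^sub>\<infinity>k. C\<^sup>2 * (norm (coord \<xi> (n + k)))\<^sup>2)"
    by (rule infsum_mono[OF s2 s1]) (rule sq)
  also have "\<dots> = C\<^sup>2 * (\<Sum>\<^sub>\<infinity>k. (norm (coord \<xi> (n + k)))\<^sup>2)"
    by (rule infsum_cmult_right[OF s0])
  also have "\<dots> = (C * norm \<xi>)\<^sup>2"
    unfolding power_mult_distrib norm_l2Z_sq
    using infsum_reindex_bij_betw[OF bij_int_shift, of "\<lambda>k. (norm (coord \<xi> k))\<^sup>2" n] by simp
  finally show "norm (shift_op n S \<xi>) \<le> C * norm \<xi>"
    by (rule power2_le_imp_le) (simp add: C)
qed

lemma shift_op_bounded_clinear: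
  assumes S: "\<And>k. bounded_clinear (S k)" "\<And>k x. norm (S k x) \<le> C * norm x" and C: "C \<ge> 0"
  shows "bounded_clinear (shift_op n S)"
proof (rule bounded_clinearI)
  note co = shift_op(1)[OF S(2) C, of n] and l = bounded_clinear_simps[OF S(1)]
  show "shift_op n S (x + y) = shift_op n S x + shift_op n S y" for x y
    by (rule l2Z_eqI) (simp add: co l)
  show "shift_op n S (c *\<^sub>C x) = c *\<^sub>C shift_op n S x" for c x
    by (rule l2Z_eqI) (simp add: co l)
  show "norm (shift_op n S x) \<le> C * norm x" for x by (rule shift_op(2)[OF S(2) C])
qed

subsection \<open>Powers of an automorphism\<close>

lemma cstar_automorphismD:
  assumes "cstar_automorphism \<alpha>"
  shows "bij \<alpha>" "\<alpha> (a + b) = \<alpha> a + \<alpha> b" "\<alpha> (c *\<^sub>C a) = c *\<^sub>C \<alpha> a" "\<alpha> (a * b) = \<alpha> a * \<alpha> b"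
    "\<alpha> (star a) = star (\<alpha> a)"
  using assms unfolding cstar_automorphism_def by simp_all

lemma zpow_0 [simp]: "zpow \<alpha> 0 a = a"
  by (simp add: zpow_def)

lemma zpow_succ:
  assumes "bij \<alpha>"
  shows "zpow \<alpha> (n + 1) a = \<alpha> (zpow \<alpha> n a)"
proof (cases "n \<ge> 0")
  case True
  then have "nat (n + 1) = Suc (nat n)" by simp
  with True show ?thesis by (simp add: zpow_def)
next
  case False
  then have n: "nat (- n) = Suc (nat (- (n + 1)))" by simp
  have "zpow \<alpha> n a = inv \<alpha> ((inv \<alpha> ^^ nat (- (n + 1))) a)"
    using False by (simp add: zpow_def n)
  then have "\<alpha> (zpow \<alpha> n a) = (inv \<alpha> ^^ nat (- (n + 1))) a"
    using assms by (simp add: bij_is_surj surj_f_inv_f)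
  with False show ?thesis by (cases "n = - 1") (simp_all add: zpow_def)
qed

text \<open>With \<alpha> on the left, a downward induction step is proved by applying \<alpha> and
  cancelling it by injectivity, without handling \<open>inv \<alpha>\<close>.\<close>

lemma zpow_pred:
  assumes "bij \<alpha>"
  shows "\<alpha> (zpow \<alpha> (n - 1) a) = zpow \<alpha> n a"
  using zpow_succ[OF assms, of "n - 1" a] by simp

lemma zpow_add:
  assumes b: "bij \<alpha>"
  shows "zpow \<alpha> (m + n) a = zpow \<alpha> m (zpow \<alpha> n a)"
proof (induction m rule: int_induct[where k = 0])
  case (step1 i)
  have "zpow \<alpha> (i + 1 + n) a = \<alpha> (zpow \<alpha> (i + n) a)"
    using zpow_succ[OF b, of "i + n" a] by (simp add: ac_simps)
  then show ?case using step1 by (simp add: zpow_succ[OF b])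
next
  case (step2 i)
  have "\<alpha> (zpow \<alpha> (i - 1 + n) a) = zpow \<alpha> (i + n) a"
    using zpow_pred[OF b, of "i + n" a] by (simp add: algebra_simps)
  also have "\<dots> = \<alpha> (zpow \<alpha> (i - 1) (zpow \<alpha> n a))" using step2 by (simp add: zpow_pred[OF b])
  finally show ?case using b by (simp add: bij_is_inj inj_eq)
qed simp

lemma zpow_hom:
  assumes \<alpha>: "cstar_automorphism \<alpha>"
  shows "zpow \<alpha> n (a + b) = zpow \<alpha> n a + zpow \<alpha> n b" "zpow \<alpha> n (c *\<^sub>C a) = c *\<^sub>C zpow \<alpha> n a"
    "zpow \<alpha> n (a * b) = zpow \<alpha> n a * zpow \<alpha> n b" "zpow \<alpha> n (star a) = star (zpow \<alpha> n a)"
proof -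
  note h = cstar_automorphismD[OF \<alpha>]
  have "(\<forall>a b. zpow \<alpha> n (a + b) = zpow \<alpha> n a + zpow \<alpha> n b) \<and>
      (\<forall>c a. zpow \<alpha> n (c *\<^sub>C a) = c *\<^sub>C zpow \<alpha> n a) \<and>
      (\<forall>a b. zpow \<alpha> n (a * b) = zpow \<alpha> n a * zpow \<alpha> n b) \<and>
      (\<forall>a. zpow \<alpha> n (star a) = star (zpow \<alpha> n a))"
  proof (induction n rule: int_induct[where k = 0])
    case (step1 i)
    then show ?case by (simp add: zpow_succ[OF h(1)] h)
  next
    case (step2 i)
    have inj: "x = y" if "\<alpha> x = \<alpha> y" for x y using that h(1) by (simp add: bij_is_inj inj_eq)
    show ?case
      by (intro conjI allI; rule inj) (simp_all add: h zpow_pred[OF h(1)] step2)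
  qed simp
  then show "zpow \<alpha> n (a + b) = zpow \<alpha> n a + zpow \<alpha> n b" "zpow \<alpha> n (c *\<^sub>C a) = c *\<^sub>C zpow \<alpha> n a"
    "zpow \<alpha> n (a * b) = zpow \<alpha> n a * zpow \<alpha> n b" "zpow \<alpha> n (star a) = star (zpow \<alpha> n a)"
    by blast+
qed

lemma op_adjoint_totalI:
  assumes "\<And>x y. cinner (T x) y = cinner x (S y)"
  shows "op_adjoint (Some \<circ> T) = Some \<circ> S"
proof
  fix y
  have "op_adjoint (Some \<circ> T) y = Some (S y)" unfolding op_adjoint_total using assms by blast
  then show "op_adjoint (Some \<circ> T) y = (Some \<circ> S) y" by simp
qed

lemma representation_zpow:
  assumes \<pi>: "representation \<pi>" and \<alpha>: "cstar_automorphism \<alpha>"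
  shows "representation (\<lambda>a. \<pi> (zpow \<alpha> k a))"
  unfolding representation_def
  by (intro conjI allI op_adjoint_totalI)
    (simp_all add: representation_simps[OF \<pi>] zpow_hom[OF \<alpha>])

text \<open>Contractivity is applied to the representation
  \<open>\<lambda>a. \<pi> (zpow \<alpha> k a)\<close> itself, so the bound is uniform in
  \<open>k\<close> without a separate proof that \<alpha> is isometric.\<close>

lemma norm_rep_zpow_le:
  "representation \<pi> \<Longrightarrow> cstar_automorphism \<alpha> \<Longrightarrow> norm (\<pi> (zpow \<alpha> k a) x) \<le> norm a * norm x"
  using representation_contractive[OF representation_zpow] by blast

subsection \<open>Covariant representation of the crossed product\<close>

lemma poly_mapping_sum_single:
  "f = (\<Sum>n\<in>Poly_Mapping.keys f. Poly_Mapping.single n (Poly_Mapping.lookup f n))"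
  by (rule poly_mapping_eqI)
    (auto simp: lookup_sum lookup_single when_def in_keys_iff)

lemma onorm_scaleC:
  assumes T: "bounded_clinear T"
  shows "onorm (\<lambda>x. c *\<^sub>C T x) = cmod c * onorm T"
proof -
  have le: "onorm (\<lambda>x. c *\<^sub>C T x) \<le> cmod c * onorm T" if T: "bounded_clinear T" for c T
  proof (rule onorm_bound)
    show "0 \<le> cmod c * onorm T" by (simp add: bounded_clinear_linear onorm_pos_le T)
    show "norm (c *\<^sub>C T x) \<le> cmod c * onorm T * norm x" for x
      using bounded_clinear_onorm[OF T, of x] by (simp add: norm_scaleC mult_left_mono mult.assoc)
  qed
  show ?thesis
  proof (cases "c = 0")
    case False
    have "onorm (\<lambda>x. (1 / c) *\<^sub>C (c *\<^sub>C T x)) \<le> cmod (1 / c) * onorm (\<lambda>x. c *\<^sub>C T x)"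
      by (rule le[OF bounded_clinear_mult[OF T]])
    then have "onorm T \<le> onorm (\<lambda>x. c *\<^sub>C T x) / cmod c"
      using False by (simp add: scaleC_scaleC norm_divide)
    then have "cmod c * onorm T \<le> onorm (\<lambda>x. c *\<^sub>C T x)"
      using False by (simp add: pos_le_divide_eq mult.commute)
    with le[OF T, of c] show ?thesis by linarith
  next
    case True
    then show ?thesis by (simp add: onorm_zero)
  qed
qed

lemma onorm_cstar_identity:
  assumes T: "bounded_clinear T" and S: "bounded_clinear S"
    and adj: "\<And>x y. cinner (T x) y = cinner x (S y)"
  shows "onorm (S \<circ> T) = (onorm T)\<^sup>2"
proof (rule antisym)
  have n0: "onorm T \<ge> 0" "onorm S \<ge> 0" "onorm (S \<circ> T) \<ge> 0"
    using T S bounded_clinear_comp[OF S T] by (simp_all add: onorm_pos_le bounded_clinear_linear)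
  have "onorm S \<le> onorm T"
  proof (rule onorm_bound[OF n0(1)])
    fix y
    have "(norm (S y))\<^sup>2 = Re (cinner (T (S y)) y)" by (simp add: adj cinner_self)
    also have "\<dots> \<le> norm (T (S y)) * norm y" using complex_Re_le_cmod cmod_cinner_le order_trans by blast
    also have "\<dots> \<le> (onorm T * norm (S y)) * norm y"
      by (intro mult_right_mono bounded_clinear_onorm T) simp
    finally have "norm (S y) * norm (S y) \<le> norm (S y) * (onorm T * norm y)"
      by (simp add: power2_eq_square mult_ac)
    then show "norm (S y) \<le> onorm T * norm y"
      by (cases "norm (S y) = 0") (use n0 in \<open>auto simp: mult_le_cancel_left\<close>)
  qed
  then have "onorm S * onorm T \<le> onorm T * onorm T" using n0 by (intro mult_right_mono)
  with onorm_compose[OF bounded_clinear_linear[OF S] bounded_clinear_linear[OF T]]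
  show "onorm (S \<circ> T) \<le> (onorm T)\<^sup>2" by (simp add: power2_eq_square)
  have "onorm T \<le> sqrt (onorm (S \<circ> T))"
  proof (rule onorm_bound)
    fix x
    have "(norm (T x))\<^sup>2 = Re (cinner x ((S \<circ> T) x))" by (simp add: adj[symmetric] cinner_self)
    also have "\<dots> \<le> norm x * norm ((S \<circ> T) x)" using complex_Re_le_cmod cmod_cinner_le order_trans by blast
    also have "\<dots> \<le> norm x * (onorm (S \<circ> T) * norm x)"
      by (intro mult_left_mono bounded_clinear_onorm bounded_clinear_comp S T) simp
    also have "\<dots> = (sqrt (onorm (S \<circ> T)) * norm x)\<^sup>2"
      using n0(3) by (simp add: power_mult_distrib power2_eq_square mult_ac)
    finally show "norm (T x) \<le> sqrt (onorm (S \<circ> T)) * norm x"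
      by (rule power2_le_imp_le) (simp add: n0)
  qed (simp add: n0)
  then have "(onorm T)\<^sup>2 \<le> (sqrt (onorm (S \<circ> T)))\<^sup>2" by (rule power_mono) (rule n0)
  then show "(onorm T)\<^sup>2 \<le> onorm (S \<circ> T)" using n0 by simp
qed

lemma norm_star [simp]: "norm (star a) = norm (a :: 'a::cstar_algebra)"
proof -
  have le: "norm a \<le> norm (star a)" for a :: 'a
  proof -
    have "norm a * norm a \<le> norm (star a) * norm a"
      using norm_mult_ineq[of "star a" a] by (simp add: cstar_identity power2_eq_square)
    then show ?thesis by (cases "norm a = 0") (auto simp: mult_le_cancel_right)
  qed
  show ?thesis using le[of a] le[of "star a"] by (simp add: star_star)
qed

lemma star_diff: "star (a - b) = star a - star (b :: 'a::cstar_algebra)"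
proof -
  have "star (a - b) + star b = star a" by (simp flip: star_add)
  then show ?thesis by (simp add: eq_diff_eq)
qed

lemma tendsto_star:
  fixes f :: "nat \<Rightarrow> 'a::cstar_algebra"
  assumes "f \<longlonglongrightarrow> a"
  shows "(\<lambda>n. star (f n)) \<longlonglongrightarrow> star a"
proof -
  have "(\<lambda>n. norm (f n - a)) \<longlonglongrightarrow> 0" using assms by (simp add: LIM_zero_iff tendsto_norm_zero)
  then have "(\<lambda>n. norm (star (f n) - star a)) \<longlonglongrightarrow> 0" by (simp flip: star_diff)
  then show ?thesis by (simp add: LIM_zero_iff tendsto_norm_zero_iff)
qed

lemma tendsto_scaleC_cstar:
  fixes f :: "nat \<Rightarrow> 'a::cstar_algebra"
  assumes "f \<longlonglongrightarrow> a"
  shows "(\<lambda>n. c *\<^sub>C f n) \<longlonglongrightarrow> c *\<^sub>C a"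
proof -
  have "bounded_linear (\<lambda>x :: 'a. c *\<^sub>C x)"
    by (rule bounded_linear_intro[of _ "cmod c"])
      (simp_all add: scaleC_add_right norm_scaleC_cstar scaleC_scaleC mult.commute flip: scaleC_of_real)
  then show ?thesis using assms by (rule bounded_linear.tendsto)
qed

section \<open>The regular representation on finitely supported functions\<close>

context
  fixes \<pi> :: "'a::cstar_algebra \<Rightarrow> 'h::chilbert_space \<Rightarrow> 'h" and \<alpha> :: "'a \<Rightarrow> 'a"
  assumes \<pi>: "representation \<pi>" and \<alpha>: "cstar_automorphism \<alpha>"
begin

definition rep_single :: "int \<Rightarrow> 'a \<Rightarrow> 'h l2Z \<Rightarrow> 'h l2Z" where
  "rep_single n a = shift_op n (\<lambda>k. \<pi> (zpow \<alpha> k a))"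

lemma coord_rep_single [simp]:
  "coord (rep_single n a \<xi>) k = \<pi> (zpow \<alpha> k a) (coord \<xi> (n + k))"
  unfolding rep_single_def by (rule shift_op(1)[OF norm_rep_zpow_le[OF \<pi> \<alpha>] norm_ge_zero])

lemma norm_rep_single: "norm (rep_single n a \<xi>) \<le> norm a * norm \<xi>"
  unfolding rep_single_def by (rule shift_op(2)[OF norm_rep_zpow_le[OF \<pi> \<alpha>] norm_ge_zero])

lemma rep_single_bounded_clinear: "bounded_clinear (rep_single n a)"
  unfolding rep_single_def
  by (rule shift_op_bounded_clinear[OF _ norm_rep_zpow_le[OF \<pi> \<alpha>] norm_ge_zero])
    (rule representation_simps[OF \<pi>])

lemma rep_single_hom:
  "rep_single n (a + b) \<xi> = rep_single n a \<xi> + rep_single n b \<xi>"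
  "rep_single n (c *\<^sub>C a) \<xi> = c *\<^sub>C rep_single n a \<xi>"
  "rep_single n 0 \<xi> = 0"
proof -
  note s = representation_simps[OF representation_zpow[OF \<pi> \<alpha>]]
  show "rep_single n (a + b) \<xi> = rep_single n a \<xi> + rep_single n b \<xi>"
    "rep_single n (c *\<^sub>C a) \<xi> = c *\<^sub>C rep_single n a \<xi>" "rep_single n 0 \<xi> = 0"
    by (rule l2Z_eqI; simp add: s)+
qed

text \<open>The inner operator is evaluated at position n + k and so carries \<alpha>^(n+k)(b) =
  \<alpha>^k(\<alpha>^n(b)), the twist in \<open>cc_mult\<close>.\<close>

lemma rep_single_mult:
  "rep_single n a (rep_single m b \<xi>) = rep_single (n + m) (a * zpow \<alpha> n b) \<xi>"
proof (rule l2Z_eqI)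
  fix k
  have "zpow \<alpha> (n + k) b = zpow \<alpha> k (zpow \<alpha> n b)"
    using zpow_add[OF cstar_automorphismD(1)[OF \<alpha>], of k n b] by (simp add: add.commute)
  moreover have "m + (n + k) = n + m + k" by simp
  ultimately show "coord (rep_single n a (rep_single m b \<xi>)) k = coord (rep_single (n + m) (a * zpow \<alpha> n b) \<xi>) k"
    by (simp only: coord_rep_single zpow_hom(3)[OF \<alpha>] representation_simps(4)[OF \<pi>])
qed

lemma rep_single_star:
  "cinner (rep_single n a \<xi>) \<eta> = cinner \<xi> (rep_single (- n) (zpow \<alpha> (- n) (star a)) \<eta>)"
proof -
  have z: "zpow \<alpha> (n + k) (zpow \<alpha> (- n) b) = zpow \<alpha> k b" for k b
    using zpow_add[OF cstar_automorphismD(1)[OF \<alpha>], of "n + k" "- n" b] by simp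
  \<comment> \<open>Translating the summation index by n moves the shift to the other
    argument.\<close>
  have "cinner \<xi> (rep_single (- n) (zpow \<alpha> (- n) (star a)) \<eta>) =
      (\<Sum>\<^sub>\<infinity>k. cinner (coord \<xi> (n + k)) (coord (rep_single (- n) (zpow \<alpha> (- n) (star a)) \<eta>) (n + k)))"
    unfolding cinner_l2Z_def
    using infsum_reindex_bij_betw[OF bij_int_shift,
        of "\<lambda>k. cinner (coord \<xi> k) (coord (rep_single (- n) (zpow \<alpha> (- n) (star a)) \<eta>) k)" n] by simp
  also have "\<dots> = cinner (rep_single n a \<xi>) \<eta>"
    unfolding cinner_l2Z_def
    by (simp add: z representation_simps(5)[OF \<pi>] zpow_hom(4)[OF \<alpha>])
  finally show ?thesis by simp
qed

definition rep_cc :: "(int \<Rightarrow>\<^sub>0 'a) \<Rightarrow> 'h l2Z \<Rightarrow> 'h l2Z" where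
  "rep_cc f \<xi> = (\<Sum>n\<in>Poly_Mapping.keys f. rep_single n (Poly_Mapping.lookup f n) \<xi>)"

lemma rep_cc_superset:
  assumes "finite F" "Poly_Mapping.keys f \<subseteq> F"
  shows "rep_cc f \<xi> = (\<Sum>n\<in>F. rep_single n (Poly_Mapping.lookup f n) \<xi>)"
  unfolding rep_cc_def
  by (rule sum.mono_neutral_left) (use assms in \<open>auto simp: in_keys_iff rep_single_hom\<close>)

lemma rep_cc_single: "rep_cc (Poly_Mapping.single n a) \<xi> = rep_single n a \<xi>"
  using rep_cc_superset[of "{n}" "Poly_Mapping.single n a"] by (simp split: if_splits)

lemma rep_cc_add: "rep_cc (f + g) \<xi> = rep_cc f \<xi> + rep_cc g \<xi>"
proof -
  let ?F = "Poly_Mapping.keys f \<union> Poly_Mapping.keys g"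
  have "rep_cc h \<xi> = (\<Sum>n\<in>?F. rep_single n (Poly_Mapping.lookup h n) \<xi>)" if "h \<in> {f, g, f + g}" for h
    by (rule rep_cc_superset) (use that Poly_Mapping.keys_add[of f g] in auto)
  then show ?thesis by (simp add: lookup_add rep_single_hom sum.distrib)
qed

lemma rep_cc_zero: "rep_cc 0 \<xi> = 0"
  by (simp add: rep_cc_def)

lemma rep_cc_sum: "rep_cc (sum g F) \<xi> = (\<Sum>i\<in>F. rep_cc (g i) \<xi>)"
  by (induction F rule: infinite_finite_induct) (auto simp: rep_cc_zero rep_cc_add)

lemma rep_cc_diff: "rep_cc (f - g) \<xi> = rep_cc f \<xi> - rep_cc g \<xi>"
  using rep_cc_add[of "f - g" g \<xi>] by simp

lemma rep_cc_bounded_clinear: "bounded_clinear (rep_cc f)"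
  unfolding rep_cc_def by (intro bounded_clinear_sum rep_single_bounded_clinear)

lemma rep_cc_scaleC: "rep_cc (cc_scaleC c f) \<xi> = c *\<^sub>C rep_cc f \<xi>"
  unfolding cc_scaleC_def rep_cc_sum rep_cc_single
  by (simp add: rep_cc_def rep_single_hom scaleC.sum_right)

lemma rep_cc_mult: "rep_cc (cc_mult \<alpha> f g) \<xi> = rep_cc f (rep_cc g \<xi>)"
  unfolding cc_mult_def rep_cc_sum rep_cc_single
  by (simp add: rep_cc_def rep_single_mult bounded_clinear_simps(5)[OF rep_single_bounded_clinear])

lemma rep_cc_star: "cinner (rep_cc f \<xi>) \<eta> = cinner \<xi> (rep_cc (cc_star \<alpha> f) \<eta>)"
  unfolding cc_star_def rep_cc_sum rep_cc_single
  by (simp add: rep_cc_def cinner.sum_left cinner.sum_right rep_single_star)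

lemma norm_rep_cc: "norm (rep_cc f \<xi>) \<le> l1_norm f * norm \<xi>"
  unfolding rep_cc_def l1_norm_def sum_distrib_right
  by (intro sum_norm_le norm_rep_single)

text \<open>Places this operator norm among the seminorms in the supremum
  \<open>crossed_product_norm\<close>. Hence \<open>rep_cc\<close> is bounded by the crossed product
  norm, and the supremum is taken over a nonempty set.\<close>

lemma rep_cc_seminorm: "cc_seminorm \<alpha> (\<lambda>f. onorm (rep_cc f))"
  unfolding cc_seminorm_def
proof (intro conjI allI)
  fix f g :: "int \<Rightarrow>\<^sub>0 'a" and c
  note b = rep_cc_bounded_clinear and bl = bounded_clinear_linear[OF rep_cc_bounded_clinear]
  show "0 \<le> onorm (rep_cc f)" by (rule onorm_pos_le[OF bl])
  show "onorm (rep_cc f) \<le> l1_norm f"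
    by (rule onorm_bound[OF _ norm_rep_cc]) (simp add: l1_norm_def sum_nonneg)
  have "rep_cc (f + g) = (\<lambda>x. rep_cc f x + rep_cc g x)" by (simp add: fun_eq_iff rep_cc_add)
  then show "onorm (rep_cc (f + g)) \<le> onorm (rep_cc f) + onorm (rep_cc g)"
    using onorm_triangle[OF bl bl] by simp
  have "rep_cc (cc_scaleC c f) = (\<lambda>x. c *\<^sub>C rep_cc f x)" by (simp add: fun_eq_iff rep_cc_scaleC)
  then show "onorm (rep_cc (cc_scaleC c f)) = cmod c * onorm (rep_cc f)" by (simp add: onorm_scaleC[OF b])
  have "rep_cc (cc_mult \<alpha> f g) = rep_cc f \<circ> rep_cc g" for f g by (simp add: fun_eq_iff rep_cc_mult)
  then show "onorm (rep_cc (cc_mult \<alpha> f g)) \<le> onorm (rep_cc f) * onorm (rep_cc g)"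
    "onorm (rep_cc (cc_mult \<alpha> (cc_star \<alpha> f) f)) = (onorm (rep_cc f))\<^sup>2"
    using onorm_compose[OF bl bl] onorm_cstar_identity[OF b b rep_cc_star] by simp_all
qed

section \<open>Extension to the crossed product\<close>

context
  fixes \<iota> :: "(int \<Rightarrow>\<^sub>0 'a) \<Rightarrow> 'b::cstar_algebra"
  assumes \<iota>: "crossed_product \<alpha> \<iota>"
begin

lemma \<iota>_simps:
  "\<iota> (f + g) = \<iota> f + \<iota> g" "\<iota> (cc_scaleC c f) = c *\<^sub>C \<iota> f" "\<iota> (cc_mult \<alpha> f g) = \<iota> f * \<iota> g"
  "\<iota> (cc_star \<alpha> f) = star (\<iota> f)" "norm (\<iota> f) = crossed_product_norm \<alpha> f" "closure (range \<iota>) = UNIV"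
  using \<iota> unfolding crossed_product_def by simp_all

lemma \<iota>_zero: "\<iota> 0 = 0"
  using \<iota>_simps(1)[of 0 0] by simp

lemma \<iota>_diff: "\<iota> (f - g) = \<iota> f - \<iota> g"
  using \<iota>_simps(1)[of "f - g" g] by simp

lemma \<iota>_sum: "\<iota> (sum g F) = (\<Sum>i\<in>F. \<iota> (g i))"
  by (induction F rule: infinite_finite_induct) (auto simp: \<iota>_zero \<iota>_simps(1))

lemma norm_\<iota>_le: "norm (\<iota> f) \<le> l1_norm f"
  unfolding \<iota>_simps(5) crossed_product_norm_def
proof (rule cSUP_least)
  show "Collect (cc_seminorm \<alpha>) \<noteq> {}" using rep_cc_seminorm by blast
  show "q f \<le> l1_norm f" if "q \<in> Collect (cc_seminorm \<alpha>)" for q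
    using that by (simp add: cc_seminorm_def)
qed

lemma rep_cc_le: "norm (rep_cc f \<xi>) \<le> norm (\<iota> f) * norm \<xi>"
proof -
  have "onorm (rep_cc f) \<le> norm (\<iota> f)"
    unfolding \<iota>_simps(5) crossed_product_norm_def
  proof (rule cSUP_upper2[where x = "\<lambda>f. onorm (rep_cc f)"])
    show "bdd_above ((\<lambda>q. q f) ` Collect (cc_seminorm \<alpha>))"
      by (rule bdd_aboveI[of _ "l1_norm f"]) (auto simp: cc_seminorm_def)
  qed (use rep_cc_seminorm in auto)
  then have "onorm (rep_cc f) * norm \<xi> \<le> norm (\<iota> f) * norm \<xi>" by (rule mult_right_mono) simp
  with bounded_clinear_onorm[OF rep_cc_bounded_clinear, of f \<xi>] show ?thesis by linarith
qed

lemma \<iota>_dense: "\<exists>X. (\<lambda>n. \<iota> (X n)) \<longlonglongrightarrow> b"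
proof -
  have "b \<in> closure (range \<iota>)" by (simp add: \<iota>_simps(6))
  then obtain f where f: "\<And>n. f n \<in> range \<iota>" "f \<longlonglongrightarrow> b" unfolding closure_sequential by blast
  have "\<forall>n. \<exists>x. f n = \<iota> x" using f(1) by (simp add: image_iff)
  then obtain X where "\<forall>n. f n = \<iota> (X n)" by (rule choice[THEN exE])
  then have "f = (\<lambda>n. \<iota> (X n))" by (intro ext) simp
  with f(2) show ?thesis by (intro exI[of _ X]) simp
qed

text \<open>Extension by continuity from the dense range of \<iota>: by \<open>rep_cc_le\<close>,
  sequences that converge under \<iota> have Cauchy images, and \<open>rep_cc f\<close> depends only
  on \<open>\<iota> f\<close>.\<close>

lemma regular_representation_exists:
  obtains \<rho> where "representation \<rho>" "\<And>f. \<rho> (\<iota> f) = rep_cc f"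
proof -
  obtain X where X: "\<And>b. (\<lambda>n. \<iota> (X b n)) \<longlonglongrightarrow> b" using \<iota>_dense by metis
  have diff: "norm (rep_cc f \<xi> - rep_cc g \<xi>) \<le> norm (\<iota> f - \<iota> g) * norm \<xi>" for f g \<xi>
    using rep_cc_le[of "f - g" \<xi>] by (simp add: rep_cc_diff \<iota>_diff)
  have "\<exists>y. (\<lambda>n. rep_cc (X b n) \<xi>) \<longlonglongrightarrow> y" for b \<xi>
  proof -
    have "Cauchy (\<lambda>n. rep_cc (X b n) \<xi>)"
    proof (rule CauchyI)
      fix e :: real assume e: "e > 0"
      define d where "d = e / (1 + norm \<xi>)"
      have n1: "1 + norm \<xi> > 0" using norm_ge_zero[of \<xi>] by linarith
      have "d > 0" using e n1 by (simp add: d_def)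
      then obtain M where M: "\<And>m n. m \<ge> M \<Longrightarrow> n \<ge> M \<Longrightarrow> norm (\<iota> (X b m) - \<iota> (X b n)) < d"
        using CauchyD[OF LIMSEQ_imp_Cauchy[OF X[of b]]] by meson
      have "norm (rep_cc (X b m) \<xi> - rep_cc (X b n) \<xi>) < e" if "m \<ge> M" "n \<ge> M" for m n
      proof -
        have "norm (rep_cc (X b m) \<xi> - rep_cc (X b n) \<xi>) \<le> norm (\<iota> (X b m) - \<iota> (X b n)) * norm \<xi>"
          by (rule diff)
        also have "\<dots> \<le> d * norm \<xi>" using M[OF that] by (intro mult_right_mono) auto
        also have "\<dots> < d * (1 + norm \<xi>)" using \<open>d > 0\<close> by simp
        also have "\<dots> = e" using n1 by (simp add: d_def)
        finally show ?thesis .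
      qed
      then show "\<exists>M. \<forall>m\<ge>M. \<forall>n\<ge>M. norm (rep_cc (X b m) \<xi> - rep_cc (X b n) \<xi>) < e" by blast
    qed
    then show ?thesis using Cauchy_convergent convergent_def by blast
  qed
  then obtain \<rho> where \<rho>: "\<And>b \<xi>. (\<lambda>n. rep_cc (X b n) \<xi>) \<longlonglongrightarrow> \<rho> b \<xi>" by metis
  \<comment> \<open>Independence of the approximating sequence: algebraic identities can be checked
    along sums, products and adjoints of the chosen sequences \<open>X\<close>, which are in general
    not the sequences chosen for the results.\<close>
  have L: "(\<lambda>n. rep_cc (Y n) \<xi>) \<longlonglongrightarrow> \<rho> b \<xi>" if Y: "(\<lambda>n. \<iota> (Y n)) \<longlonglongrightarrow> b" for Y b \<xi>
  proof -
    have "(\<lambda>n. norm (\<iota> (Y n) - \<iota> (X b n)) * norm \<xi>) \<longlonglongrightarrow> norm (b - b) * norm \<xi>"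
      by (intro tendsto_intros Y X)
    then have 0: "(\<lambda>n. norm (\<iota> (Y n) - \<iota> (X b n)) * norm \<xi>) \<longlonglongrightarrow> 0" by simp
    have "(\<lambda>n. rep_cc (Y n) \<xi> - rep_cc (X b n) \<xi>) \<longlonglongrightarrow> 0"
      by (rule Lim_null_comparison[OF _ 0]) (simp add: diff)
    from tendsto_add[OF this \<rho>[of b \<xi>]] show ?thesis by simp
  qed
  note LU = LIMSEQ_unique[OF L]
  show thesis
  proof (rule that)
    show ri: "\<rho> (\<iota> f) = rep_cc f" for f
      using LU[OF tendsto_const tendsto_const] by (simp add: fun_eq_iff)
    have le: "norm (\<rho> b \<xi>) \<le> norm b * norm \<xi>" for b \<xi>
      by (rule LIMSEQ_le[OF tendsto_norm[OF \<rho>] tendsto_mult[OF tendsto_norm[OF X] tendsto_const]])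
        (simp add: rep_cc_le)
    note l = bounded_clinear_simps[OF rep_cc_bounded_clinear]
    show "representation \<rho>"
      unfolding representation_def
    proof (intro conjI allI op_adjoint_totalI)
      fix a b :: 'b and x y :: "'h l2Z" and c
      show "bounded_clinear (\<rho> a)"
      proof (rule bounded_clinearI[OF _ _ le])
        show "\<rho> a (x + y) = \<rho> a x + \<rho> a y" for x y
          by (rule LIMSEQ_unique[OF \<rho>]) (unfold l, intro tendsto_intros \<rho>)
        show "\<rho> a (c *\<^sub>C x) = c *\<^sub>C \<rho> a x" for c x
          by (rule LIMSEQ_unique[OF \<rho>]) (unfold l, intro scaleC.tendsto tendsto_const \<rho>)
      qed
      note \<rho>b = this
      show "\<rho> (a + b) x = \<rho> a x + \<rho> b x"
      proof (rule LU)
        show "(\<lambda>n. \<iota> (X a n + X b n)) \<longlonglongrightarrow> a + b" unfolding \<iota>_simps by (intro tendsto_intros X)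
        show "(\<lambda>n. rep_cc (X a n + X b n) x) \<longlonglongrightarrow> \<rho> a x + \<rho> b x"
          unfolding rep_cc_add by (intro tendsto_intros \<rho>)
      qed
      show "\<rho> (c *\<^sub>C a) x = c *\<^sub>C \<rho> a x"
      proof (rule LU)
        show "(\<lambda>n. \<iota> (cc_scaleC c (X a n))) \<longlonglongrightarrow> c *\<^sub>C a"
          unfolding \<iota>_simps by (intro tendsto_scaleC_cstar X)
        show "(\<lambda>n. rep_cc (cc_scaleC c (X a n)) x) \<longlonglongrightarrow> c *\<^sub>C \<rho> a x"
          unfolding rep_cc_scaleC by (intro scaleC.tendsto tendsto_const \<rho>)
      qed
      show "\<rho> (a * b) x = \<rho> a (\<rho> b x)"
      proof (rule LU)
        show "(\<lambda>n. \<iota> (cc_mult \<alpha> (X a n) (X b n))) \<longlonglongrightarrow> a * b"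
          unfolding \<iota>_simps by (intro tendsto_intros X)
        have "(\<lambda>n. norm (\<iota> (X a n)) * norm (rep_cc (X b n) x - \<rho> b x)) \<longlonglongrightarrow> norm a * norm (\<rho> b x - \<rho> b x)"
          by (intro tendsto_intros X \<rho>)
        then have 0: "(\<lambda>n. norm (\<iota> (X a n)) * norm (rep_cc (X b n) x - \<rho> b x)) \<longlonglongrightarrow> 0" by simp
        have "(\<lambda>n. rep_cc (X a n) (rep_cc (X b n) x - \<rho> b x)) \<longlonglongrightarrow> 0"
          by (rule Lim_null_comparison[OF _ 0]) (simp add: rep_cc_le)
        from tendsto_add[OF this \<rho>[of a "\<rho> b x"]]
        show "(\<lambda>n. rep_cc (cc_mult \<alpha> (X a n) (X b n)) x) \<longlonglongrightarrow> \<rho> a (\<rho> b x)"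
          by (simp add: l rep_cc_mult)
      qed
      have "(\<lambda>n. \<iota> (cc_star \<alpha> (X a n))) \<longlonglongrightarrow> star a"
        unfolding \<iota>_simps by (intro tendsto_star X)
      from cinner.tendsto[OF tendsto_const L[OF this, of y]]
      have "(\<lambda>n. cinner x (rep_cc (cc_star \<alpha> (X a n)) y)) \<longlonglongrightarrow> cinner x (\<rho> (star a) y)" .
      moreover have "(\<lambda>n. cinner x (rep_cc (cc_star \<alpha> (X a n)) y)) \<longlonglongrightarrow> cinner (\<rho> a x) y"
        unfolding rep_cc_star[symmetric] by (intro cinner.tendsto tendsto_const \<rho>)
      ultimately show "cinner (\<rho> a x) y = cinner x (\<rho> (star a) y)" by (metis LIMSEQ_unique)
    qed
  qed
qed

text \<open>The definite description prescribes values on elementary elements. Additivity extends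
  agreement of two candidates to the range of \<iota>, and automatic continuity
  (\<open>representation_contractive\<close>) to the whole crossed product.\<close>

lemma regular_representation:
  shows "representation (regular_representation \<pi> \<alpha> \<iota>)"
    and "regular_representation \<pi> \<alpha> \<iota> (\<iota> (Poly_Mapping.single n a)) = rep_single n a"
proof -
  obtain \<rho> where \<rho>: "representation \<rho>" "\<And>f. \<rho> (\<iota> f) = rep_cc f"
    by (rule regular_representation_exists, rule that)
  let ?P = "\<lambda>\<rho>. representation \<rho> \<and> (\<forall>a n \<xi> k. coord (\<rho> (\<iota> (Poly_Mapping.single n a)) \<xi>) k
        = \<pi> (zpow \<alpha> k a) (coord \<xi> (n + k)))"
  have P: "?P \<rho>" using \<rho> by (simp add: rep_cc_single)
  have "\<rho>' = \<rho>" if \<rho>': "?P \<rho>'" for \<rho>'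
  proof (intro ext)
    fix b \<xi>
    have r': "representation \<rho>'" using \<rho>' by blast
    have s: "\<rho>' (\<iota> (Poly_Mapping.single n a)) x = rep_single n a x" for n a x
      using \<rho>' by (intro l2Z_eqI) simp
    have z: "\<rho>' (sum g F) x = (\<Sum>i\<in>F. \<rho>' (g i) x)" for g :: "int \<Rightarrow> 'b" and F x
      by (induction F rule: infinite_finite_induct) (auto simp: representation_simps[OF r'])
    have f: "\<rho>' (\<iota> f) x = rep_cc f x" for f x
      by (subst poly_mapping_sum_single[of f]) (simp add: \<iota>_sum z s rep_cc_def)
    obtain X where X: "(\<lambda>n. \<iota> (X n)) \<longlonglongrightarrow> b" using \<iota>_dense by blast
    have lim: "(\<lambda>n. \<sigma> (\<iota> (X n)) \<xi>) \<longlonglongrightarrow> \<sigma> b \<xi>" if \<sigma>: "representation \<sigma>"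
      for \<sigma> :: "'b \<Rightarrow> 'h l2Z \<Rightarrow> 'h l2Z"
    proof -
      have "(\<lambda>n. norm (\<iota> (X n) - b) * norm \<xi>) \<longlonglongrightarrow> norm (b - b) * norm \<xi>"
        by (intro tendsto_intros X)
      then have 0: "(\<lambda>n. norm (\<iota> (X n) - b) * norm \<xi>) \<longlonglongrightarrow> 0" by simp
      have "(\<lambda>n. \<sigma> (\<iota> (X n)) \<xi> - \<sigma> b \<xi>) \<longlonglongrightarrow> 0"
        by (rule Lim_null_comparison[OF _ 0])
          (simp add: representation_contractive[OF \<sigma>] flip: representation_simps(8)[OF \<sigma>])
      then show ?thesis by (simp add: LIM_zero_iff)
    qed
    from lim[OF r'] lim[OF \<rho>(1)] show "\<rho>' b \<xi> = \<rho> b \<xi>"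
      unfolding f \<rho>(2) by (rule LIMSEQ_unique)
  qed
  with P have eq: "regular_representation \<pi> \<alpha> \<iota> = \<rho>"
    unfolding regular_representation_def by (intro the_equality)
  show "representation (regular_representation \<pi> \<alpha> \<iota>)"
    unfolding eq by (rule \<rho>)
  show "regular_representation \<pi> \<alpha> \<iota> (\<iota> (Poly_Mapping.single n a)) = rep_single n a"
    unfolding eq \<rho>(2) by (rule ext) (rule rep_cc_single)
qed

end

end

section \<open>The spectral triple of the crossed product\<close>

lemma l2Z_separable:
  assumes "\<exists>S :: 'h::chilbert_space set. countable S \<and> closure S = UNIV"
  shows "\<exists>M :: 'h l2Z set. countable M \<and> closure M = UNIV"
proof -
  obtain S :: "'h set" where S: "countable S" "closure S = UNIV" using assms by blast
  \<comment> \<open>Lists may repeat a position, so concatenation realizes addition and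
    \<open>M\<close> is additively closed.\<close>
  define g where "g xs = (\<Sum>(k, x)\<leftarrow>xs. delta k (x :: 'h))" for xs
  define M where "M = g ` lists (UNIV \<times> S)"
  have "countable M" unfolding M_def using S(1) by (intro countable_image countable_lists) auto
  moreover have "closure M = UNIV"
  proof (rule l2Z_additive_UNIV)
    show "closed (closure M)" by simp
    have "g [] \<in> M" unfolding M_def by (rule imageI) simp
    then show "0 \<in> closure M" using closure_subset[of M] by (auto simp: g_def)
    show "x + y \<in> closure M" if "x \<in> closure M" "y \<in> closure M" for x y
    proof (rule closure_add_closed[OF _ that])
      fix x y assume "x \<in> M" "y \<in> M"
      then obtain xs ys where xy: "xs \<in> lists (UNIV \<times> S)" "x = g xs" "ys \<in> lists (UNIV \<times> S)" "y = g ys"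
        by (auto simp: M_def)
      have "x + y = g (xs @ ys)" by (simp add: xy g_def)
      moreover have "xs @ ys \<in> lists (UNIV \<times> S)" using xy by simp
      ultimately show "x + y \<in> M" unfolding M_def by (rule image_eqI)
    qed
    show "delta k x \<in> closure M" for k x
    proof (rule closure_image_mem[of "delta k" x S])
      show "continuous_on UNIV (delta k :: 'h \<Rightarrow> 'h l2Z)"
        by (intro linear_continuous_on bounded_clinear_linear delta_bounded_clinear)
      show "x \<in> closure S" by (simp add: S(2))
      show "delta k ` S \<subseteq> M"
      proof (rule image_subsetI)
        fix y assume "y \<in> S"
        then have "[(k, y)] \<in> lists (UNIV \<times> S)" by simp
        moreover have "delta k y = g [(k, y)]" by (simp add: g_def)
        ultimately show "delta k y \<in> M" unfolding M_def by (rule image_eqI[rotated])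
      qed
    qed
  qed
  ultimately show ?thesis by blast
qed

lemma prod_separable:
  assumes "\<exists>S :: 'a::topological_space set. countable S \<and> closure S = UNIV"
  shows "\<exists>M :: ('a \<times> 'a) set. countable M \<and> closure M = UNIV"
proof -
  obtain S :: "'a set" where "countable S" "closure S = UNIV" using assms by blast
  then have "countable (S \<times> S)" "closure (S \<times> S) = UNIV" by (auto simp: closure_Times)
  then show ?thesis by blast
qed

lemma bounded_clinear_Pair:
  assumes S: "bounded_clinear S" and T: "bounded_clinear T"
  shows "bounded_clinear (\<lambda>x. (S x, T x))"
  unfolding bounded_clinear_def
  using bounded_linear_Pair[OF bounded_clinear_linear[OF S] bounded_clinear_linear[OF T]]
  by (simp add: scaleC_prod_def bounded_clinear_scaleC S T)

lemma bounded_clinear_fst: "bounded_clinear (fst :: 'h::chilbert_space \<times> 'k::chilbert_space \<Rightarrow> 'h)"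
  by (simp add: bounded_clinear_def bounded_linear_fst scaleC_prod_def)

lemma bounded_clinear_snd: "bounded_clinear (snd :: 'h::chilbert_space \<times> 'k::chilbert_space \<Rightarrow> 'k)"
  by (simp add: bounded_clinear_def bounded_linear_snd scaleC_prod_def)

lemma doubled_representation:
  assumes \<rho>: "representation \<rho>"
  shows "representation (doubled_representation \<rho>)"
proof -
  note s = representation_simps[OF \<rho>]
  show ?thesis
    unfolding representation_def
  proof (intro conjI allI op_adjoint_totalI)
    fix a
    have "doubled_representation \<rho> a = (\<lambda>x. ((\<rho> a \<circ> fst) x, (\<rho> a \<circ> snd) x))"
      by (auto simp: doubled_representation_def fun_eq_iff)
    moreover have "bounded_clinear (\<lambda>x. ((\<rho> a \<circ> fst) x, (\<rho> a \<circ> snd) x))"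
      by (intro bounded_clinear_Pair bounded_clinear_comp s bounded_clinear_fst bounded_clinear_snd)
    ultimately show "bounded_clinear (doubled_representation \<rho> a)" by simp
  qed (auto simp: doubled_representation_def map_prod_def split_beta s scaleC_prod_def cinner_prod_def)
qed

lemma l1_norm_single [simp]: "l1_norm (Poly_Mapping.single n a) = norm a"
  by (simp add: l1_norm_def)

section \<open>Bounded commutators and density of the smooth algebra\<close>

lemma shifted_graph_commutator:
  assumes \<pi>: "representation \<pi>" and \<alpha>: "cstar_automorphism \<alpha>"
    and T: "\<And>k. bounded_commutator D (\<pi> (zpow \<alpha> k a)) (T k)" "\<And>k. onorm (T k) \<le> C"
  obtains W where "bounded_clinear W"
    "\<And>\<xi> \<eta>. shifted_graph D s \<xi> \<eta> \<Longrightarrow>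
       shifted_graph D s (rep_single \<pi> \<alpha> n a \<xi>) (W \<xi> + rep_single \<pi> \<alpha> n a \<eta>)"
proof -
  \<comment> \<open>The operator reads \<xi> at position n + k and writes at k, so the scalar parts
    contribute \<i>sk - \<i>s(n + k) = -\<i>sn, which no longer grows with k.\<close>
  define w where "w k x = T k x + (- (\<i> * complex_of_real (s * of_int n))) *\<^sub>C \<pi> (zpow \<alpha> k a) x" for k x
  define K where "K = C + \<bar>s * real_of_int n\<bar> * norm a"
  have Tb: "bounded_clinear (T k)" for k using T(1) by (simp add: bounded_commutator_def)
  have "0 \<le> onorm (T 0)" by (intro onorm_pos_le bounded_clinear_linear Tb)
  with T(2)[of 0] have C: "C \<ge> 0" by linarith
  have K0: "K \<ge> 0" using C by (simp add: K_def)
  have wb: "bounded_clinear (w k)" for k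
    unfolding w_def by (intro bounded_clinear_add bounded_clinear_mult Tb representation_simps(1)[OF \<pi>])
  have wK: "norm (w k x) \<le> K * norm x" for k x
  proof -
    have "norm (w k x) \<le> norm (T k x) + norm ((- (\<i> * complex_of_real (s * of_int n))) *\<^sub>C \<pi> (zpow \<alpha> k a) x)"
      unfolding w_def by (rule norm_triangle_ineq)
    also have "\<dots> \<le> C * norm x + \<bar>s * real_of_int n\<bar> * (norm a * norm x)"
    proof (rule add_mono)
      show "norm (T k x) \<le> C * norm x"
        using bounded_clinear_onorm[OF Tb, of k x] mult_right_mono[OF T(2)[of k], of "norm x"] by simp
      have "norm ((- (\<i> * complex_of_real (s * of_int n))) *\<^sub>C \<pi> (zpow \<alpha> k a) x)
          = \<bar>s * real_of_int n\<bar> * norm (\<pi> (zpow \<alpha> k a) x)"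
        unfolding norm_scaleC by (simp add: norm_mult abs_mult)
      also have "\<dots> \<le> \<bar>s * real_of_int n\<bar> * (norm a * norm x)"
        by (intro mult_left_mono norm_rep_zpow_le[OF \<pi> \<alpha>]) simp
      finally show "norm ((- (\<i> * complex_of_real (s * of_int n))) *\<^sub>C \<pi> (zpow \<alpha> k a) x)
          \<le> \<bar>s * real_of_int n\<bar> * (norm a * norm x)" .
    qed
    finally show ?thesis by (simp add: K_def algebra_simps)
  qed
  show thesis
  proof (rule that)
    show "bounded_clinear (shift_op n w)" by (rule shift_op_bounded_clinear[OF wb wK K0])
    fix \<xi> \<eta> assume h: "shifted_graph D s \<xi> \<eta>"
    show "shifted_graph D s (rep_single \<pi> \<alpha> n a \<xi>) (shift_op n w \<xi> + rep_single \<pi> \<alpha> n a \<eta>)"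
      unfolding shifted_graph_def
    proof
      fix k
      let ?p = "\<pi> (zpow \<alpha> k a)" and ?x = "coord \<xi> (n + k)"
      obtain u where u: "D ?x = Some u"
          "coord \<eta> (n + k) = u + (\<i> * complex_of_real (s * of_int (n + k))) *\<^sub>C ?x"
        using h unfolding shifted_graph_def by blast
      have x: "?x \<in> dom D" using u(1) by blast
      have bc: "?p ` dom D \<subseteq> dom D" "\<forall>x\<in>dom D. T k x = the (D (?p x)) - ?p (the (D x))"
        using T(1)[of k] by (simp_all add: bounded_commutator_def)
      have "?p ?x \<in> dom D" using bc(1) x by blast
      moreover have "T k ?x = the (D (?p ?x)) - ?p u" using bc(2) x u(1) by simp
      ultimately have D: "D (?p ?x) = Some (T k ?x + ?p u)" by auto
      note p = bounded_clinear_simps[OF representation_simps(1)[OF \<pi>]]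
      have "\<i> * complex_of_real (s * of_int (n + k)) =
          \<i> * complex_of_real (s * of_int n) + \<i> * complex_of_real (s * of_int k)"
        by (simp add: distrib_left)
      then have "coord (shift_op n w \<xi> + rep_single \<pi> \<alpha> n a \<eta>) k
          = (T k ?x + ?p u) + (\<i> * complex_of_real (s * of_int k)) *\<^sub>C ?p ?x"
        by (simp only: coord_plus shift_op(1)[OF wK K0] coord_rep_single[OF \<pi> \<alpha>] u(2) p w_def)
          (simp add: scaleC_add_left scaleC.minus_left)
      with D show "\<exists>u. D (coord (rep_single \<pi> \<alpha> n a \<xi>) k) = Some u \<and>
          coord (shift_op n w \<xi> + rep_single \<pi> \<alpha> n a \<eta>) k =
            u + (\<i> * complex_of_real (s * of_int k)) *\<^sub>C coord (rep_single \<pi> \<alpha> n a \<xi>) k"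
        by (simp only: coord_rep_single[OF \<pi> \<alpha>]) blast
    qed
  qed
qed

lemma bounded_commutator_add:
  assumes D: "self_adjoint D" and S: "bounded_commutator D S T" "bounded_commutator D S' T'"
  shows "bounded_commutator D (\<lambda>x. S x + S' x) (\<lambda>x. T x + T' x)"
proof -
  have eq: "D (S x + S' x) = Some ((T x + T' x) + (S (the (D x)) + S' (the (D x))))" if x: "x \<in> dom D" for x
  proof -
    have "S x \<in> dom D" "S' x \<in> dom D"
      using S x unfolding bounded_commutator_def by blast+
    moreover have "T x = the (D (S x)) - S (the (D x))" "T' x = the (D (S' x)) - S' (the (D x))"
      using S x unfolding bounded_commutator_def by blast+
    ultimately have "D (S x) = Some (T x + S (the (D x)))" "D (S' x) = Some (T' x + S' (the (D x)))" by auto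
    from self_adjoint_linear(2)[OF D this] show ?thesis by (simp add: ac_simps)
  qed
  show ?thesis
    unfolding bounded_commutator_def
  proof (intro conjI ballI)
    show "bounded_clinear (\<lambda>x. T x + T' x)"
      using S by (intro bounded_clinear_add) (simp_all add: bounded_commutator_def)
  qed (use eq in auto)
qed

context
  fixes \<pi> :: "'a::cstar_algebra \<Rightarrow> 'h::chilbert_space \<Rightarrow> 'h"
    and D :: "'h \<rightharpoonup> 'h" and \<alpha> :: "'a \<Rightarrow> 'a" and \<iota> :: "(int \<Rightarrow>\<^sub>0 'a) \<Rightarrow> 'b::cstar_algebra"
  assumes \<pi>: "representation \<pi>" and D: "self_adjoint D"
    and \<alpha>: "cstar_automorphism \<alpha>" and \<iota>: "crossed_product \<alpha> \<iota>"
begin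

lemma crossed_commutator:
  assumes "\<forall>n. \<exists>T. bounded_commutator D (\<pi> (zpow \<alpha> n a)) T \<and> onorm T \<le> C"
  shows "\<exists>T. bounded_commutator (crossed_dirac D)
    (doubled_representation (regular_representation \<pi> \<alpha> \<iota>) (\<iota> (Poly_Mapping.single n a))) T"
proof -
  obtain T where T: "\<And>k. bounded_commutator D (\<pi> (zpow \<alpha> k a)) (T k)" "\<And>k. onorm (T k) \<le> C"
    using assms by metis
  let ?U = "rep_single \<pi> \<alpha> n a"
  note graph = shifted_graph_commutator[OF \<pi> \<alpha> T]
  obtain V where V: "bounded_clinear V"
      "\<And>\<xi> \<eta>. shifted_graph D 1 \<xi> \<eta> \<Longrightarrow> shifted_graph D 1 (?U \<xi>) (V \<xi> + ?U \<eta>)"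
    by (rule graph[of 1 n], rule that)
  obtain W where W: "bounded_clinear W"
      "\<And>\<xi> \<eta>. shifted_graph D (-1) \<xi> \<eta> \<Longrightarrow> shifted_graph D (-1) (?U \<xi>) (W \<xi> + ?U \<eta>)"
    by (rule graph[of "-1" n], rule that)
  \<comment> \<open>The commutator of an off-diagonal with a diagonal matrix is again
    off-diagonal.\<close>
  define X where "X p = (V (snd p), W (fst p))" for p
  have "bounded_clinear (\<lambda>p. ((V \<circ> snd) p, (W \<circ> fst) p) :: 'h l2Z \<times> 'h l2Z)"
    by (intro bounded_clinear_Pair bounded_clinear_comp V W bounded_clinear_fst bounded_clinear_snd)
  then have X: "bounded_clinear X" by (simp add: X_def[abs_def])
  have rep: "doubled_representation (regular_representation \<pi> \<alpha> \<iota>) (\<iota> (Poly_Mapping.single n a)) = map_prod ?U ?U"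
    unfolding doubled_representation_def regular_representation(2)[OF \<pi> \<alpha> \<iota>] ..
  have eq: "crossed_dirac D (map_prod ?U ?U p) = Some (X p + map_prod ?U ?U q)" if "crossed_dirac D p = Some q" for p q
    using that V(2) W(2) unfolding crossed_dirac_iff[OF D] by (cases p; cases q) (simp add: X_def)
  have "bounded_commutator (crossed_dirac D) (map_prod ?U ?U) X"
    unfolding bounded_commutator_def
  proof (intro conjI ballI X)
    show "map_prod ?U ?U ` dom (crossed_dirac D) \<subseteq> dom (crossed_dirac D)"
      using eq by (auto simp: dom_def)
    fix p assume "p \<in> dom (crossed_dirac D)"
    then obtain q where q: "crossed_dirac D p = Some q" by blast
    show "X p = the (crossed_dirac D (map_prod ?U ?U p)) - map_prod ?U ?U (the (crossed_dirac D p))"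
      unfolding eq[OF q] q option.sel by simp
  qed
  then show ?thesis unfolding rep by blast
qed

text \<open>A bounded operator composed with a compact one is compact, so the smooth algebra is
  described by commutators alone and is closed under addition. Replacing \<open>a\<close> by a
  nearby element of \<open>A'\<close> moves the image of a \<otimes> V^n by at most the same
  distance, by \<open>norm_\<iota>_le\<close>; finite sums of such images are dense.\<close>

lemma crossed_smooth_dense:
  assumes A': "0 \<in> A'" "closure A' = UNIV"
    and comm: "\<forall>a\<in>A'. \<exists>C. \<forall>n. \<exists>T. bounded_commutator D (\<pi> (zpow \<alpha> n a)) T \<and> onorm T \<le> C"
    and cpt: "compact_op (inv_one_plus_sq (crossed_dirac D))"
  shows "closure (smooth_algebra (doubled_representation (regular_representation \<pi> \<alpha> \<iota>)) (crossed_dirac D)) = UNIV"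
proof -
  let ?\<rho> = "doubled_representation (regular_representation \<pi> \<alpha> \<iota>)"
  let ?A = "smooth_algebra ?\<rho> (crossed_dirac D)"
  note rep = doubled_representation[OF regular_representation(1)[OF \<pi> \<alpha> \<iota>]]
  have A_iff: "b \<in> ?A \<longleftrightarrow> (\<exists>T. bounded_commutator (crossed_dirac D) (?\<rho> b) T)" for b
    unfolding smooth_algebra_def using compact_op_comp_left[OF cpt representation_simps(1)[OF rep]] by simp
  have single: "\<iota> (Poly_Mapping.single n a) \<in> ?A" if "a \<in> A'" for n a
    unfolding A_iff using comm that crossed_commutator by blast
  have add: "a + b \<in> ?A" if ab: "a \<in> ?A" "b \<in> ?A" for a b
  proof -
    have eq: "?\<rho> (a + b) = (\<lambda>x. ?\<rho> a x + ?\<rho> b x)" by (simp add: fun_eq_iff representation_simps(2)[OF rep])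
    from ab obtain S T where "bounded_commutator (crossed_dirac D) (?\<rho> a) S"
        "bounded_commutator (crossed_dirac D) (?\<rho> b) T" unfolding A_iff by blast
    from bounded_commutator_add[OF crossed_dirac_self_adjoint[OF D] this]
    show ?thesis unfolding A_iff eq by - (rule exI)
  qed
  note cadd = closure_add_closed[of ?A, OF add]
  have zero: "0 \<in> closure ?A"
    using single[OF A'(1), of 0] closure_subset[of ?A] \<iota>_zero[OF \<pi> \<alpha> \<iota>] by (auto simp: single_zero)
  have csingle: "\<iota> (Poly_Mapping.single n a) \<in> closure ?A" for n a
    unfolding closure_approachable
  proof (intro allI impI)
    fix e :: real assume "e > 0"
    moreover have "a \<in> closure A'" using A'(2) by simp
    ultimately obtain b where b: "b \<in> A'" "dist b a < e" unfolding closure_approachable by blast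
    have "dist (\<iota> (Poly_Mapping.single n b)) (\<iota> (Poly_Mapping.single n a))
        = norm (\<iota> (Poly_Mapping.single n (b - a)))"
      by (simp add: dist_norm single_diff \<iota>_diff[OF \<pi> \<alpha> \<iota>])
    also have "\<dots> \<le> norm (b - a)" using norm_\<iota>_le[OF \<pi> \<alpha> \<iota>, of "Poly_Mapping.single n (b - a)"] by simp
    also have "\<dots> < e" using b(2) by (simp add: dist_norm)
    finally show "\<exists>y\<in>?A. dist y (\<iota> (Poly_Mapping.single n a)) < e" using single[OF b(1)] by blast
  qed
  have "\<iota> f \<in> closure ?A" for f
  proof -
    have "(\<Sum>n\<in>F. \<iota> (Poly_Mapping.single n (Poly_Mapping.lookup f n))) \<in> closure ?A" if "finite F" for F
      using that by (induction F rule: finite_induct) (auto intro: zero cadd csingle)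
    then show ?thesis
      by (subst poly_mapping_sum_single) (simp add: \<iota>_sum[OF \<pi> \<alpha> \<iota>])
  qed
  then have "closure (range \<iota>) \<subseteq> closure ?A" by (intro closure_minimal) auto
  then show ?thesis using \<iota>_simps(6)[OF \<pi> \<alpha> \<iota>] by auto
qed

end

section \<open>The grading and the conclusion\<close>

lemma grading_self_adjoint: "self_adjoint (Some \<circ> (grading :: 'k::chilbert_space \<times> 'k \<Rightarrow> 'k \<times> 'k))"
proof -
  have "op_adjoint (Some \<circ> grading) = Some \<circ> (grading :: 'k \<times> 'k \<Rightarrow> 'k \<times> 'k)"
    by (rule op_adjoint_totalI) (simp add: grading_def cinner_prod_def map_prod_def split_beta cinner_simps)
  then show ?thesis
    by (auto simp: self_adjoint_def densely_defined_def op_linear_def grading_def map_prod_def split_beta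
        scaleC_prod_def scaleC.minus_right dom_def zero_prod_def)
qed

theorem theorem3p4:
  fixes \<pi> :: "'a::cstar_algebra \<Rightarrow> 'h::chilbert_space \<Rightarrow> 'h"
    and D :: "'h \<rightharpoonup> 'h"
    and \<alpha> :: "'a \<Rightarrow> 'a"
    and \<iota> :: "(int \<Rightarrow>\<^sub>0 'a) \<Rightarrow> 'b::cstar_algebra"
    and A' :: "'a set"
  assumes "odd_spectral_triple \<pi> D"
    and "compact_resolvent D"
    and "cstar_automorphism \<alpha>"
    and "crossed_product \<alpha> \<iota>"
    and "A' \<subseteq> smooth_algebra \<pi> D" "complex_subalgebra A'" "closure A' = UNIV" "\<alpha> ` A' \<subseteq> A'"
    and "\<forall>a\<in>A'. \<exists>C. \<forall>n. \<exists>T. bounded_commutator D (\<pi> (zpow \<alpha> n a)) T \<and> onorm T \<le> C"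
  shows "even_spectral_triple
           (doubled_representation (regular_representation \<pi> \<alpha> \<iota>)) (crossed_dirac D) grading \<and>
         (\<forall>p>0. weakly_summable p D \<longrightarrow> weakly_summable (p + 1) (crossed_dirac D))"
proof -
  have \<pi>: "representation \<pi>" and D: "self_adjoint D"
    and sep: "\<exists>S :: 'h set. countable S \<and> closure S = UNIV"
    using assms(1) by (simp_all add: spectral_triple_def)
  note \<alpha> = assms(3) and \<iota> = assms(4)
  let ?\<rho> = "doubled_representation (regular_representation \<pi> \<alpha> \<iota>)" and ?D = "crossed_dirac D"
  \<comment> \<open>This eigenbasis serves twice: through \<open>crossed_dirac_eigenbasis\<close>
    for compactness of the inverse of 1 + \<D>^2, and for the summability estimate.\<close>
  obtain E r where E: "eigenbasis (inv_one_plus_sq D) E r"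
    using compact_positive_eigenbasis[OF compact_resolvent_inv_one_plus_sq[OF D assms(2)]
        inv_one_plus_sq_positive(1,2)[OF D]] by blast
  obtain E' r' where "eigenbasis (inv_one_plus_sq ?D) E' r'"
    using crossed_dirac_eigenbasis[OF D E] by blast
  then have cpt: "compact_op (inv_one_plus_sq ?D)" by (rule eigenbasis_compact)
  have "0 \<in> A'" using assms(6) by (simp add: complex_subalgebra_def)
  from crossed_smooth_dense[OF \<pi> D \<alpha> \<iota> this assms(7,9) cpt]
  have "spectral_triple ?\<rho> ?D"
    unfolding spectral_triple_def
    using prod_separable[OF l2Z_separable[OF sep]] crossed_dirac_self_adjoint[OF D]
      doubled_representation[OF regular_representation(1)[OF \<pi> \<alpha> \<iota>]] by blast
  moreover have "bounded_clinear (grading :: 'h l2Z \<times> 'h l2Z \<Rightarrow> _)"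
  proof -
    have "(grading :: 'h l2Z \<times> 'h l2Z \<Rightarrow> _) = (\<lambda>p. (fst p, ((\<lambda>x. (- 1) *\<^sub>C x) \<circ> snd) p))"
      by (simp add: fun_eq_iff grading_def)
    moreover have "bounded_clinear (\<lambda>p :: 'h l2Z \<times> 'h l2Z. (fst p, ((\<lambda>x. (- 1) *\<^sub>C x) \<circ> snd) p))"
      by (intro bounded_clinear_Pair bounded_clinear_comp bounded_clinear_mult bounded_clinear_id
          bounded_clinear_fst bounded_clinear_snd)
    ultimately show ?thesis by simp
  qed
  moreover have "grading \<circ> grading = (id :: 'h l2Z \<times> 'h l2Z \<Rightarrow> _)"
    by (simp add: fun_eq_iff grading_def)
  moreover have "grading \<circ> ?\<rho> b = ?\<rho> b \<circ> grading" for b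
    using bounded_clinear_simps(3)[OF representation_simps(1)[OF regular_representation(1)[OF \<pi> \<alpha> \<iota>]]]
    by (simp add: fun_eq_iff grading_def doubled_representation_def)
  moreover have anti: "?D (grading p) = Some (- grading q)" if "?D p = Some q" for p q
    using that shifted_graph_linear(3)[OF D, of 1 "snd p" "fst q" "- 1"]
    by (cases p; cases q) (simp add: crossed_dirac_iff[OF D] grading_def)
  then have "grading ` dom ?D \<subseteq> dom ?D" "\<forall>p\<in>dom ?D. the (?D (grading p)) = - grading (the (?D p))"
    by (auto simp: dom_def)
  ultimately have "even_spectral_triple ?\<rho> ?D grading"
    unfolding even_spectral_triple_def using grading_self_adjoint by blast
  then show ?thesis using crossed_dirac_weakly_summable[OF D E] by blast
qed

end
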